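(* If the metric space $Y$ is homeomorphic to a finite CW-complex and if $X$ is a convergent $Y$-space, then the canonical homomorphism $\iota_*\colon H_k(X;\mathbb R)\to\mathcal H_k(X)$ from singular homology to measure homology is injective in degrees $k\ge 2$.
   Context: Convergent $Y$-space: for a metric space $Y$, a metric space $X$ is called a convergent $Y$-space if it is a union $X=Y_\infty\cup\bigcup_{n\in\mathbb N}Y_n$ with $Y_\infty=Y$, and for each $n\in\mathbb N$ there is a homeomorphism $f_n\colon Y_\infty\to Y_n$ such that there are finitely many points $y\in Y$ with $f_n(y)=y$ for all $n\in\mathbb N$ (the identification points), and for all other points $y,y'$ one has $f_n(y)\neq y'$ and $f_n(y)\neq f_m(y')$ for all $n\neq m$, but $\lim_{n\to\infty}\mathrm{dist}(f_n(y),y)=0$ uniformly. Measure homology: let $map(\Delta^k,X)$ be the set of singular $k$-simplices with the compact-open topology and its Borel $\sigma$-algebra. $\mathcal C_k(X)$ is the real vector space of signed measures $\mu$ on $map(\Delta^k,X)$ that are compactly determined (there is a compact, not necessarily measurable or Hausdorff, set such that $\mu$ vanishes on every measurable subset of its complement) and have finite variation $\|\mu\|=\max_A\mu(A)-\min_B\mu(B)<\infty$. The operators $\partial_k=\sum_{i=0}^k(-1)^i\partial_k^i\colon\mathcal C_k(X)\to\mathcal C_{k-1}(X)$ are induced by push-forward along the face maps, and $\mathcal H_k(X)=\ker(\partial_k)/\mathrm{im}(\partial_{k+1})$. The homomorphism $\iota_*$ is induced by sending a singular simplex to its Dirac measure. *)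

theory Defs
  imports "HOL-Analysis.Analysis" "HOL-Homology.Homology" "HOL-Library.Function_Algebras"
begin

section \<open>Finite CW-complexes\<close>

text \<open>The closed unit ball of Euclidean \<open>n\<close>-space, in the representation of \<open>Euclidean_space\<close>;
  for \<open>n = 0\<close> it is one point, its open ball is that point, and its boundary sphere is empty.\<close>

definition unit_disc :: "nat \<Rightarrow> (nat \<Rightarrow> real) set" where
  "unit_disc n = {x \<in> topspace (Euclidean_space n). (\<Sum>i<n. (x i)\<^sup>2) \<le> 1}"

definition unit_open_disc :: "nat \<Rightarrow> (nat \<Rightarrow> real) set" where
  "unit_open_disc n = {x \<in> topspace (Euclidean_space n). (\<Sum>i<n. (x i)\<^sup>2) < 1}"

definition unit_disc_boundary :: "nat \<Rightarrow> (nat \<Rightarrow> real) set" where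
  "unit_disc_boundary n = {x \<in> topspace (Euclidean_space n). (\<Sum>i<n. (x i)\<^sup>2) = 1}"

text \<open>Whitehead's definition: \<open>\<E>\<close> is the set of open cells, \<open>dm e\<close> the dimension and
  \<open>\<Phi> e\<close> the characteristic map of the cell \<open>e\<close>. The last two conditions are closure finiteness and
  the weak topology.\<close>

definition CW_structure ::
  "'b topology \<Rightarrow> 'b set set \<Rightarrow> ('b set \<Rightarrow> nat) \<Rightarrow> ('b set \<Rightarrow> (nat \<Rightarrow> real) \<Rightarrow> 'b) \<Rightarrow> bool" where
  "CW_structure K \<E> dm \<Phi> \<longleftrightarrow>
     Hausdorff_space K \<and> disjoint \<E> \<and> \<Union>\<E> = topspace K \<and>
     (\<forall>e\<in>\<E>.
        continuous_map (subtopology (Euclidean_space (dm e)) (unit_disc (dm e))) K (\<Phi> e) \<and>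
        homeomorphic_map (subtopology (Euclidean_space (dm e)) (unit_open_disc (dm e)))
                         (subtopology K e) (\<Phi> e) \<and>
        \<Phi> e ` unit_disc_boundary (dm e) \<subseteq> \<Union>{e'\<in>\<E>. dm e' < dm e}) \<and>
     (\<forall>e\<in>\<E>. finite {e'\<in>\<E>. e' \<inter> (Abstract_Topology.closure_of K e) \<noteq> {}}) \<and>
     (\<forall>A \<subseteq> topspace K. (\<forall>e\<in>\<E>. closedin K (A \<inter> (Abstract_Topology.closure_of K e))) \<longrightarrow> closedin K A)"

definition finite_CW_complex :: "'b topology \<Rightarrow> bool" where
  "finite_CW_complex K \<longleftrightarrow> (\<exists>\<E> dm \<Phi>. finite \<E> \<and> CW_structure K \<E> dm \<Phi>)"


section \<open>Convergent \<open>Y\<close>-spaces\<close>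

text \<open>\<open>Y\<close> plays the role of \<open>Y\<^sub>\<infinity>\<close>, so it is a metric subspace of \<open>X\<close>; \<open>Z n\<close> is \<open>Y\<^sub>n\<close>, and \<open>P\<close> is the set
  of identification points, which may be empty.\<close>

definition convergent_space :: "'a metric \<Rightarrow> 'a metric \<Rightarrow> bool" where
  "convergent_space Y X \<longleftrightarrow>
     mspace Y \<subseteq> mspace X \<and> (\<forall>y\<in>mspace Y. \<forall>y'\<in>mspace Y. mdist Y y y' = mdist X y y') \<and>
     (\<exists>(Z :: nat \<Rightarrow> 'a set) (f :: nat \<Rightarrow> 'a \<Rightarrow> 'a).
        mspace X = mspace Y \<union> (\<Union>n. Z n) \<and>
        (\<forall>n. homeomorphic_map (mtopology_of Y) (subtopology (mtopology_of X) (Z n)) (f n)) \<and>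
        (let P = {y \<in> mspace Y. \<forall>n. f n y = y} in
           finite P \<and>
           (\<forall>y \<in> mspace Y - P. \<forall>y' \<in> mspace Y - P.
              (\<forall>n. f n y \<noteq> y') \<and> (\<forall>n m. n \<noteq> m \<longrightarrow> f n y \<noteq> f m y'))) \<and>
        uniform_limit (mspace Y) (\<lambda>n y. mdist X (f n y) y) (\<lambda>_. 0) sequentially)"


section \<open>Singular homology with real coefficients\<close>

type_synonym 'a real_chain = "((nat \<Rightarrow> real) \<Rightarrow> 'a) \<Rightarrow>\<^sub>0 real"

definition real_singular_chain_set :: "nat \<Rightarrow> 'a topology \<Rightarrow> 'a real_chain set" where
  "real_singular_chain_set k X = {c. Poly_Mapping.keys c \<subseteq> singular_simplex_set k X}"

definition real_chain_boundary :: "nat \<Rightarrow> 'a real_chain \<Rightarrow> 'a real_chain" where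
  "real_chain_boundary k c =
     (if k = 0 then 0
      else \<Sum>\<sigma>\<in>Poly_Mapping.keys c. \<Sum>i\<le>k.
             Poly_Mapping.single (singular_face k i \<sigma>) ((-1) ^ i * Poly_Mapping.lookup c \<sigma>))"

definition real_cycle_set :: "nat \<Rightarrow> 'a topology \<Rightarrow> 'a real_chain set" where
  "real_cycle_set k X = {c \<in> real_singular_chain_set k X. real_chain_boundary k c = 0}"

definition real_boundary_set :: "nat \<Rightarrow> 'a topology \<Rightarrow> 'a real_chain set" where
  "real_boundary_set k X = real_chain_boundary (Suc k) ` real_singular_chain_set (Suc k) X"

text \<open>Homology is a quotient of \<open>HOL-Algebra\<close> groups, as in \<open>HOL-Homology\<close>; this keeps the additive
  part of the real vector space structure.\<close>

definition additive_monoid :: "'c::monoid_add set \<Rightarrow> 'c monoid" where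
  "additive_monoid S = \<lparr>carrier = S, mult = (+), one = 0\<rparr>"

definition real_homology_group :: "nat \<Rightarrow> 'a topology \<Rightarrow> 'a real_chain set monoid" where
  "real_homology_group k X = additive_monoid (real_cycle_set k X) Mod real_boundary_set k X"


section \<open>Measure homology\<close>

definition compact_open_topology :: "'a topology \<Rightarrow> 'b topology \<Rightarrow> ('a \<Rightarrow> 'b) topology" where
  "compact_open_topology S T = topology_generated_by
     {{f. continuous_map S T f \<and> f \<in> extensional (topspace S) \<and> f ` C \<subseteq> U} | C U.
        compactin S C \<and> openin T U}"

definition borel_of :: "'a topology \<Rightarrow> 'a measure" where
  "borel_of T = sigma (topspace T) {U. openin T U}"

definition simplex_topology :: "nat \<Rightarrow> 'a topology \<Rightarrow> ((nat \<Rightarrow> real) \<Rightarrow> 'a) topology" where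
  "simplex_topology k X =
     compact_open_topology (subtopology (powertop_real UNIV) (standard_simplex k)) X"

abbreviation simplex_borel :: "nat \<Rightarrow> 'a topology \<Rightarrow> ((nat \<Rightarrow> real) \<Rightarrow> 'a) measure" where
  "simplex_borel k X \<equiv> borel_of (simplex_topology k X)"

text \<open>Signed measures on the \<open>\<sigma>\<close>-algebra of \<open>M\<close>. Only signed measures of finite variation occur
  below, and these have finite values, so values are taken in \<open>real\<close>. The value \<open>0\<close> on
  non-measurable sets makes the representing function unique.\<close>

definition signed_measure :: "'b measure \<Rightarrow> ('b set \<Rightarrow> real) \<Rightarrow> bool" where
  "signed_measure M \<mu> \<longleftrightarrow>
     \<mu> {} = 0 \<and>
     (\<forall>A. range A \<subseteq> sets M \<longrightarrow> disjoint_family A \<longrightarrow> (\<lambda>n. \<mu> (A n)) sums \<mu> (\<Union>n. A n)) \<and>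
     (\<forall>A. A \<notin> sets M \<longrightarrow> \<mu> A = 0)"

text \<open>The maximum and the minimum are attained by a Hahn decomposition, so \<open>SUP\<close> and \<open>INF\<close> agree
  with them; both are taken in \<open>ereal\<close> to make the norm meaningful without assuming finiteness.\<close>

definition variation_norm :: "'b measure \<Rightarrow> ('b set \<Rightarrow> real) \<Rightarrow> ereal" where
  "variation_norm M \<mu> = (SUP A\<in>sets M. ereal (\<mu> A)) - (INF B\<in>sets M. ereal (\<mu> B))"

text \<open>\<open>compactin\<close> is the finite-subcover property alone; \<open>C\<close> need be neither closed nor measurable.\<close>

definition compactly_determined :: "'b topology \<Rightarrow> ('b set \<Rightarrow> real) \<Rightarrow> bool" where
  "compactly_determined T \<mu> \<longleftrightarrow>
     (\<exists>C. compactin T C \<and> (\<forall>A \<in> sets (borel_of T). A \<inter> C = {} \<longrightarrow> \<mu> A = 0))"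

definition measure_chain_set :: "nat \<Rightarrow> 'a topology \<Rightarrow> (((nat \<Rightarrow> real) \<Rightarrow> 'a) set \<Rightarrow> real) set" where
  "measure_chain_set k X =
     {\<mu>. signed_measure (simplex_borel k X) \<mu> \<and> compactly_determined (simplex_topology k X) \<mu> \<and>
         variation_norm (simplex_borel k X) \<mu> < \<infinity>}"

definition push_forward ::
  "'b measure \<Rightarrow> 'c measure \<Rightarrow> ('b \<Rightarrow> 'c) \<Rightarrow> ('b set \<Rightarrow> real) \<Rightarrow> 'c set \<Rightarrow> real" where
  "push_forward M N f \<mu> = (\<lambda>A. if A \<in> sets N then \<mu> (f -` A \<inter> space M) else 0)"

definition measure_boundary :: "nat \<Rightarrow> 'a topology \<Rightarrow>
    (((nat \<Rightarrow> real) \<Rightarrow> 'a) set \<Rightarrow> real) \<Rightarrow> ((nat \<Rightarrow> real) \<Rightarrow> 'a) set \<Rightarrow> real" where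
  "measure_boundary k X \<mu> =
     (if k = 0 then 0
      else (\<lambda>A. \<Sum>i\<le>k. (-1) ^ i *
              push_forward (simplex_borel k X) (simplex_borel (k - 1) X) (singular_face k i) \<mu> A))"

definition measure_cycle_set :: "nat \<Rightarrow> 'a topology \<Rightarrow> (((nat \<Rightarrow> real) \<Rightarrow> 'a) set \<Rightarrow> real) set" where
  "measure_cycle_set k X = {\<mu> \<in> measure_chain_set k X. measure_boundary k X \<mu> = 0}"

definition measure_boundary_set :: "nat \<Rightarrow> 'a topology \<Rightarrow> (((nat \<Rightarrow> real) \<Rightarrow> 'a) set \<Rightarrow> real) set" where
  "measure_boundary_set k X = measure_boundary (Suc k) X ` measure_chain_set (Suc k) X"

definition measure_homology_group ::
  "nat \<Rightarrow> 'a topology \<Rightarrow> (((nat \<Rightarrow> real) \<Rightarrow> 'a) set \<Rightarrow> real) set monoid" where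
  "measure_homology_group k X = additive_monoid (measure_cycle_set k X) Mod measure_boundary_set k X"


section \<open>The canonical homomorphism\<close>

definition dirac :: "'b measure \<Rightarrow> 'b \<Rightarrow> 'b set \<Rightarrow> real" where
  "dirac M x = (\<lambda>A. if A \<in> sets M then indicat_real A x else 0)"

definition iota_chain :: "nat \<Rightarrow> 'a topology \<Rightarrow> 'a real_chain \<Rightarrow> ((nat \<Rightarrow> real) \<Rightarrow> 'a) set \<Rightarrow> real" where
  "iota_chain k X c =
     (\<lambda>A. \<Sum>\<sigma>\<in>Poly_Mapping.keys c. Poly_Mapping.lookup c \<sigma> * dirac (simplex_borel k X) \<sigma> A)"

text \<open>For a homology class \<open>h\<close> all cosets in this union coincide; see \<open>iota_homology_coset\<close>.\<close>

definition iota_homology ::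
  "nat \<Rightarrow> 'a topology \<Rightarrow> 'a real_chain set \<Rightarrow> (((nat \<Rightarrow> real) \<Rightarrow> 'a) set \<Rightarrow> real) set" where
  "iota_homology k X h =
     (\<Union>c\<in>h. measure_boundary_set k X #>\<^bsub>additive_monoid (measure_cycle_set k X)\<^esub> iota_chain k X c)"


section \<open>The canonical homomorphism is well defined\<close>

definition chain_eval :: "(((nat \<Rightarrow> real) \<Rightarrow> 'a) \<Rightarrow> real) \<Rightarrow> 'a real_chain \<Rightarrow> real" where
  "chain_eval \<phi> c = (\<Sum>\<sigma>\<in>Poly_Mapping.keys c. Poly_Mapping.lookup c \<sigma> * \<phi> \<sigma>)"

lemma chain_eval_superset:
  assumes "finite S" "Poly_Mapping.keys c \<subseteq> S"
  shows "chain_eval \<phi> c = (\<Sum>\<sigma>\<in>S. Poly_Mapping.lookup c \<sigma> * \<phi> \<sigma>)"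
  unfolding chain_eval_def using assms
  by (intro sum.mono_neutral_left) (auto simp: in_keys_iff)

lemma chain_eval_0 [simp]: "chain_eval \<phi> 0 = 0"
  by (simp add: chain_eval_def)

lemma chain_eval_single [simp]: "chain_eval \<phi> (Poly_Mapping.single s r) = r * \<phi> s"
  by (simp add: chain_eval_def)

lemma chain_eval_add [simp]: "chain_eval \<phi> (a + b) = chain_eval \<phi> a + chain_eval \<phi> b"
proof -
  let ?S = "Poly_Mapping.keys a \<union> Poly_Mapping.keys b"
  have "chain_eval \<phi> (a + b) = (\<Sum>\<sigma>\<in>?S. Poly_Mapping.lookup (a + b) \<sigma> * \<phi> \<sigma>)"
    by (intro chain_eval_superset) (auto simp: Poly_Mapping.keys_add)
  also have "\<dots> = (\<Sum>\<sigma>\<in>?S. Poly_Mapping.lookup a \<sigma> * \<phi> \<sigma>) + (\<Sum>\<sigma>\<in>?S. Poly_Mapping.lookup b \<sigma> * \<phi> \<sigma>)"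
    by (simp add: lookup_add distrib_right sum.distrib)
  also have "\<dots> = chain_eval \<phi> a + chain_eval \<phi> b"
    by (simp add: chain_eval_superset[of ?S, symmetric])
  finally show ?thesis .
qed

lemma chain_eval_uminus [simp]: "chain_eval \<phi> (- a) = - chain_eval \<phi> a"
  using chain_eval_add[of \<phi> a "- a"] by simp

lemma chain_eval_sum [simp]: "chain_eval \<phi> (\<Sum>i\<in>I. c i) = (\<Sum>i\<in>I. chain_eval \<phi> (c i))"
  by (induction I rule: infinite_finite_induct) auto

lemma lookup_eq_chain_eval: "Poly_Mapping.lookup c \<tau> = chain_eval (indicat_real {\<tau>}) c"
proof -
  have "chain_eval (indicat_real {\<tau>}) c =
        (\<Sum>\<sigma>\<in>insert \<tau> (Poly_Mapping.keys c). Poly_Mapping.lookup c \<sigma> * indicat_real {\<tau>} \<sigma>)"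
    by (intro chain_eval_superset) auto
  also have "\<dots> = Poly_Mapping.lookup c \<tau> +
      (\<Sum>\<sigma>\<in>Poly_Mapping.keys c - {\<tau>}. Poly_Mapping.lookup c \<sigma> * indicat_real {\<tau>} \<sigma>)"
    by (subst sum.insert_remove) auto
  also have "(\<Sum>\<sigma>\<in>Poly_Mapping.keys c - {\<tau>}. Poly_Mapping.lookup c \<sigma> * indicat_real {\<tau>} \<sigma>) = 0"
    by (intro sum.neutral) auto
  finally show ?thesis by simp
qed

lemma real_chain_eqI:
  "(\<And>\<tau>. chain_eval (indicat_real {\<tau>}) c = chain_eval (indicat_real {\<tau>}) d) \<Longrightarrow> c = d"
  by (intro poly_mapping_eqI) (simp add: lookup_eq_chain_eval)

lemma chain_eval_boundary:
  "chain_eval \<phi> (real_chain_boundary k c) =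
     (if k = 0 then 0 else chain_eval (\<lambda>\<sigma>. \<Sum>i\<le>k. (-1) ^ i * \<phi> (singular_face k i \<sigma>)) c)"
  by (simp add: real_chain_boundary_def)
     (simp add: chain_eval_def sum_distrib_left algebra_simps)

lemma real_chain_boundary_add:
  "real_chain_boundary k (a + b) = real_chain_boundary k a + real_chain_boundary k b"
  by (intro real_chain_eqI) (simp add: chain_eval_boundary)

lemma real_chain_boundary_uminus:
  "real_chain_boundary k (- a) = - real_chain_boundary k a"
  by (intro real_chain_eqI) (simp add: chain_eval_boundary)

lemma real_chain_boundary_0: "real_chain_boundary k 0 = 0"
  by (intro real_chain_eqI) (simp add: chain_eval_boundary)

lemma singular_face_face:
  assumes "i \<le> j" "j \<le> Suc n"
  shows "singular_face (Suc n) i (singular_face (Suc (Suc n)) (Suc j) \<sigma>) =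
         singular_face (Suc n) j (singular_face (Suc (Suc n)) i \<sigma>)"
proof
  fix t
  show "singular_face (Suc n) i (singular_face (Suc (Suc n)) (Suc j) \<sigma>) t =
        singular_face (Suc n) j (singular_face (Suc (Suc n)) i \<sigma>) t"
  proof (cases "t \<in> standard_simplex n")
    case True
    have fi: "simplical_face i t \<in> standard_simplex (Suc n)"
      using simplical_face_in_standard_simplex[of "Suc n" i t] True assms by simp
    have fj: "simplical_face j t \<in> standard_simplex (Suc n)"
      using simplical_face_in_standard_simplex[of "Suc n" j t] True assms by simp
    have "simplical_face (Suc j) (simplical_face i t) = simplical_face i (simplical_face j t)"
      using True assms unfolding standard_simplex_def simplical_face_def by fastforce
    then show ?thesis by (simp add: singular_face_def fi fj)
  qed (simp add: singular_face_def)
qed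

lemma alternating_double_sum:
  fixes F :: "nat \<Rightarrow> nat \<Rightarrow> real"
  assumes F: "\<And>i j. i \<le> j \<Longrightarrow> j \<le> n \<Longrightarrow> F (Suc j) i = F i j"
  shows "(\<Sum>x\<le>Suc n. \<Sum>i\<le>n. (-1) ^ (x + i) * F x i) = 0"
proof -
  let ?g = "\<lambda>(x,i). (-1) ^ (x + i) * F x i"
  have eql: "{..Suc n} \<times> {..n} \<inter> {(x, y). y < x} = (\<lambda>(i,j). (Suc j, i)) ` {(i,j). i \<le> j \<and> j \<le> n}"
    by (auto simp: image_def) (metis Suc_le_mono less_Suc_eq_le Suc_pred gr_zeroI not_less_zero)
  have eqr: "{..Suc n} \<times> {..n} - {(x, y). y < x} = {(i,j). i \<le> j \<and> j \<le> n}"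
    by auto
  have "(\<Sum>x\<le>Suc n. \<Sum>i\<le>n. (-1) ^ (x + i) * F x i) = sum ?g ({..Suc n} \<times> {..n})"
    by (simp only: sum.cartesian_product)
  also have "\<dots> = sum ?g ((\<lambda>(i,j). (Suc j, i)) ` {(i,j). i \<le> j \<and> j \<le> n})
                + sum ?g {(i,j). i \<le> j \<and> j \<le> n}"
    by (subst sum.Int_Diff [of "_ \<times> _" _ "{(x,y). y < x}"]) (simp_all only: eql eqr finite_cartesian_product finite_atMost)
  also have "sum ?g ((\<lambda>(i,j). (Suc j, i)) ` {(i,j). i \<le> j \<and> j \<le> n})
           = (\<Sum>(i,j)\<in>{(i,j). i \<le> j \<and> j \<le> n}. - ((-1) ^ (i + j) * F i j))"
    by (subst sum.reindex) (auto simp: inj_on_def F add.commute intro!: sum.cong)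
  also have "\<dots> = - sum ?g {(i,j). i \<le> j \<and> j \<le> n}"
    by (simp add: sum_negf[symmetric] split_def)
  finally show ?thesis by simp
qed

lemma real_chain_boundary_boundary:
  "real_chain_boundary k (real_chain_boundary (Suc k) c) = 0"
proof (cases k)
  case (Suc n)
  have *: "(\<Sum>i\<le>Suc (Suc n). (-1) ^ i * (\<Sum>j\<le>Suc n. (-1) ^ j *
           indicat_real {\<tau>} (singular_face (Suc n) j (singular_face (Suc (Suc n)) i \<sigma>)))) = 0" for \<sigma> \<tau>
    using alternating_double_sum[of "Suc n" "\<lambda>i j. indicat_real {\<tau>} (singular_face (Suc n) j (singular_face (Suc (Suc n)) i \<sigma>))"]
    by (simp only: singular_face_face sum_distrib_left power_add mult.assoc)
  show ?thesis
    unfolding Suc by (intro real_chain_eqI) (simp only: chain_eval_boundary *, simp add: chain_eval_def)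
qed (simp add: real_chain_boundary_def)

lemma real_chain_boundary_in:
  assumes "c \<in> real_singular_chain_set (Suc k) X"
  shows "real_chain_boundary (Suc k) c \<in> real_singular_chain_set k X"
proof -
  have "\<sigma> \<in> singular_simplex_set k X" if "Poly_Mapping.lookup (real_chain_boundary (Suc k) c) \<sigma> \<noteq> 0" for \<sigma>
  proof (rule ccontr)
    assume n: "\<sigma> \<notin> singular_simplex_set k X"
    have "(\<Sum>i\<le>Suc k. (-1) ^ i * indicat_real {\<sigma>} (singular_face (Suc k) i \<tau>)) = 0"
      if "\<tau> \<in> Poly_Mapping.keys c" for \<tau>
    proof (intro sum.neutral ballI)
      fix i assume "i \<in> {..Suc k}"
      then have "singular_simplex k X (singular_face (Suc k) i \<tau>)"
        using singular_simplex_singular_face[of "Suc k" X \<tau> i] that assms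
        by (auto simp: real_singular_chain_set_def)
      with n show "(-1) ^ i * indicat_real {\<sigma>} (singular_face (Suc k) i \<tau>) = 0"
        by (auto simp: indicator_def)
    qed
    with that show False
      unfolding lookup_eq_chain_eval chain_eval_boundary
      by (simp add: chain_eval_def del: sum.atMost_Suc)
  qed
  then show ?thesis
    by (auto simp: real_singular_chain_set_def in_keys_iff)
qed

definition add_closed :: "'c::ab_group_add set \<Rightarrow> bool" where
  "add_closed S \<longleftrightarrow> 0 \<in> S \<and> (\<forall>a\<in>S. \<forall>b\<in>S. a + b \<in> S) \<and> (\<forall>a\<in>S. - a \<in> S)"

lemma comm_group_additive_monoid:
  assumes "add_closed S" shows "comm_group (additive_monoid S)"
proof (rule comm_groupI)
  fix x assume "x \<in> carrier (additive_monoid S)"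
  then show "\<exists>y\<in>carrier (additive_monoid S). y \<otimes>\<^bsub>additive_monoid S\<^esub> x = \<one>\<^bsub>additive_monoid S\<^esub>"
    using assms by (intro bexI[of _ "- x"]) (auto simp: additive_monoid_def add_closed_def)
qed (use assms in \<open>auto simp: additive_monoid_def add_closed_def add_ac\<close>)

lemma inv_additive_monoid:
  assumes "add_closed S" "x \<in> S"
  shows "inv\<^bsub>additive_monoid S\<^esub> x = - x"
proof -
  interpret comm_group "additive_monoid S" by (rule comm_group_additive_monoid) fact
  have "- x \<otimes>\<^bsub>additive_monoid S\<^esub> x = \<one>\<^bsub>additive_monoid S\<^esub>"
    by (simp add: additive_monoid_def)
  moreover have "x \<in> carrier (additive_monoid S)" "- x \<in> carrier (additive_monoid S)"
    using assms by (auto simp: additive_monoid_def add_closed_def)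
  ultimately show ?thesis by (rule inv_equality)
qed

lemma subgroup_additive_monoid:
  assumes "add_closed S" "add_closed T" "T \<subseteq> S"
  shows "subgroup T (additive_monoid S)"
proof
  show "T \<subseteq> carrier (additive_monoid S)" using assms by (simp add: additive_monoid_def)
  show "inv\<^bsub>additive_monoid S\<^esub> x \<in> T" if "x \<in> T" for x
    using that assms by (subst inv_additive_monoid) (auto simp: add_closed_def)
qed (use assms in \<open>auto simp: additive_monoid_def add_closed_def\<close>)

lemma normal_additive_monoid:
  assumes "add_closed S" "add_closed T" "T \<subseteq> S"
  shows "T \<lhd> additive_monoid S"
  using comm_group.subgroup_imp_normal[OF comm_group_additive_monoid subgroup_additive_monoid] assms
  by blast

lemma add_closed_real_chains: "add_closed (real_singular_chain_set k X)"
  using Poly_Mapping.keys_add by (fastforce simp: add_closed_def real_singular_chain_set_def)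

lemma add_closed_real_cycles: "add_closed (real_cycle_set k X)"
  using add_closed_real_chains[of k X]
  by (auto simp: add_closed_def real_cycle_set_def real_chain_boundary_add
      real_chain_boundary_uminus real_chain_boundary_0)

lemma add_closed_real_boundaries: "add_closed (real_boundary_set k X)"
  using add_closed_real_chains[of "Suc k" X] unfolding real_boundary_set_def add_closed_def
  by (auto simp flip: real_chain_boundary_add real_chain_boundary_uminus)
     (metis image_eqI real_chain_boundary_0)

lemma real_boundaries_subset_cycles: "real_boundary_set k X \<subseteq> real_cycle_set k X"
  by (auto simp: real_boundary_set_def real_cycle_set_def real_chain_boundary_in
      real_chain_boundary_boundary)

lemma topspace_simplex_topology [simp]: "topspace (simplex_topology k X) = singular_simplex_set k X"
proof
  let ?D = "subtopology (powertop_real UNIV) (standard_simplex k)"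
  show "topspace (simplex_topology k X) \<subseteq> singular_simplex_set k X"
    unfolding simplex_topology_def compact_open_topology_def topology_generated_by_topspace
    by (auto simp: singular_simplex_def)
  have "singular_simplex_set k X =
      {f. continuous_map ?D X f \<and> f \<in> extensional (topspace ?D) \<and> f ` {} \<subseteq> {}}"
    by (auto simp: singular_simplex_def)
  moreover have "compactin ?D {}" "openin X {}" by simp_all
  ultimately have "openin (simplex_topology k X) (singular_simplex_set k X)"
    unfolding simplex_topology_def compact_open_topology_def
    by (intro topology_generated_by_Basis) blast
  then show "singular_simplex_set k X \<subseteq> topspace (simplex_topology k X)"
    by (rule openin_subset)
qed

lemma space_borel_of [simp]: "space (borel_of T) = topspace T"
  unfolding borel_of_def by (subst space_measure_of) (auto dest: openin_subset)

lemma measurable_borel_of: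
  assumes "continuous_map S T f" shows "f \<in> borel_of S \<rightarrow>\<^sub>M borel_of T"
  unfolding borel_of_def[of T]
proof (rule measurable_measure_of)
  show "{U. openin T U} \<subseteq> Pow (topspace T)" by (auto dest: openin_subset)
  have sp: "space (borel_of S) = topspace S"
    unfolding borel_of_def by (subst space_measure_of) (auto dest: openin_subset)
  show "f \<in> space (borel_of S) \<rightarrow> topspace T"
    using assms by (auto simp: sp continuous_map_def)
  fix U assume "U \<in> {U. openin T U}"
  then have "openin S (f -` U \<inter> topspace S)"
    using assms by (simp add: continuous_map_alt)
  then show "f -` U \<inter> space (borel_of S) \<in> sets (borel_of S)"
    unfolding sp unfolding borel_of_def
    by (subst sets_measure_of) (auto dest: openin_subset)
qed

lemma continuous_simplical_face:
  assumes "i \<le> Suc k"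
  shows "continuous_map (subtopology (powertop_real UNIV) (standard_simplex k))
           (subtopology (powertop_real UNIV) (standard_simplex (Suc k))) (simplical_face i)"
proof -
  have 0: "simplical_face i \<in> standard_simplex k \<rightarrow> standard_simplex (Suc k)"
    using assms simplical_face_in_standard_simplex[of "Suc k" i] by auto
  show ?thesis
  proof (clarsimp simp add: continuous_map_in_subtopology continuous_map_componentwise 0)
    fix j
    have "continuous_map (powertop_real UNIV) euclideanreal
            (\<lambda>x. if j < i then x j else if j = i then 0 else x (j - 1))"
      by (auto intro: continuous_map_product_projection)
    then show "continuous_map (subtopology (powertop_real UNIV) (standard_simplex k)) euclideanreal
                              (\<lambda>x. simplical_face i x j)"
      by (simp add: simplical_face_def continuous_map_from_subtopology)
  qed
qed

lemma continuous_singular_face: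
  assumes "i \<le> Suc k"
  shows "continuous_map (simplex_topology (Suc k) X) (simplex_topology k X) (singular_face (Suc k) i)"
proof -
  let ?D = "\<lambda>k. subtopology (powertop_real UNIV) (standard_simplex k)"
  have face: "singular_face (Suc k) i \<sigma> \<in> singular_simplex_set k X" if "\<sigma> \<in> singular_simplex_set (Suc k) X" for \<sigma>
    using singular_simplex_singular_face[of "Suc k" X \<sigma> i] that assms by auto
  have "openin (simplex_topology (Suc k) X) (singular_face (Suc k) i -` V \<inter> topspace (simplex_topology (Suc k) X))"
    if V: "V = {f. continuous_map (?D k) X f \<and> f \<in> extensional (topspace (?D k)) \<and> f ` C \<subseteq> U}"
      and C: "compactin (?D k) C" and U: "openin X U" for V C U
  proof -
    have C': "compactin (?D (Suc k)) (simplical_face i ` C)"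
      using image_compactin[OF C continuous_simplical_face[OF assms]] .
    have Csub: "C \<subseteq> standard_simplex k"
      using C by (auto simp: compactin_def)
    have "singular_face (Suc k) i -` V \<inter> topspace (simplex_topology (Suc k) X) =
       {f. continuous_map (?D (Suc k)) X f \<and> f \<in> extensional (topspace (?D (Suc k))) \<and> f ` (simplical_face i ` C) \<subseteq> U}"
      (is "?L = ?R")
    proof -
      have "(singular_face (Suc k) i \<sigma>) ` C = \<sigma> ` (simplical_face i ` C)" for \<sigma> :: "(nat \<Rightarrow> real) \<Rightarrow> 'a"
        using Csub by (auto simp: singular_face_def image_image intro!: image_cong)
      then show ?thesis
        using face by (fastforce simp: V singular_simplex_def)
    qed
    also have "openin (simplex_topology (Suc k) X) \<dots>"
      unfolding simplex_topology_def compact_open_topology_def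
      by (rule topology_generated_by_Basis) (use C' U in auto)
    finally show ?thesis .
  qed
  moreover have "singular_face (Suc k) i ` topspace (simplex_topology (Suc k) X)
      \<subseteq> topspace (simplex_topology k X)"
    using face by auto
  ultimately show ?thesis
    unfolding simplex_topology_def[of k] compact_open_topology_def
    unfolding topology_generated_by_topspace
    by (intro continuous_on_generated_topo) blast+
qed

lemma measurable_singular_face:
  "i \<le> Suc k \<Longrightarrow> singular_face (Suc k) i \<in> simplex_borel (Suc k) X \<rightarrow>\<^sub>M simplex_borel k X"
  by (intro measurable_borel_of continuous_singular_face)

lemma variation_finite_iff:
  assumes "\<mu> {} = 0"
  shows "variation_norm M \<mu> < \<infinity> \<longleftrightarrow> (\<exists>b. \<forall>A\<in>sets M. \<bar>\<mu> A\<bar> \<le> b)"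
proof
  assume L: "variation_norm M \<mu> < \<infinity>"
  let ?S = "SUP A\<in>sets M. ereal (\<mu> A)" and ?I = "INF B\<in>sets M. ereal (\<mu> B)"
  have S0: "0 \<le> ?S" using assms by (intro SUP_upper2[of "{}"]) (auto simp: zero_ereal_def)
  have I0: "?I \<le> 0" using assms by (intro INF_lower2[of "{}"]) (auto simp: zero_ereal_def)
  from L S0 I0 have S: "?S < \<infinity>" and I: "- \<infinity> < ?I"
    unfolding variation_norm_def by (cases ?S; cases ?I; simp)+
  from S0 S obtain s where s: "?S = ereal s" by (cases ?S) auto
  from I0 I obtain i where i: "?I = ereal i" by (cases ?I) auto
  have "\<bar>\<mu> A\<bar> \<le> max s (- i)" if "A \<in> sets M" for A
  proof -
    have "ereal (\<mu> A) \<le> ereal s" unfolding s[symmetric] using that by (intro SUP_upper)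
    moreover have "ereal i \<le> ereal (\<mu> A)" unfolding i[symmetric] using that by (intro INF_lower)
    ultimately show ?thesis by (auto simp: abs_if)
  qed
  then show "\<exists>b. \<forall>A\<in>sets M. \<bar>\<mu> A\<bar> \<le> b" by blast
next
  assume "\<exists>b. \<forall>A\<in>sets M. \<bar>\<mu> A\<bar> \<le> b"
  then obtain b where b: "\<And>A. A \<in> sets M \<Longrightarrow> \<bar>\<mu> A\<bar> \<le> b" by blast
  have "(SUP A\<in>sets M. ereal (\<mu> A)) \<le> ereal b"
    using b by (intro SUP_least) (auto simp: abs_le_iff)
  moreover have "ereal (- b) \<le> (INF B\<in>sets M. ereal (\<mu> B))"
    using b by (intro INF_greatest) (force simp: abs_le_iff)
  ultimately have "variation_norm M \<mu> \<le> ereal b - ereal (- b)"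
    unfolding variation_norm_def by (intro ereal_minus_mono)
  also have "\<dots> < \<infinity>" by simp
  finally show "variation_norm M \<mu> < \<infinity>" .
qed

lemma measure_chain_set_iff:
  "\<mu> \<in> measure_chain_set k X \<longleftrightarrow>
     signed_measure (simplex_borel k X) \<mu> \<and> compactly_determined (simplex_topology k X) \<mu> \<and>
     (\<exists>b. \<forall>A\<in>sets (simplex_borel k X). \<bar>\<mu> A\<bar> \<le> b)"
  using variation_finite_iff[of \<mu> "simplex_borel k X"]
  by (simp only: measure_chain_set_def mem_Collect_eq signed_measure_def) blast

lemma signed_measure_0: "signed_measure M 0"
  by (auto simp: signed_measure_def)

lemma signed_measure_add: "signed_measure M \<mu> \<Longrightarrow> signed_measure M \<nu> \<Longrightarrow> signed_measure M (\<mu> + \<nu>)"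
  by (auto simp: signed_measure_def intro: sums_add)

lemma signed_measure_cmult: "signed_measure M \<mu> \<Longrightarrow> signed_measure M (\<lambda>A. r * \<mu> A)"
  by (auto simp: signed_measure_def intro: sums_mult)

lemma measure_chain_0: "0 \<in> measure_chain_set k X"
  by (auto simp: measure_chain_set_iff signed_measure_0 compactly_determined_def
      intro: exI[of _ "{}"] exI[of _ 0])

lemma measure_chain_add:
  assumes "\<mu> \<in> measure_chain_set k X" "\<nu> \<in> measure_chain_set k X"
  shows "\<mu> + \<nu> \<in> measure_chain_set k X"
proof -
  obtain b b' where b: "\<And>A. A\<in>sets (simplex_borel k X) \<Longrightarrow> \<bar>\<mu> A\<bar> \<le> b"
    "\<And>A. A\<in>sets (simplex_borel k X) \<Longrightarrow> \<bar>\<nu> A\<bar> \<le> b'"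
    using assms by (auto simp: measure_chain_set_iff)
  then have "\<forall>A\<in>sets (simplex_borel k X). \<bar>(\<mu> + \<nu>) A\<bar> \<le> b + b'"
    by (auto intro!: order_trans[OF abs_triangle_ineq] add_mono)
  moreover obtain C D where CD: "compactin (simplex_topology k X) C" "compactin (simplex_topology k X) D"
    "\<And>A. A \<in> sets (simplex_borel k X) \<Longrightarrow> A \<inter> C = {} \<Longrightarrow> \<mu> A = 0"
    "\<And>A. A \<in> sets (simplex_borel k X) \<Longrightarrow> A \<inter> D = {} \<Longrightarrow> \<nu> A = 0"
    using assms by (auto simp: measure_chain_set_iff compactly_determined_def)
  then have "compactly_determined (simplex_topology k X) (\<mu> + \<nu>)"
    unfolding compactly_determined_def
    by (intro exI[of _ "C \<union> D"]) (auto simp: compactin_Un Int_Un_distrib)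
  ultimately show ?thesis
    using assms unfolding measure_chain_set_iff by (blast intro: signed_measure_add)
qed

lemma measure_chain_cmult:
  assumes "\<mu> \<in> measure_chain_set k X"
  shows "(\<lambda>A. r * \<mu> A) \<in> measure_chain_set k X"
proof -
  obtain b where b: "\<And>A. A\<in>sets (simplex_borel k X) \<Longrightarrow> \<bar>\<mu> A\<bar> \<le> b"
    using assms by (auto simp: measure_chain_set_iff)
  then have "\<forall>A\<in>sets (simplex_borel k X). \<bar>r * \<mu> A\<bar> \<le> \<bar>r\<bar> * b"
    by (auto simp: abs_mult intro!: mult_left_mono)
  moreover have "compactly_determined (simplex_topology k X) (\<lambda>A. r * \<mu> A)"
    using assms by (fastforce simp: measure_chain_set_iff compactly_determined_def)
  ultimately show ?thesis
    using assms unfolding measure_chain_set_iff by (blast intro: signed_measure_cmult)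
qed

lemma measure_chain_uminus: "\<mu> \<in> measure_chain_set k X \<Longrightarrow> - \<mu> \<in> measure_chain_set k X"
  using measure_chain_cmult[of \<mu> k X "-1"] by (simp add: fun_Compl_def)

lemma measure_chain_sum:
  assumes "\<And>i. i \<in> I \<Longrightarrow> \<mu> i \<in> measure_chain_set k X"
  shows "(\<lambda>A. \<Sum>i\<in>I. r i * \<mu> i A) \<in> measure_chain_set k X"
  using assms
proof (induction I rule: infinite_finite_induct)
  case (insert i I)
  then have "(\<lambda>A. r i * \<mu> i A) + (\<lambda>A. \<Sum>i\<in>I. r i * \<mu> i A) \<in> measure_chain_set k X"
    by (intro measure_chain_add measure_chain_cmult) auto
  with insert show ?case by (simp add: plus_fun_def)
qed (use measure_chain_0 in \<open>auto simp: zero_fun_def\<close>)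

lemma dirac_in: 
  assumes "\<sigma> \<in> singular_simplex_set k X"
  shows "dirac (simplex_borel k X) \<sigma> \<in> measure_chain_set k X"
proof -
  let ?M = "simplex_borel k X"
  have "(\<lambda>n. dirac ?M \<sigma> (A n)) sums dirac ?M \<sigma> (\<Union>n. A n)"
    if "range A \<subseteq> sets ?M" "disjoint_family A" for A :: "nat \<Rightarrow> _"
  proof -
    have "(\<lambda>n. indicat_real (A n) \<sigma>) sums indicat_real (\<Union>n. A n) \<sigma>"
    proof (cases "\<exists>n. \<sigma> \<in> A n")
      case True
      then obtain n where n: "\<sigma> \<in> A n" by blast
      have "\<sigma> \<notin> A m" if "m \<noteq> n" for m
        using n that \<open>disjoint_family A\<close> by (auto simp: disjoint_family_on_def)
      then have "(\<lambda>m. indicat_real (A m) \<sigma>) = (\<lambda>m. if m = n then 1 else 0)"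
        using n by (auto simp: indicator_def fun_eq_iff)
      moreover have "indicat_real (\<Union>n. A n) \<sigma> = 1" using n by (auto simp: indicator_def)
      ultimately show ?thesis using sums_single[of n "\<lambda>_. 1::real"] by simp
    qed (auto simp: indicator_def)
    moreover have "(\<Union>n. A n) \<in> sets ?M" using that by auto
    ultimately show ?thesis using that by (auto simp: dirac_def range_subsetD)
  qed
  then have "signed_measure ?M (dirac ?M \<sigma>)"
    unfolding signed_measure_def by (simp add: dirac_def)
  moreover have "compactly_determined (simplex_topology k X) (dirac ?M \<sigma>)"
    unfolding compactly_determined_def using assms
    by (intro exI[of _ "{\<sigma>}"]) (auto simp: dirac_def indicator_def)
  moreover have "\<forall>A\<in>sets ?M. \<bar>dirac ?M \<sigma> A\<bar> \<le> 1"
    by (auto simp: dirac_def indicator_def)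
  ultimately show ?thesis unfolding measure_chain_set_iff by blast
qed

lemma iota_chain_in:
  assumes "c \<in> real_singular_chain_set k X"
  shows "iota_chain k X c \<in> measure_chain_set k X"
  unfolding iota_chain_def using assms
  by (intro measure_chain_sum dirac_in) (auto simp: real_singular_chain_set_def)

lemma iota_chain_eval: "iota_chain k X c A = chain_eval (\<lambda>\<sigma>. dirac (simplex_borel k X) \<sigma> A) c"
  by (simp add: iota_chain_def chain_eval_def)

lemma iota_chain_add: "iota_chain k X (a + b) = iota_chain k X a + iota_chain k X b"
  by (auto simp: iota_chain_eval)

lemma iota_chain_0: "iota_chain k X 0 = 0"
  by (auto simp: iota_chain_eval)

lemma push_forward_in:
  assumes "\<mu> \<in> measure_chain_set (Suc k) X" "i \<le> Suc k"
  shows "push_forward (simplex_borel (Suc k) X) (simplex_borel k X) (singular_face (Suc k) i) \<mu>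
         \<in> measure_chain_set k X"
proof -
  let ?M = "simplex_borel (Suc k) X" and ?N = "simplex_borel k X" and ?f = "singular_face (Suc k) i"
  let ?\<nu> = "push_forward ?M ?N ?f \<mu>"
  have f: "?f \<in> ?M \<rightarrow>\<^sub>M ?N" using assms(2) by (rule measurable_singular_face)
  have sm: "signed_measure ?M \<mu>" using assms by (simp add: measure_chain_set_iff)
  have "(\<lambda>n. ?\<nu> (A n)) sums ?\<nu> (\<Union>n. A n)" if "range A \<subseteq> sets ?N" "disjoint_family A" for A :: "nat \<Rightarrow> _"
  proof -
    let ?B = "\<lambda>n. ?f -` A n \<inter> space ?M"
    have "range ?B \<subseteq> sets ?M" using that measurable_sets[OF f] by blast
    moreover have "disjoint_family ?B" using that by (fastforce simp: disjoint_family_on_def)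
    ultimately have "(\<lambda>n. \<mu> (?B n)) sums \<mu> (\<Union>n. ?B n)"
      using sm unfolding signed_measure_def by blast
    moreover have "(\<Union>n. ?B n) = ?f -` (\<Union>n. A n) \<inter> space ?M" by auto
    moreover have "(\<Union>n. A n) \<in> sets ?N" "\<And>n. A n \<in> sets ?N" using that by auto
    ultimately show ?thesis by (simp add: push_forward_def)
  qed
  then have "signed_measure ?N ?\<nu>"
    using sm unfolding signed_measure_def by (simp add: push_forward_def)
  moreover have "compactly_determined (simplex_topology k X) ?\<nu>"
  proof -
    obtain C where C: "compactin (simplex_topology (Suc k) X) C"
      "\<And>A. A \<in> sets ?M \<Longrightarrow> A \<inter> C = {} \<Longrightarrow> \<mu> A = 0"
      using assms by (auto simp: measure_chain_set_iff compactly_determined_def)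
    have "compactin (simplex_topology k X) (?f ` C)"
      using image_compactin[OF C(1) continuous_singular_face[OF assms(2)]] .
    moreover have "?\<nu> A = 0" if "A \<in> sets ?N" "A \<inter> ?f ` C = {}" for A
      using that measurable_sets[OF f that(1)] by (auto simp: push_forward_def intro!: C(2))
    ultimately show ?thesis unfolding compactly_determined_def by blast
  qed
  moreover obtain b where b: "\<And>A. A\<in>sets ?M \<Longrightarrow> \<bar>\<mu> A\<bar> \<le> b"
    using assms by (auto simp: measure_chain_set_iff)
  then have "\<forall>A\<in>sets ?N. \<bar>?\<nu> A\<bar> \<le> b"
    using measurable_sets[OF f] by (auto simp: push_forward_def)
  ultimately show ?thesis unfolding measure_chain_set_iff by blast
qed

lemma measure_boundary_in:
  assumes "\<mu> \<in> measure_chain_set (Suc k) X"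
  shows "measure_boundary (Suc k) X \<mu> \<in> measure_chain_set k X"
proof -
  have "(\<lambda>A. \<Sum>i\<le>Suc k. (-1) ^ i * push_forward (simplex_borel (Suc k) X) (simplex_borel k X) (singular_face (Suc k) i) \<mu> A)
     \<in> measure_chain_set k X"
    using assms by (intro measure_chain_sum push_forward_in) auto
  then show ?thesis by (simp add: measure_boundary_def del: sum.atMost_Suc)
qed

lemma measure_boundary_add: "measure_boundary k X (\<mu> + \<nu>) = measure_boundary k X \<mu> + measure_boundary k X \<nu>"
  by (auto simp: measure_boundary_def push_forward_def fun_eq_iff distrib_left simp flip: sum.distrib intro!: sum.cong)

lemma measure_boundary_uminus: "measure_boundary k X (- \<mu>) = - measure_boundary k X \<mu>"
  by (auto simp: measure_boundary_def push_forward_def fun_eq_iff simp flip: sum_negf intro!: sum.cong)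

lemma measure_boundary_0: "measure_boundary k X 0 = 0"
  using measure_boundary_add[of k X 0 0] by simp

lemma measure_boundary_boundary:
  "measure_boundary k X (measure_boundary (Suc k) X \<mu>) = 0"
proof (cases k)
  case (Suc n)
  show ?thesis
  proof
    fix A
    show "measure_boundary k X (measure_boundary (Suc k) X \<mu>) A = 0 A"
    proof (cases "A \<in> sets (simplex_borel n X)")
      case True
      let ?F = "\<lambda>x i. \<mu> ({\<sigma> \<in> singular_simplex_set (Suc (Suc n)) X.
                   singular_face (Suc n) i (singular_face (Suc (Suc n)) x \<sigma>) \<in> A})"
      have *: "singular_face (Suc n) i -` A \<inter> singular_simplex_set (Suc n) X \<in> sets (simplex_borel (Suc n) X)"
        if "i \<le> Suc n" for i
        using measurable_sets[OF measurable_singular_face[OF that] True] by simp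
      have **: "{\<sigma> \<in> singular_simplex_set (Suc (Suc n)) X. singular_face (Suc (Suc n)) x \<sigma> \<in>
               singular_face (Suc n) i -` A \<inter> singular_simplex_set (Suc n) X} = {\<sigma> \<in> singular_simplex_set (Suc (Suc n)) X.
                   singular_face (Suc n) i (singular_face (Suc (Suc n)) x \<sigma>) \<in> A}" if "x \<le> Suc (Suc n)" for x i
        using singular_simplex_singular_face[of "Suc (Suc n)" X _ x] that by auto
      have "measure_boundary k X (measure_boundary (Suc k) X \<mu>) A
          = (\<Sum>i\<le>Suc n. (-1) ^ i * (\<Sum>x\<le>Suc (Suc n). (-1) ^ x * ?F x i))"
      proof -
        have pf: "push_forward (simplex_borel (Suc (Suc n)) X) (simplex_borel (Suc n) X)
              (singular_face (Suc (Suc n)) x) \<mu> (singular_face (Suc n) i -` A \<inter> singular_simplex_set (Suc n) X)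
            = ?F x i" if "x \<le> Suc (Suc n)" "i \<le> Suc n" for x i
          using *[OF that(2)] **[OF that(1), of i]
          unfolding push_forward_def space_borel_of topspace_simplex_topology
          by (simp add: vimage_def Int_def conj_commute conj_assoc)
        have "measure_boundary k X \<nu> A = (\<Sum>i\<le>Suc n. (-1) ^ i *
            \<nu> (singular_face (Suc n) i -` A \<inter> singular_simplex_set (Suc n) X))" for \<nu>
          using True by (simp add: measure_boundary_def push_forward_def Suc del: sum.atMost_Suc)
        moreover have "measure_boundary (Suc k) X \<mu> (singular_face (Suc n) i -` A \<inter> singular_simplex_set (Suc n) X)
            = (\<Sum>x\<le>Suc (Suc n). (-1) ^ x * ?F x i)" if "i \<le> Suc n" for i
          using pf[OF _ that] by (simp add: measure_boundary_def Suc del: sum.atMost_Suc)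
        ultimately show ?thesis by (simp del: sum.atMost_Suc)
      qed
      also have "\<dots> = (\<Sum>x\<le>Suc (Suc n). \<Sum>i\<le>Suc n. (-1) ^ (x + i) * ?F x i)"
        by (subst sum.swap) (simp add: sum_distrib_left power_add mult_ac del: sum.atMost_Suc)
      also have "\<dots> = 0"
        by (intro alternating_double_sum) (simp add: singular_face_face)
      finally show ?thesis by simp
    qed (simp add: measure_boundary_def push_forward_def Suc)
  qed
qed (simp add: measure_boundary_def)

lemma measure_boundary_iota:
  assumes c: "c \<in> real_singular_chain_set k X"
  shows "measure_boundary k X (iota_chain k X c) = iota_chain (k - 1) X (real_chain_boundary k c)"
proof (cases k)
  case (Suc n)
  show ?thesis
  proof
    fix A
    have *: "push_forward (simplex_borel k X) (simplex_borel n X) (singular_face k i) (iota_chain k X c) A =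
          chain_eval (\<lambda>\<sigma>. dirac (simplex_borel n X) (singular_face k i \<sigma>) A) c"
      if "i \<le> k" for i
    proof (cases "A \<in> sets (simplex_borel n X)")
      case True
      then have "singular_face k i -` A \<inter> singular_simplex_set k X \<in> sets (simplex_borel k X)"
        using measurable_sets[OF measurable_singular_face True, of i] that by (simp add: Suc)
      then show ?thesis
        using True c unfolding push_forward_def iota_chain_eval
        by (auto simp: chain_eval_def dirac_def indicator_def real_singular_chain_set_def intro!: sum.cong)
    qed (simp add: push_forward_def chain_eval_def dirac_def)
    have "measure_boundary k X (iota_chain k X c) A =
        (\<Sum>i\<le>k. (-1) ^ i * chain_eval (\<lambda>\<sigma>. dirac (simplex_borel n X) (singular_face k i \<sigma>) A) c)"
      using * by (simp add: measure_boundary_def Suc del: sum.atMost_Suc)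
    also have "\<dots> = chain_eval (\<lambda>\<sigma>. \<Sum>i\<le>k. (-1) ^ i * dirac (simplex_borel n X) (singular_face k i \<sigma>) A) c"
      unfolding chain_eval_def sum_distrib_left by (subst sum.swap) (simp add: mult_ac)
    also have "\<dots> = iota_chain (k - 1) X (real_chain_boundary k c) A"
      by (simp add: iota_chain_eval chain_eval_boundary Suc del: sum.atMost_Suc)
    finally show "measure_boundary k X (iota_chain k X c) A = iota_chain (k - 1) X (real_chain_boundary k c) A" .
  qed
qed (simp add: measure_boundary_def real_chain_boundary_def iota_chain_0)

lemma add_closed_measure_chains: "add_closed (measure_chain_set k X)"
  by (auto simp: add_closed_def measure_chain_0 measure_chain_add measure_chain_uminus)

lemma add_closed_measure_cycles: "add_closed (measure_cycle_set k X)"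
  using add_closed_measure_chains[of k X]
  by (simp add: add_closed_def measure_cycle_set_def measure_boundary_add
      measure_boundary_uminus measure_boundary_0)

lemma add_closed_measure_boundaries: "add_closed (measure_boundary_set k X)"
  using add_closed_measure_chains[of "Suc k" X] unfolding measure_boundary_set_def add_closed_def
  by (auto simp flip: measure_boundary_add measure_boundary_uminus)
     (metis image_eqI measure_boundary_0)

lemma measure_boundaries_subset_cycles: "measure_boundary_set k X \<subseteq> measure_cycle_set k X"
  by (auto simp: measure_boundary_set_def measure_cycle_set_def measure_boundary_in
      measure_boundary_boundary)

lemma iota_cycle: "c \<in> real_cycle_set k X \<Longrightarrow> iota_chain k X c \<in> measure_cycle_set k X"
  by (auto simp: real_cycle_set_def measure_cycle_set_def iota_chain_in measure_boundary_iota iota_chain_0)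

lemma iota_boundary: "c \<in> real_boundary_set k X \<Longrightarrow> iota_chain k X c \<in> measure_boundary_set k X"
  using measure_boundary_iota[of _ "Suc k" X] 
  by (auto simp: real_boundary_set_def measure_boundary_set_def intro!: image_eqI iota_chain_in)

lemmas normal_real_boundaries = normal_additive_monoid
  [OF add_closed_real_cycles add_closed_real_boundaries real_boundaries_subset_cycles]
lemmas normal_measure_boundaries = normal_additive_monoid
  [OF add_closed_measure_cycles add_closed_measure_boundaries measure_boundaries_subset_cycles]

lemma carrier_additive_monoid: "carrier (additive_monoid S) = S"
  by (simp add: additive_monoid_def)

lemma mult_additive_monoid: "a \<otimes>\<^bsub>additive_monoid S\<^esub> b = a + b"
  by (simp add: additive_monoid_def)

lemma r_coset_additive_monoid: "T #>\<^bsub>additive_monoid S\<^esub> a = (\<lambda>t. t + a) ` T"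
  by (auto simp: r_coset_def additive_monoid_def)

lemma iota_homology_coset:
  assumes "c \<in> real_cycle_set k X"
  shows "iota_homology k X (real_boundary_set k X #>\<^bsub>additive_monoid (real_cycle_set k X)\<^esub> c) =
         measure_boundary_set k X #>\<^bsub>additive_monoid (measure_cycle_set k X)\<^esub> iota_chain k X c"
proof -
  have "measure_boundary_set k X #>\<^bsub>additive_monoid (measure_cycle_set k X)\<^esub> iota_chain k X (b + c) =
        measure_boundary_set k X #>\<^bsub>additive_monoid (measure_cycle_set k X)\<^esub> iota_chain k X c"
    if "b \<in> real_boundary_set k X" for b
  proof -
    note ac = add_closed_measure_boundaries[of k X, unfolded add_closed_def]
    have b: "iota_chain k X b \<in> measure_boundary_set k X" using that by (rule iota_boundary)
    have "\<mu> + iota_chain k X c \<in> (\<lambda>t. t + (iota_chain k X b + iota_chain k X c)) ` measure_boundary_set k X"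
      if "\<mu> \<in> measure_boundary_set k X" for \<mu>
    proof (rule image_eqI)
      show "\<mu> + iota_chain k X c = (\<mu> + - iota_chain k X b) + (iota_chain k X b + iota_chain k X c)"
        by (simp add: algebra_simps)
      show "\<mu> + - iota_chain k X b \<in> measure_boundary_set k X" using ac b that by blast
    qed
    moreover have "\<mu> + (iota_chain k X b + iota_chain k X c) \<in> (\<lambda>t. t + iota_chain k X c) ` measure_boundary_set k X"
      if "\<mu> \<in> measure_boundary_set k X" for \<mu>
      using ac b that by (intro image_eqI[of _ _ "\<mu> + iota_chain k X b"]) (auto simp: add.assoc)
    ultimately show ?thesis
      unfolding r_coset_additive_monoid iota_chain_add by auto
  qed
  moreover have "real_boundary_set k X \<noteq> {}"
    using add_closed_real_boundaries[of k X] by (auto simp: add_closed_def)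
  ultimately show ?thesis
    unfolding iota_homology_def r_coset_additive_monoid[where T = "real_boundary_set k X"] by auto
qed

theorem iota_homology_hom:
  "iota_homology k X \<in> hom (real_homology_group k X) (measure_homology_group k X)"
proof (rule homI)
  interpret R: normal "real_boundary_set k X" "additive_monoid (real_cycle_set k X)"
    by (rule normal_real_boundaries)
  interpret M: normal "measure_boundary_set k X" "additive_monoid (measure_cycle_set k X)"
    by (rule normal_measure_boundaries)
  note ac = add_closed_real_cycles[of k X, unfolded add_closed_def]
  fix h assume "h \<in> carrier (real_homology_group k X)"
  then obtain c where c: "c \<in> real_cycle_set k X"
    and h: "h = real_boundary_set k X #>\<^bsub>additive_monoid (real_cycle_set k X)\<^esub> c"
    by (auto simp: real_homology_group_def carrier_FactGroup additive_monoid_def)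
  show "iota_homology k X h \<in> carrier (measure_homology_group k X)"
    unfolding h iota_homology_coset[OF c] using iota_cycle[OF c]
    by (auto simp: measure_homology_group_def carrier_FactGroup additive_monoid_def)
  fix g assume "g \<in> carrier (real_homology_group k X)"
  then obtain d where d: "d \<in> real_cycle_set k X"
    and g: "g = real_boundary_set k X #>\<^bsub>additive_monoid (real_cycle_set k X)\<^esub> d"
    by (auto simp: real_homology_group_def carrier_FactGroup additive_monoid_def)
  have "h \<otimes>\<^bsub>real_homology_group k X\<^esub> g =
      real_boundary_set k X #>\<^bsub>additive_monoid (real_cycle_set k X)\<^esub> (c + d)"
    using R.rcos_sum[of c d] c d
    by (simp add: h g real_homology_group_def FactGroup_def carrier_additive_monoid mult_additive_monoid)
  moreover have "iota_homology k X h \<otimes>\<^bsub>measure_homology_group k X\<^esub> iota_homology k X g =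
      measure_boundary_set k X #>\<^bsub>additive_monoid (measure_cycle_set k X)\<^esub> (iota_chain k X c + iota_chain k X d)"
    using iota_cycle[OF c] iota_cycle[OF d] M.rcos_sum[of "iota_chain k X c" "iota_chain k X d"]
    by (simp add: h g c d iota_homology_coset measure_homology_group_def FactGroup_def
        carrier_additive_monoid mult_additive_monoid)
  moreover have "c + d \<in> real_cycle_set k X" using c d ac by blast
  ultimately show "iota_homology k X (h \<otimes>\<^bsub>real_homology_group k X\<^esub> g) =
      iota_homology k X h \<otimes>\<^bsub>measure_homology_group k X\<^esub> iota_homology k X g"
    by (simp add: iota_homology_coset iota_chain_add)
qed

end

theory Submission
  imports Defs
begin

text \<open>Subdivide a singular cycle \<open>c\<close> of \<open>X\<close> until each of its simplices either misses the set \<open>P\<close> of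
  identification points, and hence lies in a single copy of \<open>Y\<close>, or lies in a neighbourhood of \<open>P\<close>
  that deforms into \<open>P\<close>. Folding all but finitely many copies onto \<open>Y\<^sub>\<infinity>\<close> then does not change the
  homology class of \<open>c\<close>. The fold takes values in a finite union \<open>M\<close> of copies, which, unlike \<open>X\<close>, is
  locally contractible.

  A compact, locally contractible metric space \<open>M\<close> admits small fillings of small cycles.
  If \<open>\<mu>\<close> is a measure chain that bounds \<open>c\<close>, then some iterated subdivision makes all simplices in
  its compact determination set small in \<open>M\<close>; replacing their vertices by points of a finite net of
  \<open>M\<close> and filling in, one obtains a simple function with values in singular chains of \<open>M\<close>, whose
  \<open>\<mu>\<close>-integral is an honest singular chain. It bounds a cycle that is homologous to the image of
  \<open>c\<close> in \<open>M\<close>.\<close>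

subsection \<open>Singular chains with real coefficients\<close>

text \<open>In general the fold is not homotopic to the identity: two sheets meet only in
  \<open>P\<close>, so a point off \<open>P\<close> cannot be carried continuously to the next
  sheet. The comparison is made on chains instead. After subdivision the cycle is
  \<open>a + b\<close> with \<open>a\<close> in the sheets that are kept and \<open>b\<close> near
  \<open>P\<close>. The fold leaves \<open>a\<close> unchanged, so \<open>b\<close> minus its fold
  is a cycle near \<open>P\<close>. The end map \<open>g\<close> of the deformation into
  \<open>P\<close> does not see the sheet of a point, because all sheets agree on \<open>P\<close>;
  hence \<open>g\<close> maps this cycle to 0, while \<open>g\<close> is homotopic to the inclusion.

  Fillings are obtained by choice, so nothing is known about how they vary with the simplex. The net
  is what makes them measurable: they are chosen for finitely many tuples of net points, and
  evaluating a simplex at fixed points is continuous. The price is that filling moves a chain; that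
  it does so only up to a small chain homotopy is a second use of small fillings in
  \<open>M\<close>.\<close>

definition real_smult :: "real \<Rightarrow> ('b \<Rightarrow>\<^sub>0 real) \<Rightarrow> ('b \<Rightarrow>\<^sub>0 real)" where
  "real_smult r = Poly_Mapping.map (\<lambda>x. r * x)"

definition real_frag :: "('b \<Rightarrow>\<^sub>0 int) \<Rightarrow> ('b \<Rightarrow>\<^sub>0 real)" where
  "real_frag = Poly_Mapping.map real_of_int"

definition real_extend ::
  "(((nat \<Rightarrow> real) \<Rightarrow> 'a) \<Rightarrow> 'b real_chain) \<Rightarrow> 'a real_chain \<Rightarrow> 'b real_chain" where
  "real_extend F c = (\<Sum>\<sigma>\<in>Poly_Mapping.keys c. real_smult (Poly_Mapping.lookup c \<sigma>) (F \<sigma>))"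

lemma lookup_real_smult [simp]: "Poly_Mapping.lookup (real_smult r c) x = r * Poly_Mapping.lookup c x"
  by (simp add: real_smult_def Poly_Mapping.map.rep_eq when_def)

lemma lookup_real_frag [simp]: "Poly_Mapping.lookup (real_frag z) x = real_of_int (Poly_Mapping.lookup z x)"
  by (simp add: real_frag_def Poly_Mapping.map.rep_eq when_def)

lemma keys_real_frag [simp]: "Poly_Mapping.keys (real_frag z) = Poly_Mapping.keys z"
  by (auto simp: in_keys_iff)

lemma real_frag_add: "real_frag (a + b) = real_frag a + real_frag b"
  by (intro poly_mapping_eqI) (simp add: lookup_add)

lemma real_frag_0 [simp]: "real_frag 0 = 0"
  by (intro poly_mapping_eqI) simp

lemma real_frag_of [simp]: "real_frag (frag_of x) = Poly_Mapping.single x 1"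
  by (intro poly_mapping_eqI) (simp add: lookup_single when_def)

lemma real_frag_cmul: "real_frag (frag_cmul m a) = real_smult (real_of_int m) (real_frag a)"
  by (intro poly_mapping_eqI) simp

lemma real_frag_sum: "real_frag (\<Sum>i\<in>I. a i) = (\<Sum>i\<in>I. real_frag (a i))"
  by (induction I rule: infinite_finite_induct) (auto simp: real_frag_add)

lemma chain_eval_smult [simp]: "chain_eval \<phi> (real_smult r c) = r * chain_eval \<phi> c"
proof -
  have "chain_eval \<phi> (real_smult r c) = (\<Sum>\<sigma>\<in>Poly_Mapping.keys c. (r * Poly_Mapping.lookup c \<sigma>) * \<phi> \<sigma>)"
    by (subst chain_eval_superset[of "Poly_Mapping.keys c"]) (auto simp: in_keys_iff)
  then show ?thesis by (simp add: chain_eval_def sum_distrib_left mult_ac)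
qed

lemma chain_eval_diff [simp]: "chain_eval \<phi> (a - b) = chain_eval \<phi> a - chain_eval \<phi> b"
  using chain_eval_add[of \<phi> a "- b"] by simp

lemma chain_eval_extend [simp]:
  "chain_eval \<phi> (real_extend F c) = chain_eval (\<lambda>\<sigma>. chain_eval \<phi> (F \<sigma>)) c"
  by (simp add: real_extend_def) (simp add: chain_eval_def)

lemma chain_eval_cong:
  "(\<And>\<sigma>. \<sigma> \<in> Poly_Mapping.keys c \<Longrightarrow> \<phi> \<sigma> = \<psi> \<sigma>) \<Longrightarrow> chain_eval \<phi> c = chain_eval \<psi> c"
  by (simp add: chain_eval_def)

lemma chain_eval_frag_extend:
  "chain_eval \<phi> (real_frag (frag_extend F z)) = chain_eval (\<lambda>\<sigma>. chain_eval \<phi> (real_frag (F \<sigma>))) (real_frag z)"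
  by (simp add: frag_extend_def real_frag_sum real_frag_cmul) (simp add: chain_eval_def)

lemma real_chain_boundary_frag: "real_chain_boundary k (real_frag z) = real_frag (chain_boundary k z)"
  by (intro real_chain_eqI)
     (simp add: chain_eval_boundary chain_boundary_def chain_eval_frag_extend real_frag_sum real_frag_cmul)

lemma real_chain_boundary_smult: "real_chain_boundary k (real_smult r c) = real_smult r (real_chain_boundary k c)"
  by (intro real_chain_eqI) (simp add: chain_eval_boundary)

lemma real_chain_boundary_sum: "real_chain_boundary k (\<Sum>i\<in>I. c i) = (\<Sum>i\<in>I. real_chain_boundary k (c i))"
  by (induction I rule: infinite_finite_induct) (auto simp: real_chain_boundary_add real_chain_boundary_0)

lemma real_chain_boundary_diff:
  "real_chain_boundary k (a - b) = real_chain_boundary k a - real_chain_boundary k b"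
  by (intro real_chain_eqI) (simp add: chain_eval_boundary)

lemma real_chain_smult: "c \<in> real_singular_chain_set k X \<Longrightarrow> real_smult r c \<in> real_singular_chain_set k X"
  by (auto simp: real_singular_chain_set_def in_keys_iff subset_iff)

lemma real_chain_sum:
  "(\<And>i. i \<in> I \<Longrightarrow> c i \<in> real_singular_chain_set k X) \<Longrightarrow> (\<Sum>i\<in>I. c i) \<in> real_singular_chain_set k X"
  using add_closed_real_chains[of k X]
  by (induction I rule: infinite_finite_induct) (auto simp: add_closed_def)

lemma real_chain_diff:
  "a \<in> real_singular_chain_set k X \<Longrightarrow> b \<in> real_singular_chain_set k X \<Longrightarrow> a - b \<in> real_singular_chain_set k X"
  using add_closed_real_chains[of k X] unfolding add_closed_def by (metis diff_conv_add_uminus)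

lemma real_chain_single:
  "Poly_Mapping.single \<sigma> r \<in> real_singular_chain_set k X \<longleftrightarrow> r = 0 \<or> singular_simplex k X \<sigma>"
  by (auto simp: real_singular_chain_set_def)

lemma real_chain_frag: "real_frag z \<in> real_singular_chain_set k X \<longleftrightarrow> singular_chain k X z"
  by (simp add: real_singular_chain_set_def singular_chain_def)

lemma real_chain_extend:
  assumes "\<And>\<sigma>. \<sigma> \<in> Poly_Mapping.keys c \<Longrightarrow> F \<sigma> \<in> real_singular_chain_set k X"
  shows "real_extend F c \<in> real_singular_chain_set k X"
  unfolding real_extend_def by (intro real_chain_sum real_chain_smult assms)

lemma real_chain_mono:
  "c \<in> real_singular_chain_set k (subtopology X S) \<Longrightarrow> S \<subseteq> T \<Longrightarrow> c \<in> real_singular_chain_set k (subtopology X T)"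
  using singular_simplex_mono by (fastforce simp: real_singular_chain_set_def)

lemma real_chain_subtopology:
  "c \<in> real_singular_chain_set k (subtopology X S) \<longleftrightarrow>
   c \<in> real_singular_chain_set k X \<and> (\<forall>\<sigma>\<in>Poly_Mapping.keys c. \<sigma> ` standard_simplex k \<subseteq> S)"
  unfolding real_singular_chain_set_def singular_simplex_subtopology by blast

lemma real_boundary_smult: "c \<in> real_boundary_set k X \<Longrightarrow> real_smult r c \<in> real_boundary_set k X"
  unfolding real_boundary_set_def
  by (auto simp flip: real_chain_boundary_smult intro: real_chain_smult)

lemma real_boundary_sum:
  "(\<And>i. i \<in> I \<Longrightarrow> c i \<in> real_boundary_set k X) \<Longrightarrow> (\<Sum>i\<in>I. c i) \<in> real_boundary_set k X"
  using add_closed_real_boundaries[of k X]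
  by (induction I rule: infinite_finite_induct) (auto simp: add_closed_def)

lemma real_boundary_add:
  "a \<in> real_boundary_set k X \<Longrightarrow> b \<in> real_boundary_set k X \<Longrightarrow> a + b \<in> real_boundary_set k X"
  using add_closed_real_boundaries[of k X] by (simp add: add_closed_def)

lemma real_boundary_diff:
  "a \<in> real_boundary_set k X \<Longrightarrow> b \<in> real_boundary_set k X \<Longrightarrow> a - b \<in> real_boundary_set k X"
  using add_closed_real_boundaries[of k X] unfolding add_closed_def by (metis diff_conv_add_uminus)

lemma real_boundary_frag:
  assumes "singular_relboundary k X {} z"
  shows "real_frag z \<in> real_boundary_set k X"
proof -
  obtain d where "singular_chain (Suc k) X d" "chain_boundary (Suc k) d = z"
    using assms by (auto simp: singular_boundary)
  then show ?thesis
    unfolding real_boundary_set_def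
    by (auto simp: real_chain_boundary_frag real_chain_frag intro!: image_eqI[of _ _ "real_frag d"])
qed

lemma real_extend_add: "real_extend F (a + b) = real_extend F a + real_extend F b"
  by (intro real_chain_eqI) simp

lemma real_extend_diff: "real_extend F (a - b) = real_extend F a - real_extend F b"
  by (intro real_chain_eqI) simp

lemma real_extend_smult: "real_extend F (real_smult r a) = real_smult r (real_extend F a)"
  by (intro real_chain_eqI) simp

lemma real_extend_sum: "real_extend F (\<Sum>i\<in>I. a i) = (\<Sum>i\<in>I. real_extend F (a i))"
  by (intro real_chain_eqI) simp

lemma real_extend_cong:
  "(\<And>\<sigma>. \<sigma> \<in> Poly_Mapping.keys c \<Longrightarrow> F \<sigma> = G \<sigma>) \<Longrightarrow> real_extend F c = real_extend G c"
  by (simp add: real_extend_def)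

lemma real_frag_extend: "real_frag (frag_extend F z) = real_extend (\<lambda>\<sigma>. real_frag (F \<sigma>)) (real_frag z)"
  by (intro real_chain_eqI) (simp add: chain_eval_frag_extend)

text \<open>Compatibility with faces is demanded only on the simplices that occur in
  \<open>c\<close>: the fillings used below are natural on small simplices only.\<close>

lemma real_boundary_extend:
  fixes F G :: "((nat \<Rightarrow> real) \<Rightarrow> 'a) \<Rightarrow> 'b real_chain"
  assumes "\<And>\<sigma>. \<sigma> \<in> Poly_Mapping.keys c \<Longrightarrow>
     real_chain_boundary (Suc k) (F \<sigma>) = (\<Sum>i\<le>Suc k. real_smult ((-1) ^ i) (G (singular_face (Suc k) i \<sigma>)))"
  shows "real_chain_boundary (Suc k) (real_extend F c) = real_extend G (real_chain_boundary (Suc k) c)"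
proof (intro real_chain_eqI)
  fix \<tau> :: "(nat \<Rightarrow> real) \<Rightarrow> 'b"
  let ?\<phi> = "indicat_real {\<tau>}"
  have "chain_eval ?\<phi> (real_chain_boundary (Suc k) (real_extend F c))
     = chain_eval (\<lambda>\<sigma>. chain_eval ?\<phi> (real_chain_boundary (Suc k) (F \<sigma>))) c"
    by (simp add: chain_eval_boundary del: sum.atMost_Suc)
  also have "\<dots> = chain_eval (\<lambda>\<sigma>. \<Sum>i\<le>Suc k. (-1) ^ i * chain_eval ?\<phi> (G (singular_face (Suc k) i \<sigma>))) c"
    by (intro chain_eval_cong) (simp add: assms del: sum.atMost_Suc)
  also have "\<dots> = chain_eval ?\<phi> (real_extend G (real_chain_boundary (Suc k) c))"
    by (simp add: chain_eval_boundary del: sum.atMost_Suc)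
  finally show "chain_eval ?\<phi> (real_chain_boundary (Suc k) (real_extend F c)) =
    chain_eval ?\<phi> (real_extend G (real_chain_boundary (Suc k) c))" .
qed

section \<open>Chain maps induced by continuous maps\<close>

definition real_chain_map :: "nat \<Rightarrow> ('a \<Rightarrow> 'b) \<Rightarrow> 'a real_chain \<Rightarrow> 'b real_chain" where
  "real_chain_map p g = real_extend (\<lambda>\<sigma>. Poly_Mapping.single (simplex_map p g \<sigma>) 1)"

lemma real_chain_map_frag: "real_chain_map p g (real_frag z) = real_frag (chain_map p g z)"
  by (simp add: real_chain_map_def chain_map_def real_frag_extend o_def)

lemma real_chain_map_in:
  "continuous_map X Y g \<Longrightarrow> c \<in> real_singular_chain_set p X \<Longrightarrow> real_chain_map p g c \<in> real_singular_chain_set p Y"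
  unfolding real_chain_map_def
  by (intro real_chain_extend)
     (auto simp: real_chain_single real_singular_chain_set_def intro!: singular_simplex_simplex_map)

lemma singular_face_simplex_map':
  assumes "1 \<le> p" "i \<le> p"
  shows "singular_face p i (simplex_map p g \<sigma>) = simplex_map (p - 1) g (singular_face p i \<sigma>)"
  using assms simplical_face_in_standard_simplex[of p i]
  by (auto simp: singular_face_simplex_map simplex_map_def singular_face_def fun_eq_iff restrict_def)

lemma real_chain_boundary_map:
  "real_chain_boundary p (real_chain_map p g c) = real_chain_map (p - 1) g (real_chain_boundary p c)"
proof (cases p)
  case 0
  then show ?thesis by (simp add: real_chain_boundary_def real_chain_map_def real_extend_def)
next
  case (Suc k)
  have "real_chain_boundary (Suc k) (Poly_Mapping.single (simplex_map (Suc k) g \<sigma>) 1) =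
     (\<Sum>i\<le>Suc k. real_smult ((-1) ^ i) (Poly_Mapping.single (simplex_map k g (singular_face (Suc k) i \<sigma>)) 1))" for \<sigma>
    by (intro real_chain_eqI)
       (auto simp: chain_eval_boundary singular_face_simplex_map' simp del: sum.atMost_Suc intro!: sum.cong)
  then show ?thesis
    unfolding Suc real_chain_map_def by (simp add: real_boundary_extend)
qed

lemma real_chain_map_cong:
  assumes "c \<in> real_singular_chain_set p X" "\<And>x. x \<in> topspace X \<Longrightarrow> f x = g x"
  shows "real_chain_map p f c = real_chain_map p g c"
  unfolding real_chain_map_def
  by (intro real_extend_cong arg_cong[of _ _ "\<lambda>s. Poly_Mapping.single s 1"])
     (use assms in \<open>auto simp: real_singular_chain_set_def intro!: simplex_map_eq\<close>)

lemma real_chain_map_id: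
  assumes "c \<in> real_singular_chain_set p X" "\<And>x. x \<in> topspace X \<Longrightarrow> f x = x"
  shows "real_chain_map p f c = c"
proof -
  have "real_chain_map p f c = real_extend (\<lambda>\<sigma>. Poly_Mapping.single \<sigma> 1) c"
    unfolding real_chain_map_def
    by (intro real_extend_cong arg_cong[of _ _ "\<lambda>s. Poly_Mapping.single s 1"])
       (use assms in \<open>auto simp: real_singular_chain_set_def intro!: simplex_map_id_gen\<close>)
  also have "\<dots> = c" by (intro real_chain_eqI) simp
  finally show ?thesis .
qed

lemma real_chain_map_compose:
  "real_chain_map p g (real_chain_map p f c) = real_chain_map p (g \<circ> f) c"
  by (intro real_chain_eqI) (simp add: real_chain_map_def simplex_map_compose)

lemma real_cycle_map:
  "continuous_map X Y g \<Longrightarrow> c \<in> real_cycle_set p X \<Longrightarrow> real_chain_map p g c \<in> real_cycle_set p Y"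
  by (auto simp: real_cycle_set_def real_chain_map_in real_chain_boundary_map)
     (simp add: real_chain_map_def real_extend_def)

lemma real_boundary_map:
  "continuous_map X Y g \<Longrightarrow> c \<in> real_boundary_set p X \<Longrightarrow> real_chain_map p g c \<in> real_boundary_set p Y"
  unfolding real_boundary_set_def
  by (auto intro!: image_eqI[OF _ real_chain_map_in] simp: real_chain_boundary_map)

subsection \<open>Real cycles as combinations of integral cycles\<close>

text \<open>Finitely many reals span a finite-dimensional rational vector space; scaling a rational
  basis by a common denominator makes all coordinates integral.\<close>

lemma integral_basis:
  fixes A :: "'b set" and a :: "'b \<Rightarrow> real"
  assumes "finite A"
  shows "\<exists>n (B :: nat \<Rightarrow> real) N.
     (\<forall>x\<in>A. a x = (\<Sum>j<n. real_of_int (N x j) * B j)) \<and>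
     (\<forall>m. (\<Sum>j<n. real_of_int (m j) * B j) = 0 \<longrightarrow> (\<forall>j<n. m j = 0))"
  using assms
proof (induction A rule: finite_induct)
  case empty
  then show ?case by (intro exI[of _ 0]) auto
next
  case (insert x A)
  then obtain n :: nat and B N where N': "\<forall>x\<in>A. a x = (\<Sum>j<n. real_of_int (N x j) * B j)"
    and ind': "\<forall>m. (\<Sum>j<n. real_of_int (m j) * B j) = 0 \<longrightarrow> (\<forall>j<n. m j = 0)"
    by (elim exE conjE)
  note N = N'[rule_format] and ind = ind'[rule_format]
  show ?case
  proof (cases "\<exists>m0 m. real_of_int m0 * a x = (\<Sum>j<n. real_of_int (m j) * B j) \<and> m0 \<noteq> 0")
    case True
    then obtain m0 m where m: "real_of_int m0 * a x = (\<Sum>j<n. real_of_int (m j) * B j)" "m0 \<noteq> 0" by blast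
    \<comment> \<open>The new number depends rationally on the basis, with denominator
      \<open>m0\<close>. Dividing the basis by \<open>m0\<close> makes its coordinates integral and
      multiplies the old ones by \<open>m0\<close>.\<close>
    define C where "C j = B j / real_of_int m0" for j
    have CB: "(\<Sum>j<n. real_of_int (q j) * C j) = (\<Sum>j<n. real_of_int (q j) * B j) / real_of_int m0" for q
      by (simp add: C_def sum_divide_distrib)
    have "a x = (\<Sum>j<n. real_of_int (m j) * C j)" unfolding CB using m by (simp add: field_simps)
    moreover have "a y = (\<Sum>j<n. real_of_int (m0 * N y j) * C j)" if "y \<in> A" for y
      using m(2) by (simp add: N[OF that] C_def)
    moreover have "m j = 0" if "(\<Sum>j<n. real_of_int (m j) * C j) = 0" "j < n" for m j
      using that m(2) ind[of m j] by (simp add: CB)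
    ultimately show ?thesis
      using insert(2)
      by (intro exI[of _ n] exI[of _ C] exI[of _ "\<lambda>y j. if y = x then m j else m0 * N y j"])
         (auto intro!: sum.cong)
  next
    case False
    \<comment> \<open>The number itself joins the basis at index \<open>n\<close>; a relation in
      which it occurs would put it into the rational span of the others.\<close>
    have "a x = (\<Sum>j<Suc n. real_of_int (if j = n then 1 else 0) * (B(n := a x)) j)"
      by (simp add: sum.neutral)
    moreover have "a y = (\<Sum>j<Suc n. real_of_int (if j = n then 0 else N y j) * (B(n := a x)) j)" if "y \<in> A" for y
      by (simp add: N[OF that])
    moreover have "m j = 0" if e: "(\<Sum>j<Suc n. real_of_int (m j) * (B(n := a x)) j) = 0" and j: "j < Suc n" for m j
    proof -
      have s: "(\<Sum>j<n. real_of_int (m j) * B j) + real_of_int (m n) * a x = 0"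
        using e by simp
      then have "real_of_int (m n) * a x = (\<Sum>j<n. real_of_int (- m j) * B j)"
        by (simp add: sum_negf)
      then have "\<exists>q. real_of_int (m n) * a x = (\<Sum>j<n. real_of_int (q j) * B j)"
        by (intro exI[of _ "\<lambda>j. - m j"])
      then have "m n = 0" using False by blast
      then show ?thesis using s ind[of m j] j by (cases "j = n") auto
    qed
    ultimately show ?thesis
      using insert(2)
      by (intro exI[of _ "Suc n"] exI[of _ "B(n := a x)"]
          exI[of _ "\<lambda>y j. if y = x then if j = n then 1 else 0 else if j = n then 0 else N y j"])
         (force intro!: sum.cong)
  qed
qed

text \<open>Each coordinate of a real cycle with respect to a basis over the integers of its coefficients is
  an integral cycle, which makes the integral homology theory of the library applicable.\<close>

lemma real_cycle_decomposition:
  assumes "c \<in> real_cycle_set k X"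
  obtains n B z where "c = (\<Sum>j<(n::nat). real_smult (B j) (real_frag (z j)))"
    "\<And>j. j < n \<Longrightarrow> singular_relcycle k X {} (z j)"
proof -
  obtain n :: nat and B N where N': "\<forall>\<sigma>\<in>Poly_Mapping.keys c.
       Poly_Mapping.lookup c \<sigma> = (\<Sum>j<n. real_of_int (N \<sigma> j) * B j)"
    and ind': "\<forall>m. (\<Sum>j<n. real_of_int (m j) * B j) = 0 \<longrightarrow> (\<forall>j<n. m j = 0)"
    using integral_basis[OF finite_keys, of c "Poly_Mapping.lookup c"] by (elim exE conjE)
  note N = N'[rule_format] and ind = ind'[rule_format]
  define z where "z j = (\<Sum>\<sigma>\<in>Poly_Mapping.keys c. frag_cmul (N \<sigma> j) (frag_of \<sigma>))" for j
  have lz: "Poly_Mapping.lookup (z j) \<sigma> = (if \<sigma> \<in> Poly_Mapping.keys c then N \<sigma> j else 0)" for j \<sigma>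
    by (simp add: z_def lookup_sum if_distrib[of "\<lambda>x. _ * x"] cong: if_cong)
  have c: "c = (\<Sum>j<n. real_smult (B j) (real_frag (z j)))"
  proof (intro poly_mapping_eqI)
    fix \<sigma>
    show "Poly_Mapping.lookup c \<sigma> = Poly_Mapping.lookup (\<Sum>j<n. real_smult (B j) (real_frag (z j))) \<sigma>"
      by (cases "\<sigma> \<in> Poly_Mapping.keys c") (simp add: lookup_sum lz N mult.commute, simp add: lookup_sum lz in_keys_iff)
  qed
  have "singular_relcycle k X {} (z j)" if j: "j < n" for j
  proof -
    have "Poly_Mapping.keys (z j) \<subseteq> Poly_Mapping.keys c"
      using lz by (auto simp: in_keys_iff split: if_splits)
    then have "singular_chain k X (z j)"
      using assms by (auto simp: real_cycle_set_def real_singular_chain_set_def singular_chain_def)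
    \<comment> \<open>The boundaries of the \<open>z j\<close>, weighted by the \<open>B j\<close>,
      add up to the boundary of \<open>c\<close>, which is 0; independence of the \<open>B j\<close>
      kills each of them separately.\<close>
    moreover have "chain_boundary k (z j) = 0"
    proof (intro poly_mapping_eqI)
      fix \<tau>
      have "(\<Sum>j<n. real_smult (B j) (real_frag (chain_boundary k (z j)))) = real_chain_boundary k c"
        by (subst c) (simp add: real_chain_boundary_sum real_chain_boundary_smult real_chain_boundary_frag)
      also have "\<dots> = 0" using assms by (simp add: real_cycle_set_def)
      finally have "Poly_Mapping.lookup (\<Sum>j<n. real_smult (B j) (real_frag (chain_boundary k (z j)))) \<tau> = 0"
        by simp
      then have "(\<Sum>j<n. real_of_int (Poly_Mapping.lookup (chain_boundary k (z j)) \<tau>) * B j) = 0"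
        by (simp add: lookup_sum mult.commute)
      from ind[OF this j] show "Poly_Mapping.lookup (chain_boundary k (z j)) \<tau> = Poly_Mapping.lookup 0 \<tau>"
        by simp
    qed
    ultimately show ?thesis by (simp add: singular_cycle)
  qed
  with c show thesis by (rule that)
qed

text \<open>The integral theorem applies to each integral coordinate of the cycle; the real
  statement is a linear combination of these.\<close>

lemma real_homotopy_invariance:
  assumes h: "homotopic_with (\<lambda>h. True) S U f g" and c: "c \<in> real_cycle_set k S"
  shows "real_chain_map k f c - real_chain_map k g c \<in> real_boundary_set k U"
proof -
  obtain n B z where c: "c = (\<Sum>j<(n::nat). real_smult (B j) (real_frag (z j)))"
    and z: "\<And>j. j < n \<Longrightarrow> singular_relcycle k S {} (z j)"
    using real_cycle_decomposition[OF c] by metis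
  have h': "homotopic_with (\<lambda>h. h \<in> {} \<rightarrow> {}) S U f g"
    using h by (rule homotopic_with_mono) auto
  have "real_chain_map k f c - real_chain_map k g c =
      (\<Sum>j<n. real_smult (B j) (real_frag (chain_map k f (z j) - chain_map k g (z j))))"
    unfolding c real_chain_map_def real_extend_sum real_extend_smult
    unfolding real_chain_map_def[symmetric] sum_subtractf[symmetric] real_chain_map_frag
    by (intro sum.cong refl poly_mapping_eqI) (simp add: lookup_minus algebra_simps)
  also have "\<dots> \<in> real_boundary_set k U"
    using homotopic_imp_homologous_rel_chain_maps[OF h' z]
    by (intro real_boundary_sum real_boundary_smult real_boundary_frag) (auto simp: homologous_rel_def)
  finally show ?thesis .
qed

text \<open>\<open>real_chain_boundary 0\<close> is 0, so every 0-chain is a cycle; in a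
  contractible set only those of augmentation 0 bound.\<close>

definition reduced_cycle_set :: "nat \<Rightarrow> 'a topology \<Rightarrow> 'a real_chain set" where
  "reduced_cycle_set p X = {c \<in> real_cycle_set p X. p = 0 \<longrightarrow> chain_eval (\<lambda>_. 1) c = 0}"

text \<open>The homotopy makes \<open>c\<close> homologous to its image under a constant map. That
  image is a cycle of a one-point space: a boundary in positive degrees, and in degree 0 the
  augmentation times a single simplex, hence 0.\<close>

lemma reduced_cycle_bounds:
  assumes h: "homotopic_with (\<lambda>h. True) S U id (\<lambda>_. a)" and c: "c \<in> reduced_cycle_set k S"
  shows "c \<in> real_boundary_set k U"
proof (cases "topspace S = {}")
  case True
  then have "Poly_Mapping.keys c = {}" using c singular_simplex_empty[OF True]
    by (auto simp: reduced_cycle_set_def real_cycle_set_def real_singular_chain_set_def subset_iff simp del: keys_eq_empty)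
  then have "c = 0" by simp
  then show ?thesis using add_closed_real_boundaries[of k U] by (simp add: add_closed_def)
next
  case False
  have "continuous_map S U (\<lambda>_. a)" using homotopic_with_imp_continuous_maps[OF h] by blast
  with False have a: "a \<in> topspace U" by (auto simp: continuous_map_def)
  have cc: "c \<in> real_cycle_set k S" using c by (simp add: reduced_cycle_set_def)
  have "real_chain_map k (\<lambda>_. a) c \<in> real_boundary_set k U"
  proof (cases "k = 0")
    case True
    have "chain_eval \<phi> (real_chain_map k (\<lambda>_. a) c) = 0" for \<phi>
    proof -
      have "chain_eval \<phi> (real_chain_map k (\<lambda>_. a) c) =
          chain_eval (\<lambda>\<sigma>. \<phi> (\<lambda>x\<in>standard_simplex k. a) * 1) c"
        by (simp add: real_chain_map_def simplex_map_def o_def)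
      also have "\<dots> = \<phi> (\<lambda>x\<in>standard_simplex k. a) * chain_eval (\<lambda>_. 1) c"
        by (simp add: chain_eval_def sum_distrib_left sum_distrib_right mult.commute)
      finally show ?thesis using c True by (simp add: reduced_cycle_set_def)
    qed
    then have "real_chain_map k (\<lambda>_. a) c = 0" by (intro real_chain_eqI) simp
    then show ?thesis using add_closed_real_boundaries[of k U] by (simp add: add_closed_def)
  next
    case False
    obtain n B z where ceq: "c = (\<Sum>j<(n::nat). real_smult (B j) (real_frag (z j)))"
      and z: "\<And>j. j < n \<Longrightarrow> singular_relcycle k S {} (z j)"
      using real_cycle_decomposition[OF cc] by metis
    have "singular_relboundary k U {} (chain_map k (\<lambda>_. a) (z j))" if "j < n" for j
    proof -
      have "singular_relcycle k (subtopology U {a}) {} (chain_map k (\<lambda>_. a) (z j))"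
        using a by (intro singular_relcycle_chain_map[OF z[OF that]]) auto
      then have "singular_relboundary k (subtopology U {a}) {} (chain_map k (\<lambda>_. a) (z j))"
        using singular_boundary_eq_cycle_singleton[of "subtopology U {a}" a k] False a by auto
      then show ?thesis by (metis singular_boundary_mono subset_UNIV subtopology_UNIV)
    qed
    then show ?thesis
      unfolding ceq real_chain_map_def real_extend_sum real_extend_smult
      unfolding real_chain_map_def[symmetric] real_chain_map_frag
      by (auto intro!: real_boundary_sum real_boundary_smult real_boundary_frag)
  qed
  moreover have "real_chain_map k id c = c"
    using cc by (intro real_chain_map_id) (auto simp: real_cycle_set_def)
  ultimately show ?thesis
    using real_boundary_add[OF real_homotopy_invariance[OF h cc]] by fastforce
qed

subsection \<open>Iterated subdivision\<close>

definition real_subdivision :: "nat \<Rightarrow> nat \<Rightarrow> 'a real_chain \<Rightarrow> 'a real_chain" where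
  "real_subdivision m p = real_extend (\<lambda>\<sigma>. real_frag ((singular_subdivision p ^^ m) (frag_of \<sigma>)))"

lemma singular_subdivision_power_extend:
  "(singular_subdivision p ^^ m) z = frag_extend (\<lambda>\<sigma>. (singular_subdivision p ^^ m) (frag_of \<sigma>)) z"
  using subset_UNIV
  by (induction z rule: frag_induction) (auto simp: singular_subdivision_power_diff frag_extend_diff)

lemma real_subdivision_frag:
  "real_subdivision m p (real_frag z) = real_frag ((singular_subdivision p ^^ m) z)"
  by (subst singular_subdivision_power_extend) (simp add: real_subdivision_def real_frag_extend)

lemma singular_chain_subdivision_power:
  "singular_chain p X c \<Longrightarrow> singular_chain p X ((singular_subdivision p ^^ m) c)"
  by (induction m) (auto simp: singular_chain_singular_subdivision)

lemma chain_boundary_subdivision_power: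
  "singular_chain p X c \<Longrightarrow>
   chain_boundary p ((singular_subdivision p ^^ m) c) = (singular_subdivision (p - 1) ^^ m) (chain_boundary p c)"
  by (induction m)
     (simp_all add: chain_boundary_singular_subdivision[OF singular_chain_subdivision_power])

lemma real_subdivision_in:
  "c \<in> real_singular_chain_set p X \<Longrightarrow> real_subdivision m p c \<in> real_singular_chain_set p X"
  unfolding real_subdivision_def
  by (intro real_chain_extend, unfold real_chain_frag, rule singular_chain_subdivision_power)
     (auto simp: real_singular_chain_set_def singular_chain_of)

text \<open>On each integral coordinate of the cycle, the chain homotopy between iterated
  subdivision and the identity gives a bounding chain.\<close>

lemma real_subdivision_homologous:
  assumes c: "c \<in> real_cycle_set k X"
  shows "real_subdivision m k c - c \<in> real_boundary_set k X"
proof -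
  obtain n B z where c: "c = (\<Sum>j<(n::nat). real_smult (B j) (real_frag (z j)))"
    and z: "\<And>j. j < n \<Longrightarrow> singular_relcycle k X {} (z j)"
    using real_cycle_decomposition[OF c] by metis
  have "singular_relboundary k X {} ((singular_subdivision k ^^ m) (z j) - z j)" if j: "j < n" for j
  proof -
    obtain h where h: "\<And>p. h p 0 = (0 :: 'a chain)"
      "\<And>p X c. singular_chain p X c \<Longrightarrow> singular_chain (Suc p) X (h p c)"
      "\<And>p X c. singular_chain p X c \<Longrightarrow> chain_boundary (Suc p) (h p c) + h (p - Suc 0) (chain_boundary p c)
                   = (singular_subdivision p ^^ m) c - c"
      using chain_homotopic_iterated_singular_subdivision[of m] by metis
    then show ?thesis
      using z[OF j] by (auto simp: singular_cycle singular_boundary) (metis add.right_neutral)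
  qed
  moreover have "real_subdivision m k c - c =
      (\<Sum>j<n. real_smult (B j) (real_frag ((singular_subdivision k ^^ m) (z j) - z j)))"
    unfolding c real_subdivision_def real_extend_sum real_extend_smult
    unfolding real_subdivision_def[symmetric] sum_subtractf[symmetric] real_subdivision_frag
    by (intro sum.cong refl poly_mapping_eqI) (simp add: lookup_minus algebra_simps)
  ultimately show ?thesis
    by (auto intro!: real_boundary_sum real_boundary_smult real_boundary_frag)
qed

lemma real_boundary_subdivision:
  assumes "c \<in> real_singular_chain_set k X"
  shows "real_chain_boundary k (real_subdivision m k c) = real_subdivision m (k - 1) (real_chain_boundary k c)"
proof (cases k)
  case 0
  then show ?thesis by (simp add: real_chain_boundary_def real_subdivision_def real_extend_def)
next
  case (Suc p)
  have "real_chain_boundary (Suc p) (real_frag ((singular_subdivision (Suc p) ^^ m) (frag_of \<sigma>))) =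
      (\<Sum>i\<le>Suc p. real_smult ((-1) ^ i) (real_frag ((singular_subdivision p ^^ m) (frag_of (singular_face (Suc p) i \<sigma>)))))"
    if "\<sigma> \<in> Poly_Mapping.keys c" for \<sigma>
  proof -
    have "singular_chain (Suc p) X (frag_of \<sigma>)"
      using that assms by (auto simp: Suc real_singular_chain_set_def singular_chain_of)
    then show ?thesis
      by (simp add: real_chain_boundary_frag chain_boundary_subdivision_power del: sum.atMost_Suc)
         (subst singular_subdivision_power_extend,
          simp add: chain_boundary_of frag_extend_sum frag_extend_cmul real_frag_sum real_frag_cmul del: sum.atMost_Suc)
  qed
  then show ?thesis
    unfolding Suc real_subdivision_def by (simp add: real_boundary_extend del: sum.atMost_Suc)
qed

subsection \<open>Integration of simple functions against signed measures\<close>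

definition signed_simple_integral :: "'b measure \<Rightarrow> ('b set \<Rightarrow> real) \<Rightarrow> ('b \<Rightarrow> real) \<Rightarrow> real" where
  "signed_simple_integral M \<mu> f = (\<Sum>y\<in>f ` space M. \<mu> (f -` {y} \<inter> space M) * y)"

lemma signed_measure_Un:
  assumes "signed_measure M \<mu>" "A \<in> sets M" "B \<in> sets M" "A \<inter> B = {}"
  shows "\<mu> (A \<union> B) = \<mu> A + \<mu> B"
proof -
  have "range (binaryset A B) \<subseteq> sets M" "disjoint_family (binaryset A B)"
    using assms by (auto simp: disjoint_family_on_def binaryset_def range_binaryset_eq)
  then have "(\<lambda>n. \<mu> (binaryset A B n)) sums \<mu> (A \<union> B)"
    using assms(1) unfolding signed_measure_def UN_binaryset_eq[symmetric] by blast
  moreover have "(\<lambda>n. \<mu> (binaryset A B n)) sums (\<mu> A + \<mu> B)"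
    using assms(1) by (intro binaryset_sums) (simp add: signed_measure_def)
  ultimately show ?thesis by (rule sums_unique2)
qed

lemma signed_measure_UN:
  assumes "signed_measure M \<mu>" "finite I" "\<And>i. i \<in> I \<Longrightarrow> A i \<in> sets M" "disjoint_family_on A I"
  shows "\<mu> (\<Union>i\<in>I. A i) = (\<Sum>i\<in>I. \<mu> (A i))"
  using assms(2-)
proof (induction I rule: finite_induct)
  case empty
  then show ?case using assms(1) by (simp add: signed_measure_def)
next
  case (insert i I)
  then have "A i \<inter> (\<Union>i\<in>I. A i) = {}" "(\<Union>i\<in>I. A i) \<in> sets M"
    by (auto simp: disjoint_family_on_def)
  with insert assms(1) show ?case
    using disjoint_family_on_mono[of I "insert i I" A]
    by (auto simp: signed_measure_Un)
qed

text \<open>A level set of \<open>h \<circ> w\<close> is the disjoint union of finitely many level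
  sets of \<open>w\<close>. With a pair of simple functions as \<open>w\<close>, both live on one
  partition, which yields additivity and comparison; \<open>w\<close> may also be
  chain-valued.\<close>

lemma signed_simple_integral_comp:
  assumes "signed_measure M \<mu>" "simple_function M w"
  shows "signed_simple_integral M \<mu> (\<lambda>x. h (w x)) =
         (\<Sum>v\<in>w ` space M. \<mu> (w -` {v} \<inter> space M) * h v)"
proof -
  let ?W = "\<lambda>v. w -` {v} \<inter> space M"
  have fin: "finite (w ` space M)" and W: "\<And>v. v \<in> w ` space M \<Longrightarrow> ?W v \<in> sets M"
    using assms(2) by (auto simp: simple_function_def)
  have *: "\<mu> ((\<lambda>x. h (w x)) -` {y} \<inter> space M) = (\<Sum>v\<in>{v \<in> w ` space M. h v = y}. \<mu> (?W v))" for y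
  proof -
    have "(\<lambda>x. h (w x)) -` {y} \<inter> space M = (\<Union>v\<in>{v \<in> w ` space M. h v = y}. ?W v)" by auto
    then show ?thesis
      using signed_measure_UN[OF assms(1), of "{v \<in> w ` space M. h v = y}" ?W] fin W
      by (auto simp: disjoint_family_on_def)
  qed
  have "signed_simple_integral M \<mu> (\<lambda>x. h (w x)) =
      (\<Sum>y\<in>h ` w ` space M. \<Sum>v\<in>{v \<in> w ` space M. h v = y}. \<mu> (?W v) * h v)"
    unfolding signed_simple_integral_def * image_image by (simp add: sum_distrib_right)
  also have "\<dots> = (\<Sum>v\<in>w ` space M. \<mu> (?W v) * h v)"
    by (rule sum.group) (use fin in auto)
  finally show ?thesis .
qed

lemma signed_simple_integral_add:
  assumes "signed_measure M \<mu>" "simple_function M f" "simple_function M g"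
  shows "signed_simple_integral M \<mu> (\<lambda>x. f x + g x) = signed_simple_integral M \<mu> f + signed_simple_integral M \<mu> g"
proof -
  note w = simple_function_Pair[OF assms(2,3)]
  show ?thesis
    using signed_simple_integral_comp[OF assms(1) w, of "\<lambda>v. fst v + snd v"]
    unfolding signed_simple_integral_comp[OF assms(1) w, of fst, simplified fst_conv]
      signed_simple_integral_comp[OF assms(1) w, of snd, simplified snd_conv] fst_conv snd_conv
    by (simp only: distrib_left sum.distrib)
qed

lemma signed_simple_integral_cmult:
  assumes "signed_measure M \<mu>" "simple_function M f"
  shows "signed_simple_integral M \<mu> (\<lambda>x. r * f x) = r * signed_simple_integral M \<mu> f"
  unfolding signed_simple_integral_comp[OF assms, of "\<lambda>v. r * v"]
  by (simp add: signed_simple_integral_def sum_distrib_left mult_ac)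

lemma signed_simple_integral_sum:
  assumes "signed_measure M \<mu>" "\<And>i. i \<in> I \<Longrightarrow> simple_function M (f i)"
  shows "signed_simple_integral M \<mu> (\<lambda>x. \<Sum>i\<in>I. r i * f i x) = (\<Sum>i\<in>I. r i * signed_simple_integral M \<mu> (f i))"
  using assms(2)
proof (induction I rule: infinite_finite_induct)
  case (insert i I)
  then have s: "simple_function M (\<lambda>x. r i * f i x)" "simple_function M (\<lambda>x. \<Sum>i\<in>I. r i * f i x)"
    by (auto intro!: simple_function_sum simple_function_mult)
  have "signed_simple_integral M \<mu> (\<lambda>x. \<Sum>i\<in>insert i I. r i * f i x) =
     signed_simple_integral M \<mu> (\<lambda>x. r i * f i x + (\<Sum>i\<in>I. r i * f i x))"
    using insert by simp
  also have "\<dots> = r i * signed_simple_integral M \<mu> (f i) + signed_simple_integral M \<mu> (\<lambda>x. \<Sum>i\<in>I. r i * f i x)"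
    using insert by (simp add: signed_simple_integral_add[OF assms(1) s] signed_simple_integral_cmult[OF assms(1)])
  finally show ?case using insert by simp
qed (auto simp: signed_simple_integral_def intro!: sum.neutral)

text \<open>\<open>C\<close> itself may fail to be measurable, so the functions are compared on the
  level sets of the pair \<open>(f, g)\<close>: such a set is measurable, and it misses
  \<open>C\<close> if the two values differ.\<close>

lemma signed_simple_integral_cong_on:
  assumes \<mu>: "signed_measure M \<mu>" and fg: "simple_function M f" "simple_function M g"
    and C: "\<And>A. A \<in> sets M \<Longrightarrow> A \<inter> C = {} \<Longrightarrow> \<mu> A = 0" and eq: "\<And>x. x \<in> C \<Longrightarrow> x \<in> space M \<Longrightarrow> f x = g x"
  shows "signed_simple_integral M \<mu> f = signed_simple_integral M \<mu> g"
proof -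
  let ?w = "\<lambda>x. (f x, g x)"
  note w = simple_function_Pair[OF fg]
  have "\<mu> (?w -` {v} \<inter> space M) * fst v = \<mu> (?w -` {v} \<inter> space M) * snd v" if "v \<in> ?w ` space M" for v
  proof (cases "fst v = snd v")
    case False
    have "?w -` {v} \<inter> space M \<in> sets M" using w that unfolding simple_function_def by blast
    moreover have "(?w -` {v} \<inter> space M) \<inter> C = {}" using False eq by auto
    ultimately show ?thesis using C by simp
  qed simp
  then show ?thesis
    using signed_simple_integral_comp[OF \<mu> w, of fst] signed_simple_integral_comp[OF \<mu> w, of snd]
    unfolding fst_conv snd_conv by (metis (no_types, lifting) sum.cong)
qed

lemma simple_function_measurable_comp:
  assumes "F \<in> M \<rightarrow>\<^sub>M N" "simple_function N f"
  shows "simple_function M (\<lambda>x. f (F x))"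
  unfolding simple_function_def
proof (intro conjI ballI)
  have sub: "(\<lambda>x. f (F x)) ` space M \<subseteq> f ` space N"
    using measurable_space[OF assms(1)] by auto
  then show "finite ((\<lambda>x. f (F x)) ` space M)"
    using assms(2) finite_subset unfolding simple_function_def by blast
  fix y assume "y \<in> (\<lambda>x. f (F x)) ` space M"
  then have "f -` {y} \<inter> space N \<in> sets N"
    using sub assms(2) unfolding simple_function_def by blast
  moreover have "(\<lambda>x. f (F x)) -` {y} \<inter> space M = F -` (f -` {y} \<inter> space N) \<inter> space M"
    using measurable_space[OF assms(1)] by auto
  ultimately show "(\<lambda>x. f (F x)) -` {y} \<inter> space M \<in> sets M"
    using measurable_sets[OF assms(1)] by presburger
qed

lemma signed_simple_integral_push_forward:
  assumes \<mu>: "signed_measure M \<mu>" and F: "F \<in> M \<rightarrow>\<^sub>M N" and f: "simple_function N f"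
  shows "signed_simple_integral N (push_forward M N F \<mu>) f = signed_simple_integral M \<mu> (\<lambda>x. f (F x))"
proof -
  have 0: "\<mu> {} = 0" using \<mu> by (simp add: signed_measure_def)
  have "signed_simple_integral N (push_forward M N F \<mu>) f =
     (\<Sum>y\<in>f ` space N. \<mu> ((\<lambda>x. f (F x)) -` {y} \<inter> space M) * y)"
    unfolding signed_simple_integral_def
  proof (intro sum.cong refl)
    fix y assume "y \<in> f ` space N"
    then have "f -` {y} \<inter> space N \<in> sets N" using f unfolding simple_function_def by blast
    moreover have "F -` (f -` {y} \<inter> space N) \<inter> space M = (\<lambda>x. f (F x)) -` {y} \<inter> space M"
      using measurable_space[OF F] by auto
    ultimately show "push_forward M N F \<mu> (f -` {y} \<inter> space N) * y = \<mu> ((\<lambda>x. f (F x)) -` {y} \<inter> space M) * y"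
      by (simp add: push_forward_def)
  qed
  also have "\<dots> = signed_simple_integral M \<mu> (\<lambda>x. f (F x))"
    unfolding signed_simple_integral_def
  \<comment> \<open>Values of \<open>f\<close> not taken on the image of \<open>F\<close> contribute
    the measure of the empty set.\<close>
  proof (rule sum.mono_neutral_right)
    show "finite (f ` space N)" using f by (simp add: simple_function_def)
    show "(\<lambda>x. f (F x)) ` space M \<subseteq> f ` space N"
      using measurable_space[OF F] by auto
    show "\<forall>y\<in>f ` space N - (\<lambda>x. f (F x)) ` space M. \<mu> ((\<lambda>x. f (F x)) -` {y} \<inter> space M) * y = 0"
    proof
      fix y assume "y \<in> f ` space N - (\<lambda>x. f (F x)) ` space M"
      then have "y \<notin> (\<lambda>x. f (F x)) ` space M" by simp
      then have "(\<lambda>x. f (F x)) -` {y} \<inter> space M = {}" by blast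
      then show "\<mu> ((\<lambda>x. f (F x)) -` {y} \<inter> space M) * y = 0" by (simp only: 0)
    qed
  qed
  finally show ?thesis .
qed

lemma signed_simple_integral_sum_measure:
  "signed_simple_integral M (\<lambda>A. \<Sum>i\<in>I. r i * \<mu> i A) f = (\<Sum>i\<in>I. r i * signed_simple_integral M (\<mu> i) f)"
  unfolding signed_simple_integral_def sum_distrib_left sum_distrib_right
  by (subst sum.swap) (simp add: mult_ac)

lemma signed_simple_integral_dirac:
  assumes "simple_function M f" "x \<in> space M"
  shows "signed_simple_integral M (dirac M x) f = f x"
proof -
  have "signed_simple_integral M (dirac M x) f = (\<Sum>y\<in>f ` space M. if y = f x then y else 0)"
    unfolding signed_simple_integral_def
    by (intro sum.cong refl) (use assms in \<open>auto simp: dirac_def simple_function_def indicator_def\<close>)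
  then show ?thesis using assms by (simp add: simple_function_def)
qed

text \<open>The Bochner integral of a simple function whose values are singular chains.\<close>

definition chain_integral :: "'b measure \<Rightarrow> ('b set \<Rightarrow> real) \<Rightarrow> ('b \<Rightarrow> 'a real_chain) \<Rightarrow> 'a real_chain" where
  "chain_integral M \<mu> G = (\<Sum>g\<in>G ` space M. real_smult (\<mu> (G -` {g} \<inter> space M)) g)"

lemma chain_eval_integral:
  assumes "signed_measure M \<mu>" "simple_function M G"
  shows "chain_eval \<phi> (chain_integral M \<mu> G) = signed_simple_integral M \<mu> (\<lambda>x. chain_eval \<phi> (G x))"
  unfolding chain_integral_def signed_simple_integral_comp[OF assms, of "chain_eval \<phi>"] by simp

text \<open>A Stokes formula: the boundary of the integral of \<open>G\<close> is the integral of
  the boundary of \<open>G\<close>, that is, of the alternating sum of \<open>F\<close> over the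
  faces. By change of variables this is the integral of \<open>F\<close> against the boundary of
  \<open>\<mu>\<close>, a combination of Dirac measures. The relation between \<open>G\<close> and
  \<open>F\<close> is required only on \<open>C\<close>, off which \<open>\<mu>\<close>
  vanishes.\<close>

lemma boundary_chain_integral:
  fixes F G :: "((nat \<Rightarrow> real) \<Rightarrow> 'a) \<Rightarrow> 'b real_chain"
  assumes \<mu>: "\<mu> \<in> measure_chain_set (Suc k) X"
    and \<mu>0: "\<And>A. A \<in> sets (simplex_borel (Suc k) X) \<Longrightarrow> A \<inter> C = {} \<Longrightarrow> \<mu> A = 0"
    and c: "c \<in> real_singular_chain_set k X" and eq: "measure_boundary (Suc k) X \<mu> = iota_chain k X c"
    and G: "simple_function (simplex_borel (Suc k) X) G" and F: "simple_function (simplex_borel k X) F"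
    and GF: "\<And>\<sigma>. \<sigma> \<in> C \<Longrightarrow> singular_simplex (Suc k) X \<sigma> \<Longrightarrow>
      real_chain_boundary (Suc k) (G \<sigma>) = (\<Sum>i\<le>Suc k. real_smult ((-1) ^ i) (F (singular_face (Suc k) i \<sigma>)))"
  shows "real_chain_boundary (Suc k) (chain_integral (simplex_borel (Suc k) X) \<mu> G) = real_extend F c"
proof (rule real_chain_eqI)
  fix \<tau> :: "(nat \<Rightarrow> real) \<Rightarrow> 'b"
  let ?M = "simplex_borel (Suc k) X" and ?N = "simplex_borel k X"
  let ?\<phi> = "indicat_real {\<tau>}"
  have sm: "signed_measure ?M \<mu>" using \<mu> by (simp add: measure_chain_set_iff)
  have SG: "simple_function ?M (\<lambda>x. h (G x))" for h :: "'b real_chain \<Rightarrow> real"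
    using simple_function_compose[OF G, of h] by (simp add: o_def)
  have SF: "simple_function ?N (\<lambda>x. chain_eval ?\<phi> (F x))"
    using simple_function_compose[OF F, of "chain_eval ?\<phi>"] by (simp add: o_def)
  note face = measurable_singular_face[of _ k X]
  have SFi: "simple_function ?M (\<lambda>x. chain_eval ?\<phi> (F (singular_face (Suc k) i x)))" if "i \<le> Suc k" for i
    by (rule simple_function_measurable_comp[OF face[OF that] SF])
  have "chain_eval ?\<phi> (real_chain_boundary (Suc k) (chain_integral ?M \<mu> G)) =
      signed_simple_integral ?M \<mu> (\<lambda>\<sigma>. chain_eval ?\<phi> (real_chain_boundary (Suc k) (G \<sigma>)))"
    by (simp add: chain_eval_boundary chain_eval_integral[OF sm G] del: sum.atMost_Suc)
  also have "\<dots> = signed_simple_integral ?M \<mu> (\<lambda>\<sigma>. \<Sum>i\<le>Suc k. (-1) ^ i * chain_eval ?\<phi> (F (singular_face (Suc k) i \<sigma>)))"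
  proof (rule signed_simple_integral_cong_on[OF sm SG _ \<mu>0])
    show "simple_function ?M (\<lambda>\<sigma>. \<Sum>i\<le>Suc k. (-1) ^ i * chain_eval ?\<phi> (F (singular_face (Suc k) i \<sigma>)))"
      using SFi by (intro simple_function_sum simple_function_mult) auto
  qed (auto simp: GF simp del: sum.atMost_Suc)
  also have "\<dots> = (\<Sum>i\<le>Suc k. (-1) ^ i * signed_simple_integral ?M \<mu> (\<lambda>\<sigma>. chain_eval ?\<phi> (F (singular_face (Suc k) i \<sigma>))))"
    using SFi by (intro signed_simple_integral_sum[OF sm]) auto
  also have "\<dots> = (\<Sum>i\<le>Suc k. (-1) ^ i * signed_simple_integral ?N
      (push_forward ?M ?N (singular_face (Suc k) i) \<mu>) (\<lambda>\<sigma>. chain_eval ?\<phi> (F \<sigma>)))"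
    using signed_simple_integral_push_forward[OF sm face SF] by (intro sum.cong refl) auto
  also have "\<dots> = signed_simple_integral ?N (measure_boundary (Suc k) X \<mu>) (\<lambda>\<sigma>. chain_eval ?\<phi> (F \<sigma>))"
    by (simp add: measure_boundary_def signed_simple_integral_sum_measure del: sum.atMost_Suc)
  also have "\<dots> = (\<Sum>\<sigma>\<in>Poly_Mapping.keys c. Poly_Mapping.lookup c \<sigma> * chain_eval ?\<phi> (F \<sigma>))"
    unfolding eq iota_chain_def signed_simple_integral_sum_measure
    using c signed_simple_integral_dirac[OF SF]
    by (intro sum.cong refl) (auto simp: real_singular_chain_set_def)
  also have "\<dots> = chain_eval ?\<phi> (real_extend F c)" by simp (simp add: chain_eval_def)
  finally show "chain_eval ?\<phi> (real_chain_boundary (Suc k) (chain_integral ?M \<mu> G)) =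
      chain_eval ?\<phi> (real_extend F c)" .
qed

lemma chain_integral_in:
  assumes "\<And>x. x \<in> space M \<Longrightarrow> G x \<in> real_singular_chain_set k X"
  shows "chain_integral M \<mu> G \<in> real_singular_chain_set k X"
  unfolding chain_integral_def using assms by (intro real_chain_sum real_chain_smult) auto

subsection \<open>Homological local connectedness\<close>

text \<open>The weak form: \<open>V\<close> is contracted inside the larger \<open>U\<close>, to a
  point that need not be \<open>x\<close>. This is what killing the cycles of \<open>V\<close> in
  \<open>U\<close> requires.\<close>

definition locally_contractible :: "'a topology \<Rightarrow> bool" where
  "locally_contractible X \<longleftrightarrow>
     (\<forall>x\<in>topspace X. \<forall>U. openin X U \<longrightarrow> x \<in> U \<longrightarrow>
        (\<exists>V a. openin X V \<and> x \<in> V \<and> V \<subseteq> U \<and>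
           homotopic_with (\<lambda>_. True) (subtopology X V) (subtopology X U) id (\<lambda>_. a)))"

abbreviation ball_topology :: "'m metric \<Rightarrow> 'm \<Rightarrow> real \<Rightarrow> 'm topology" where
  "ball_topology M x r \<equiv> subtopology (mtopology_of M) (mball_of M x r)"

text \<open>Uniform homological local connectedness: one radius serves all centres and all
  degrees.\<close>

definition uniformly_acyclic :: "'m metric \<Rightarrow> bool" where
  "uniformly_acyclic M \<longleftrightarrow>
     (\<forall>\<epsilon>>0. \<exists>\<delta>>0. \<forall>x\<in>mspace M. \<forall>p.
        reduced_cycle_set p (ball_topology M x \<delta>) \<subseteq> real_boundary_set p (ball_topology M x \<epsilon>))"

lemma real_boundary_mono:
  "c \<in> real_boundary_set k (subtopology X S) \<Longrightarrow> S \<subseteq> T \<Longrightarrow> c \<in> real_boundary_set k (subtopology X T)"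
  unfolding real_boundary_set_def using real_chain_mono by blast

lemma real_boundary_subtopology: "c \<in> real_boundary_set k (subtopology X S) \<Longrightarrow> c \<in> real_boundary_set k X"
  unfolding real_boundary_set_def using real_chain_subtopology by blast

lemma reduced_cycle_mono:
  "c \<in> reduced_cycle_set k (subtopology X S) \<Longrightarrow> S \<subseteq> T \<Longrightarrow> c \<in> reduced_cycle_set k (subtopology X T)"
  unfolding reduced_cycle_set_def real_cycle_set_def using real_chain_mono by blast

lemma mball_of_mono:
  assumes "mdist M x y + r \<le> s" "x \<in> mspace M"
  shows "mball_of M y r \<subseteq> mball_of M x s"
proof
  fix z assume z: "z \<in> mball_of M y r"
  interpret Metric_space "mspace M" "mdist M" by simp
  have "mdist M x z \<le> mdist M x y + mdist M y z" using z assms by (intro triangle) auto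
  with z assms show "z \<in> mball_of M x s" by auto
qed

lemma openin_mball_of: "openin (mtopology_of M) (mball_of M x r)"
  unfolding mtopology_of_def mball_of_def by (simp add: Metric_space.openin_mball)

text \<open>The radius is a Lebesgue number of a cover by sets that contract in balls of radius
  \<open>\<epsilon>/2\<close>. A contraction kills reduced cycles of every degree, so the radius
  does not depend on \<open>p\<close>.\<close>

lemma locally_contractible_imp_uniformly_acyclic:
  assumes comp: "compact_space (mtopology_of M)" and lc: "locally_contractible (mtopology_of M)"
  shows "uniformly_acyclic M"
  unfolding uniformly_acyclic_def
proof (intro allI impI)
  fix \<epsilon> :: real assume \<epsilon>: "\<epsilon> > 0"
  interpret Metric_space "mspace M" "mdist M" by simp
  have "\<exists>V a. openin (mtopology_of M) V \<and> x \<in> V \<and> V \<subseteq> mball_of M x (\<epsilon>/2) \<and>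
     homotopic_with (\<lambda>_. True) (subtopology (mtopology_of M) V) (ball_topology M x (\<epsilon>/2)) id (\<lambda>_. a)"
    if "x \<in> mspace M" for x
    using lc that \<epsilon> openin_mball_of[of M x "\<epsilon>/2"] unfolding locally_contractible_def by simp
  then obtain V a where V: "\<And>x. x \<in> mspace M \<Longrightarrow> openin (mtopology_of M) (V x) \<and> x \<in> V x \<and>
     V x \<subseteq> mball_of M x (\<epsilon>/2) \<and>
     homotopic_with (\<lambda>_. True) (subtopology (mtopology_of M) (V x)) (ball_topology M x (\<epsilon>/2)) id (\<lambda>_. a x)"
    by metis
  have "compactin mtopology (mspace M)" using comp by (simp add: mtopology_of_def compact_space_def)
  moreover have "mspace M \<subseteq> \<Union>(V ` mspace M)" using V by auto
  ultimately obtain \<delta> where \<delta>: "\<delta> > 0" "\<And>x. x \<in> mspace M \<Longrightarrow> \<exists>U\<in>V ` mspace M. mball x \<delta> \<subseteq> U"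
    using lebesgue_number[of "mspace M" "V ` mspace M"] V unfolding mtopology_of_def by blast
  have "reduced_cycle_set p (ball_topology M x \<delta>) \<subseteq> real_boundary_set p (ball_topology M x \<epsilon>)"
    if x: "x \<in> mspace M" for x p
  proof
    fix c assume c: "c \<in> reduced_cycle_set p (ball_topology M x \<delta>)"
    obtain y where y: "y \<in> mspace M" "mball_of M x \<delta> \<subseteq> V y" using \<delta>(2)[OF x] by (auto simp: mball_of_def)
    have "x \<in> V y" using y x \<delta>(1) by auto
    then have "mdist M y x < \<epsilon>/2" using V[OF y(1)] by auto
    \<comment> \<open>The contraction takes place around \<open>y\<close>; as \<open>x\<close> is
      within \<open>\<epsilon>/2\<close> of \<open>y\<close>, it stays in the
      \<open>\<epsilon>\<close>-ball around \<open>x\<close>.\<close>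
    then have "mball_of M y (\<epsilon>/2) \<subseteq> mball_of M x \<epsilon>"
      using x by (intro mball_of_mono) (auto simp: commute)
    moreover have "c \<in> real_boundary_set p (ball_topology M y (\<epsilon>/2))"
      using reduced_cycle_bounds[OF _ reduced_cycle_mono[OF c y(2)]] V[OF y(1)] by metis
    ultimately show "c \<in> real_boundary_set p (ball_topology M x \<epsilon>)" by (rule real_boundary_mono[rotated])
  qed
  with \<delta>(1) show "\<exists>\<delta>>0. \<forall>x\<in>mspace M. \<forall>p.
        reduced_cycle_set p (ball_topology M x \<delta>) \<subseteq> real_boundary_set p (ball_topology M x \<epsilon>)" by blast
qed

subsection \<open>Filling small tuples of points\<close>

text \<open>The face operator on tuples of vertices, the counterpart of
  \<open>singular_face\<close>.\<close>

definition skip :: "nat \<Rightarrow> (nat \<Rightarrow> 'm) \<Rightarrow> nat \<Rightarrow> 'm" where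
  "skip l t = (\<lambda>j. t (if j < l then j else Suc j))"

definition small_tuple :: "'m metric \<Rightarrow> real \<Rightarrow> nat \<Rightarrow> (nat \<Rightarrow> 'm) \<Rightarrow> bool" where
  "small_tuple M \<delta> p t \<longleftrightarrow> (\<forall>j\<le>p. t j \<in> mspace M) \<and> (\<forall>j\<le>p. \<forall>l\<le>p. mdist M (t j) (t l) < \<delta>)"

lemma skip_skip: "i \<le> j \<Longrightarrow> skip i (skip (Suc j) t) = skip j (skip i t)"
  by (auto simp: skip_def fun_eq_iff)

lemma small_tuple_skip: "small_tuple M \<delta> (Suc p) t \<Longrightarrow> small_tuple M \<delta> p (skip l t)"
  by (auto simp: small_tuple_def skip_def)

lemma small_tuple_mono:
  assumes "small_tuple M \<delta> p t" "\<delta> \<le> \<delta>'" shows "small_tuple M \<delta>' p t"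
proof -
  have "x < \<delta> \<Longrightarrow> x < \<delta>'" for x using assms(2) by simp
  with assms(1) show ?thesis unfolding small_tuple_def by blast
qed

text \<open>Up to degree \<open>p\<close>, \<open>A\<close> is an augmentation-preserving chain map,
  carried by balls, from the complex of small tuples (a Vietoris complex) to singular chains. The
  first clause concerns all tuples, small or not: the function integrated later must be chain-valued
  everywhere, while its boundary is controlled only on small simplices.\<close>

definition fills_tuples :: "'m metric \<Rightarrow> nat \<Rightarrow> real \<Rightarrow> real \<Rightarrow> (nat \<Rightarrow> (nat \<Rightarrow> 'm) \<Rightarrow> 'm real_chain) \<Rightarrow> bool" where
  "fills_tuples M p \<delta> \<epsilon> A \<longleftrightarrow>
     (\<forall>i t. A i t \<in> real_singular_chain_set i (mtopology_of M)) \<and>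
     (\<forall>i\<le>p. \<forall>t. small_tuple M \<delta> i t \<longrightarrow> A i t \<in> real_singular_chain_set i (ball_topology M (t 0) \<epsilon>)) \<and>
     (\<forall>t. small_tuple M \<delta> 0 t \<longrightarrow> chain_eval (\<lambda>_. 1) (A 0 t) = 1) \<and>
     (\<forall>i<p. \<forall>t. small_tuple M \<delta> (Suc i) t \<longrightarrow>
        real_chain_boundary (Suc i) (A (Suc i) t) = (\<Sum>l\<le>Suc i. real_smult ((-1) ^ l) (A i (skip l t))))"

lemma fills_tuplesD:
  assumes "fills_tuples M p \<delta> \<epsilon> A"
  shows "A i t \<in> real_singular_chain_set i (mtopology_of M)"
    and "i \<le> p \<Longrightarrow> small_tuple M \<delta> i t \<Longrightarrow> A i t \<in> real_singular_chain_set i (ball_topology M (t 0) \<epsilon>)"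
    and "small_tuple M \<delta> 0 t \<Longrightarrow> chain_eval (\<lambda>_. 1) (A 0 t) = 1"
    and "i < p \<Longrightarrow> small_tuple M \<delta> (Suc i) t \<Longrightarrow>
      real_chain_boundary (Suc i) (A (Suc i) t) = (\<Sum>l\<le>Suc i. real_smult ((-1) ^ l) (A i (skip l t)))"
  using assms unfolding fills_tuples_def by blast+

text \<open>The method of acyclic carriers, by induction on the degree: the fillings of the faces
  add up to a reduced cycle in a small ball, which bounds in a larger one. Each degree shrinks
  \<open>\<delta>\<close>, so \<open>p\<close> is fixed in advance.\<close>

lemma fills_tuples_exists:
  fixes M :: "'m metric"
  assumes M: "uniformly_acyclic M" and "\<epsilon> > 0"
  shows "\<exists>\<delta>>0. \<exists>A. fills_tuples M p \<delta> \<epsilon> A"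
  using \<open>\<epsilon> > 0\<close>
proof (induction p arbitrary: \<epsilon>)
  case 0
  interpret Metric_space "mspace M" "mdist M" by simp
  let ?\<sigma> = "\<lambda>t. \<lambda>x\<in>standard_simplex 0. t (0::nat)"
  let ?A = "\<lambda>i t. if i = 0 \<and> t 0 \<in> mspace M then Poly_Mapping.single (?\<sigma> t) 1 else 0"
  have A: "?A i t \<in> real_singular_chain_set i X" if "t 0 \<in> topspace X" for i t and X :: "'m topology"
    using that by (auto simp: real_chain_single singular_simplex_def) (auto simp: real_singular_chain_set_def)
  have "fills_tuples M 0 1 \<epsilon> ?A"
    unfolding fills_tuples_def
  proof (intro conjI allI impI)
    fix i t
    show "?A i t \<in> real_singular_chain_set i (mtopology_of M)"
      using A[of t "mtopology_of M" i] by (cases "t 0 \<in> mspace M") (auto simp: real_singular_chain_set_def)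
    assume "small_tuple M 1 i t"
    then show "?A i t \<in> real_singular_chain_set i (ball_topology M (t 0) \<epsilon>)"
      using 0 by (intro A) (auto simp: small_tuple_def)
  next
    fix t assume "small_tuple M 1 0 t"
    then show "chain_eval (\<lambda>_. 1) (?A 0 t) = 1" by (simp add: small_tuple_def)
  qed auto
  then show ?case by (intro exI[of _ 1]) auto
next
  case (Suc p)
  obtain \<epsilon>1 where \<epsilon>1: "\<epsilon>1 > 0" "\<And>x p. x \<in> mspace M \<Longrightarrow>
      reduced_cycle_set p (ball_topology M x \<epsilon>1) \<subseteq> real_boundary_set p (ball_topology M x \<epsilon>)"
    using M Suc.prems unfolding uniformly_acyclic_def by metis
  \<comment> \<open>The filling of a face lies in an \<open>\<epsilon>2\<close>-ball around the
    first point of that face, which is \<open>t 1\<close> if \<open>t 0\<close> is omitted. This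
    point is closer than \<open>\<delta> \<le> \<epsilon>2\<close> to \<open>t 0\<close>, so
    \<open>2 * \<epsilon>2 \<le> \<epsilon>1\<close> puts all faces into one
    \<open>\<epsilon>1\<close>-ball.\<close>
  define \<epsilon>2 where "\<epsilon>2 = min \<epsilon>1 \<epsilon> / 2"
  have \<epsilon>2: "\<epsilon>2 > 0" "2 * \<epsilon>2 \<le> \<epsilon>1" "\<epsilon>2 \<le> \<epsilon>" using \<epsilon>1(1) Suc.prems by (auto simp: \<epsilon>2_def)
  obtain \<delta>0 A where \<delta>0: "\<delta>0 > 0" and A: "fills_tuples M p \<delta>0 \<epsilon>2 A" using Suc.IH[OF \<epsilon>2(1)] by blast
  define \<delta> where "\<delta> = min \<delta>0 \<epsilon>2"
  have \<delta>: "\<delta> > 0" "\<delta> \<le> \<delta>0" "\<delta> \<le> \<epsilon>2" using \<delta>0 \<epsilon>2 by (auto simp: \<delta>_def)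
  define z where "z t = (\<Sum>l\<le>Suc p. real_smult ((-1) ^ l) (A p (skip l t)))" for t
  have z: "z t \<in> real_boundary_set p (ball_topology M (t 0) \<epsilon>)" if t: "small_tuple M \<delta> (Suc p) t" for t
  proof -
    have st: "small_tuple M \<delta>0 p (skip l t)" for l
      using small_tuple_mono[OF small_tuple_skip[OF t] \<delta>(2)] .
    have "A p (skip l t) \<in> real_singular_chain_set p (ball_topology M (t 0) \<epsilon>1)" for l
    proof -
      have "A p (skip l t) \<in> real_singular_chain_set p (ball_topology M (skip l t 0) \<epsilon>2)"
        using fills_tuplesD(2)[OF A order_refl st] .
      moreover have "mdist M (t 0) (skip l t 0) < \<delta>" "t 0 \<in> mspace M"
        using t by (auto simp: small_tuple_def skip_def)
      then have "mball_of M (skip l t 0) \<epsilon>2 \<subseteq> mball_of M (t 0) \<epsilon>1"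
        using \<epsilon>2 \<delta> by (intro mball_of_mono) auto
      ultimately show ?thesis by (rule real_chain_mono)
    qed
    then have "z t \<in> real_singular_chain_set p (ball_topology M (t 0) \<epsilon>1)"
      unfolding z_def by (intro real_chain_sum real_chain_smult)
    moreover have "real_chain_boundary p (z t) = 0"
    proof (cases p)
      case 0
      then show ?thesis by (simp add: real_chain_boundary_def)
    next
      case (Suc q)
      have "real_chain_boundary p (A p (skip l t)) = (\<Sum>i\<le>p. real_smult ((-1) ^ i) (A q (skip i (skip l t))))" for l
        using fills_tuplesD(4)[OF A, of q "skip l t"] st[of l] by (simp add: Suc del: sum.atMost_Suc)
      then have "chain_eval \<phi> (real_chain_boundary p (z t)) =
          (\<Sum>l\<le>Suc p. \<Sum>i\<le>p. (-1) ^ (l + i) * chain_eval \<phi> (A q (skip i (skip l t))))" for \<phi>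
        by (simp add: z_def real_chain_boundary_sum real_chain_boundary_smult sum_distrib_left power_add
            mult.assoc del: sum.atMost_Suc)
      moreover have "(\<Sum>l\<le>Suc p. \<Sum>i\<le>p. (-1) ^ (l + i) * chain_eval \<phi> (A q (skip i (skip l t)))) = 0" for \<phi>
        by (rule alternating_double_sum) (simp add: skip_skip)
      ultimately show ?thesis by (intro real_chain_eqI) simp
    qed
    \<comment> \<open>The difference of two 0-chains of augmentation 1.\<close>
    moreover have "chain_eval (\<lambda>_. 1) (z t) = 0" if "p = 0"
    proof -
      have "chain_eval (\<lambda>_. 1) (A 0 (skip l t)) = 1" for l
        using fills_tuplesD(3)[OF A] st[of l] that by simp
      then show ?thesis by (simp add: z_def that)
    qed
    ultimately have "z t \<in> reduced_cycle_set p (ball_topology M (t 0) \<epsilon>1)"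
      by (simp add: reduced_cycle_set_def real_cycle_set_def)
    then show ?thesis using \<epsilon>1(2)[of "t 0" p] t by (auto simp: small_tuple_def)
  qed
  have "\<exists>b. b \<in> real_singular_chain_set (Suc p) (ball_topology M (t 0) \<epsilon>) \<and>
      real_chain_boundary (Suc p) b = z t" if "small_tuple M \<delta> (Suc p) t" for t
    by (use z[OF that] in \<open>auto simp: real_boundary_set_def\<close>)
  then obtain B where B': "\<And>t. small_tuple M \<delta> (Suc p) t \<Longrightarrow>
      B t \<in> real_singular_chain_set (Suc p) (ball_topology M (t 0) \<epsilon>) \<and>
      real_chain_boundary (Suc p) (B t) = z t" by metis
  note B = conjunct1[OF B'] conjunct2[OF B']
  \<comment> \<open>The value 0 on tuples that are not small keeps the first clause of
    \<open>fills_tuples\<close> true.\<close>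
  let ?A = "A(Suc p := \<lambda>t. if small_tuple M \<delta> (Suc p) t then B t else 0)"
  have "fills_tuples M (Suc p) \<delta> \<epsilon> ?A"
    unfolding fills_tuples_def
  proof (intro conjI allI impI)
    fix i t
    have "A i t \<in> real_singular_chain_set i (mtopology_of M)" by (rule fills_tuplesD(1)[OF A])
    moreover have "B t \<in> real_singular_chain_set (Suc p) (mtopology_of M)" if "small_tuple M \<delta> (Suc p) t"
      using B(1)[OF that] by (simp add: real_chain_subtopology)
    moreover have "0 \<in> real_singular_chain_set (Suc p) (mtopology_of M)" by (simp add: real_singular_chain_set_def)
    ultimately show "?A i t \<in> real_singular_chain_set i (mtopology_of M)" by simp
  next
    fix i t assume i: "i \<le> Suc p" "small_tuple M \<delta> i t"
    show "?A i t \<in> real_singular_chain_set i (ball_topology M (t 0) \<epsilon>)"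
    proof (cases "i = Suc p")
      case False
      have "mball_of M (t 0) \<epsilon>2 \<subseteq> mball_of M (t 0) \<epsilon>" using \<epsilon>2 by auto
      moreover have "A i t \<in> real_singular_chain_set i (ball_topology M (t 0) \<epsilon>2)"
        using fills_tuplesD(2)[OF A _ small_tuple_mono[OF i(2) \<delta>(2)]] i(1) False by simp
      ultimately show ?thesis using False real_chain_mono by auto
    qed (use i B in auto)
  next
    fix t assume "small_tuple M \<delta> 0 t"
    then have "small_tuple M \<delta>0 0 t" using small_tuple_mono \<delta>(2) by blast
    then have "chain_eval (\<lambda>_. 1) (A 0 t) = 1"
      by (rule fills_tuplesD(3)[OF A])
    then show "chain_eval (\<lambda>_. 1) (?A 0 t) = 1" by simp
  next
    fix i t assume i: "i < Suc p" and t: "small_tuple M \<delta> (Suc i) t"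
    show "real_chain_boundary (Suc i) (?A (Suc i) t) = (\<Sum>l\<le>Suc i. real_smult ((-1) ^ l) (?A i (skip l t)))"
    proof (cases "i = p")
      case True
      then show ?thesis using t B(2) by (simp add: z_def del: sum.atMost_Suc)
    next
      case False
      then have "i < p" using i by simp
      then have "real_chain_boundary (Suc i) (A (Suc i) t) = (\<Sum>l\<le>Suc i. real_smult ((-1) ^ l) (A i (skip l t)))"
        by (rule fills_tuplesD(4)[OF A _ small_tuple_mono[OF t \<delta>(2)]])
      then show ?thesis using \<open>i < p\<close> by (simp del: sum.atMost_Suc)
    qed
  qed
  with \<delta>(1) show ?case by blast
qed

subsection \<open>Homotopies between small chain maps\<close>

definition vertex :: "nat \<Rightarrow> nat \<Rightarrow> real" where
  "vertex j = (\<lambda>i. if i = j then 1 else 0)"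

lemma vertex_in_simplex [simp]: "vertex j \<in> standard_simplex p \<longleftrightarrow> j \<le> p"
  by (simp add: vertex_def)

lemma simplical_face_vertex: "simplical_face l (vertex j) = vertex (if j < l then j else Suc j)"
  by (auto simp: simplical_face_def vertex_def fun_eq_iff)

definition small_simplex :: "'m metric \<Rightarrow> real \<Rightarrow> nat \<Rightarrow> ((nat \<Rightarrow> real) \<Rightarrow> 'm) \<Rightarrow> bool" where
  "small_simplex M \<delta> p \<tau> \<longleftrightarrow> singular_simplex p (mtopology_of M) \<tau> \<and>
     (\<forall>x\<in>standard_simplex p. \<forall>y\<in>standard_simplex p. mdist M (\<tau> x) (\<tau> y) < \<delta>)"

lemma singular_face_image:
  "l \<le> Suc p \<Longrightarrow> singular_face (Suc p) l \<tau> ` standard_simplex p \<subseteq> \<tau> ` standard_simplex (Suc p)"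
  using simplical_face_in_standard_simplex[of "Suc p" l] by (auto simp: singular_face_def)

lemma small_simplex_face:
  assumes "small_simplex M \<delta> (Suc p) \<tau>" "l \<le> Suc p"
  shows "small_simplex M \<delta> p (singular_face (Suc p) l \<tau>)"
  unfolding small_simplex_def
proof (intro conjI ballI)
  show "singular_simplex p (mtopology_of M) (singular_face (Suc p) l \<tau>)"
    using singular_simplex_singular_face[of "Suc p" "mtopology_of M" \<tau> l] assms by (simp add: small_simplex_def)
  fix x y assume "x \<in> standard_simplex p" "y \<in> standard_simplex p"
  then have "singular_face (Suc p) l \<tau> x \<in> \<tau> ` standard_simplex (Suc p)"
     "singular_face (Suc p) l \<tau> y \<in> \<tau> ` standard_simplex (Suc p)"
    by (auto intro!: subsetD[OF singular_face_image[OF assms(2)]])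
  then show "mdist M (singular_face (Suc p) l \<tau> x) (singular_face (Suc p) l \<tau> y) < \<delta>"
    using assms(1) by (auto simp: small_simplex_def)
qed

lemma singular_simplex_in_space:
  "singular_simplex p X \<tau> \<Longrightarrow> x \<in> standard_simplex p \<Longrightarrow> \<tau> x \<in> topspace X"
  by (auto simp: singular_simplex_def continuous_map_def)

text \<open>A chain map on small simplices, carried by balls. Its augmentation is 0 because it will
  be the difference of two augmentation-preserving maps.\<close>

definition small_chain_map ::
  "'m metric \<Rightarrow> nat \<Rightarrow> real \<Rightarrow> real \<Rightarrow> (nat \<Rightarrow> ((nat \<Rightarrow> real) \<Rightarrow> 'm) \<Rightarrow> 'm real_chain) \<Rightarrow> bool" where
  "small_chain_map M p \<delta> \<epsilon> \<Phi> \<longleftrightarrow>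
     (\<forall>i\<le>p. \<forall>\<tau>. small_simplex M \<delta> i \<tau> \<longrightarrow>
        \<Phi> i \<tau> \<in> real_singular_chain_set i (ball_topology M (\<tau> (vertex 0)) \<epsilon>)) \<and>
     (\<forall>\<tau>. small_simplex M \<delta> 0 \<tau> \<longrightarrow> chain_eval (\<lambda>_. 1) (\<Phi> 0 \<tau>) = 0) \<and>
     (\<forall>i<p. \<forall>\<tau>. small_simplex M \<delta> (Suc i) \<tau> \<longrightarrow> real_chain_boundary (Suc i) (\<Phi> (Suc i) \<tau>) =
        (\<Sum>l\<le>Suc i. real_smult ((-1) ^ l) (\<Phi> i (singular_face (Suc i) l \<tau>))))"

text \<open>A chain homotopy from \<open>\<Phi>\<close> to 0, that is, \<partial>D + D\<partial> =
  \<Phi>; degree 0 is separate because D\<partial> has no term there.\<close>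

definition small_nullhomotopy :: "'m metric \<Rightarrow> nat \<Rightarrow> real \<Rightarrow> real \<Rightarrow>
   (nat \<Rightarrow> ((nat \<Rightarrow> real) \<Rightarrow> 'm) \<Rightarrow> 'm real_chain) \<Rightarrow> (nat \<Rightarrow> ((nat \<Rightarrow> real) \<Rightarrow> 'm) \<Rightarrow> 'm real_chain) \<Rightarrow> bool" where
  "small_nullhomotopy M p \<delta> \<epsilon> \<Phi> D \<longleftrightarrow>
     (\<forall>i\<le>p. \<forall>\<tau>. small_simplex M \<delta> i \<tau> \<longrightarrow>
        D i \<tau> \<in> real_singular_chain_set (Suc i) (ball_topology M (\<tau> (vertex 0)) \<epsilon>)) \<and>
     (\<forall>\<tau>. small_simplex M \<delta> 0 \<tau> \<longrightarrow> real_chain_boundary 1 (D 0 \<tau>) = \<Phi> 0 \<tau>) \<and>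
     (\<forall>i<p. \<forall>\<tau>. small_simplex M \<delta> (Suc i) \<tau> \<longrightarrow> real_chain_boundary (Suc (Suc i)) (D (Suc i) \<tau>) =
        \<Phi> (Suc i) \<tau> - (\<Sum>l\<le>Suc i. real_smult ((-1) ^ l) (D i (singular_face (Suc i) l \<tau>))))"

lemma small_chain_mapD:
  assumes "small_chain_map M p \<delta> \<epsilon> \<Phi>"
  shows "i \<le> p \<Longrightarrow> small_simplex M \<delta> i \<tau> \<Longrightarrow>
        \<Phi> i \<tau> \<in> real_singular_chain_set i (ball_topology M (\<tau> (vertex 0)) \<epsilon>)"
    and "small_simplex M \<delta> 0 \<tau> \<Longrightarrow> chain_eval (\<lambda>_. 1) (\<Phi> 0 \<tau>) = 0"
    and "i < p \<Longrightarrow> small_simplex M \<delta> (Suc i) \<tau> \<Longrightarrow> real_chain_boundary (Suc i) (\<Phi> (Suc i) \<tau>) =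
        (\<Sum>l\<le>Suc i. real_smult ((-1) ^ l) (\<Phi> i (singular_face (Suc i) l \<tau>)))"
  using assms unfolding small_chain_map_def by blast+

lemma small_nullhomotopyD:
  assumes "small_nullhomotopy M p \<delta> \<epsilon> \<Phi> D"
  shows "i \<le> p \<Longrightarrow> small_simplex M \<delta> i \<tau> \<Longrightarrow>
        D i \<tau> \<in> real_singular_chain_set (Suc i) (ball_topology M (\<tau> (vertex 0)) \<epsilon>)"
    and "small_simplex M \<delta> 0 \<tau> \<Longrightarrow> real_chain_boundary 1 (D 0 \<tau>) = \<Phi> 0 \<tau>"
    and "i < p \<Longrightarrow> small_simplex M \<delta> (Suc i) \<tau> \<Longrightarrow> real_chain_boundary (Suc (Suc i)) (D (Suc i) \<tau>) =
        \<Phi> (Suc i) \<tau> - (\<Sum>l\<le>Suc i. real_smult ((-1) ^ l) (D i (singular_face (Suc i) l \<tau>)))"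
  using assms unfolding small_nullhomotopy_def by blast+

text \<open>Acyclic carriers again: \<Phi>\<tau> - D\<partial>\<tau> is a cycle in a small ball and
  bounds in a larger one. Two sizes are kept apart, \<open>\<delta>\<close> for the carriers of
  \<open>\<Phi>\<close> and \<open>\<delta>'\<close> for the simplices, because
  \<open>\<Phi>\<close> will be available only on simplices finer than its carriers.\<close>

lemma small_nullhomotopy_exists:
  assumes M: "uniformly_acyclic M" and "\<epsilon> > 0"
  shows "\<exists>\<delta>>0. \<forall>\<delta>'\<le>\<delta>. \<forall>\<Phi>. small_chain_map M p \<delta>' \<delta> \<Phi> \<longrightarrow> (\<exists>D. small_nullhomotopy M p \<delta>' \<epsilon> \<Phi> D)"
  using \<open>\<epsilon> > 0\<close>
proof (induction p arbitrary: \<epsilon>)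
  case 0
  obtain \<delta> where \<delta>: "\<delta> > 0" "\<And>x p. x \<in> mspace M \<Longrightarrow>
      reduced_cycle_set p (ball_topology M x \<delta>) \<subseteq> real_boundary_set p (ball_topology M x \<epsilon>)"
    using M 0 unfolding uniformly_acyclic_def by metis
  have "\<exists>D. small_nullhomotopy M 0 \<delta>' \<epsilon> \<Phi> D" if \<Phi>: "small_chain_map M 0 \<delta>' \<delta> \<Phi>" for \<delta>' \<Phi>
  proof -
    have "\<exists>b. b \<in> real_singular_chain_set 1 (ball_topology M (\<tau> (vertex 0)) \<epsilon>) \<and> real_chain_boundary 1 b = \<Phi> 0 \<tau>"
      if \<tau>: "small_simplex M \<delta>' 0 \<tau>" for \<tau>
    proof -
      \<comment> \<open>Vanishing augmentation enters here, to make the 0-chain a reduced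
        cycle.\<close>
      have "\<Phi> 0 \<tau> \<in> reduced_cycle_set 0 (ball_topology M (\<tau> (vertex 0)) \<delta>)"
        using small_chain_mapD(1)[OF \<Phi> _ \<tau>] small_chain_mapD(2)[OF \<Phi> \<tau>]
        by (simp add: reduced_cycle_set_def real_cycle_set_def real_chain_boundary_def)
      moreover have "\<tau> (vertex 0) \<in> mspace M"
        using \<tau> singular_simplex_in_space[of 0 "mtopology_of M" \<tau> "vertex 0"] by (simp add: small_simplex_def)
      ultimately have "\<Phi> 0 \<tau> \<in> real_boundary_set 0 (ball_topology M (\<tau> (vertex 0)) \<epsilon>)"
        using \<delta>(2) by blast
      then show ?thesis by (auto simp: real_boundary_set_def)
    qed
    then obtain D0 where "\<And>\<tau>. small_simplex M \<delta>' 0 \<tau> \<Longrightarrow>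
       D0 \<tau> \<in> real_singular_chain_set 1 (ball_topology M (\<tau> (vertex 0)) \<epsilon>) \<and> real_chain_boundary 1 (D0 \<tau>) = \<Phi> 0 \<tau>"
      by metis
    then show ?thesis by (intro exI[of _ "\<lambda>_. D0"]) (simp add: small_nullhomotopy_def)
  qed
  with \<delta>(1) show ?case by blast
next
  case (Suc p)
  obtain \<epsilon>1 where \<epsilon>1: "\<epsilon>1 > 0" "\<And>x p. x \<in> mspace M \<Longrightarrow>
      reduced_cycle_set p (ball_topology M x \<epsilon>1) \<subseteq> real_boundary_set p (ball_topology M x \<epsilon>)"
    using M Suc.prems unfolding uniformly_acyclic_def by metis
  \<comment> \<open>As for tuples: the first vertex of a face is closer than
    \<open>\<delta>' \<le> \<epsilon>2\<close> to that of \<open>\<tau>\<close>.\<close>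
  define \<epsilon>2 where "\<epsilon>2 = min \<epsilon>1 \<epsilon> / 2"
  have \<epsilon>2: "\<epsilon>2 > 0" "2 * \<epsilon>2 \<le> \<epsilon>1" "\<epsilon>2 \<le> \<epsilon>" using \<epsilon>1(1) Suc.prems by (auto simp: \<epsilon>2_def)
  obtain \<delta>0 where \<delta>0: "\<delta>0 > 0" "\<And>\<delta>' \<Phi>. \<delta>' \<le> \<delta>0 \<Longrightarrow> small_chain_map M p \<delta>' \<delta>0 \<Phi> \<Longrightarrow>
      (\<exists>D. small_nullhomotopy M p \<delta>' \<epsilon>2 \<Phi> D)" using Suc.IH[OF \<epsilon>2(1)] by blast
  define \<delta> where "\<delta> = min \<delta>0 \<epsilon>2"
  have \<delta>: "\<delta> > 0" "\<delta> \<le> \<delta>0" "\<delta> \<le> \<epsilon>2" using \<delta>0 \<epsilon>2 by (auto simp: \<delta>_def)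
  have "\<exists>D. small_nullhomotopy M (Suc p) \<delta>' \<epsilon> \<Phi> D"
    if \<delta>': "\<delta>' \<le> \<delta>" and \<Phi>: "small_chain_map M (Suc p) \<delta>' \<delta> \<Phi>" for \<delta>' \<Phi>
  proof -
    have bm: "mball_of M x \<delta> \<subseteq> mball_of M x \<delta>0" for x using \<delta> by auto
    have "small_chain_map M p \<delta>' \<delta>0 \<Phi>"
      using \<Phi> real_chain_mono[OF _ bm] unfolding small_chain_map_def by simp
    then obtain D where D: "small_nullhomotopy M p \<delta>' \<epsilon>2 \<Phi> D" using \<delta>0(2)[of \<delta>' \<Phi>] \<delta>' \<delta> by auto
    define z where "z \<tau> = \<Phi> (Suc p) \<tau> - (\<Sum>l\<le>Suc p. real_smult ((-1) ^ l) (D p (singular_face (Suc p) l \<tau>)))" for \<tau>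
    have z: "z \<tau> \<in> real_boundary_set (Suc p) (ball_topology M (\<tau> (vertex 0)) \<epsilon>)"
      if \<tau>: "small_simplex M \<delta>' (Suc p) \<tau>" for \<tau>
    proof -
      note f = small_simplex_face[OF \<tau>]
      let ?x = "\<tau> (vertex 0)"
      have x: "?x \<in> mspace M"
        using \<tau> singular_simplex_in_space[of "Suc p" "mtopology_of M" \<tau> "vertex 0"] by (simp add: small_simplex_def)
      have "D p (singular_face (Suc p) l \<tau>) \<in> real_singular_chain_set (Suc p) (ball_topology M ?x \<epsilon>1)" if l: "l \<le> Suc p" for l
      proof -
        have "D p (singular_face (Suc p) l \<tau>) \<in> real_singular_chain_set (Suc p)
            (ball_topology M (singular_face (Suc p) l \<tau> (vertex 0)) \<epsilon>2)"
          by (rule small_nullhomotopyD(1)[OF D order_refl f[OF l]])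
        moreover have "singular_face (Suc p) l \<tau> (vertex 0) \<in> \<tau> ` standard_simplex (Suc p)"
          by (intro subsetD[OF singular_face_image[OF l]] imageI) simp
        then have "mdist M ?x (singular_face (Suc p) l \<tau> (vertex 0)) < \<delta>'"
          using \<tau> by (auto simp: small_simplex_def)
        then have "mball_of M (singular_face (Suc p) l \<tau> (vertex 0)) \<epsilon>2 \<subseteq> mball_of M ?x \<epsilon>1"
          using \<epsilon>2 \<delta> \<delta>' x by (intro mball_of_mono) auto
        ultimately show ?thesis by (rule real_chain_mono)
      qed
      moreover have "\<Phi> (Suc p) \<tau> \<in> real_singular_chain_set (Suc p) (ball_topology M ?x \<epsilon>1)"
      proof -
        have "\<Phi> (Suc p) \<tau> \<in> real_singular_chain_set (Suc p) (ball_topology M ?x \<delta>)"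
          by (rule small_chain_mapD(1)[OF \<Phi> order_refl \<tau>])
        moreover have "mball_of M ?x \<delta> \<subseteq> mball_of M ?x \<epsilon>1" using \<delta> \<epsilon>2 by auto
        ultimately show ?thesis by (rule real_chain_mono)
      qed
      ultimately have "z \<tau> \<in> real_singular_chain_set (Suc p) (ball_topology M ?x \<epsilon>1)"
        unfolding z_def by (intro real_chain_diff real_chain_sum real_chain_smult) auto
      \<comment> \<open>The \<Phi>-terms of \<partial>D\<partial>\<tau> cancel
        \<partial>\<Phi>\<tau>; what is left is D on the iterated faces of \<tau>, which cancel in
        pairs.\<close>
      moreover have "real_chain_boundary (Suc p) (z \<tau>) = 0"
      proof -
        have \<Phi>b: "real_chain_boundary (Suc p) (\<Phi> (Suc p) \<tau>) =
            (\<Sum>l\<le>Suc p. real_smult ((-1) ^ l) (\<Phi> p (singular_face (Suc p) l \<tau>)))"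
          by (rule small_chain_mapD(3)[OF \<Phi> lessI \<tau>])
        show ?thesis
        proof (cases p)
          case 0
          have "real_chain_boundary (Suc 0) (D 0 (singular_face (Suc 0) l \<tau>)) = \<Phi> 0 (singular_face (Suc 0) l \<tau>)"
            if "l \<le> Suc 0" for l
            using small_nullhomotopyD(2)[OF D, of "singular_face (Suc 0) l \<tau>"] f[of l] that by (simp add: 0)
          then show ?thesis
            using \<Phi>b by (simp add: z_def 0 real_chain_boundary_diff real_chain_boundary_add real_chain_boundary_smult)
        next
          case (Suc q)
          have "real_chain_boundary (Suc p) (D p (singular_face (Suc p) l \<tau>)) =
             \<Phi> p (singular_face (Suc p) l \<tau>) - (\<Sum>i\<le>p. real_smult ((-1) ^ i)
               (D q (singular_face p i (singular_face (Suc p) l \<tau>))))" if "l \<le> Suc p" for l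
            using small_nullhomotopyD(3)[OF D, of q "singular_face (Suc p) l \<tau>"] f[OF that]
            by (simp add: Suc del: sum.atMost_Suc)
          then have "chain_eval \<phi> (real_chain_boundary (Suc p) (z \<tau>)) =
             (\<Sum>l\<le>Suc p. \<Sum>i\<le>p. (-1) ^ (l + i) *
               chain_eval \<phi> (D q (singular_face p i (singular_face (Suc p) l \<tau>))))" for \<phi>
            using \<Phi>b by (simp add: z_def real_chain_boundary_sum real_chain_boundary_smult real_chain_boundary_diff
                sum_distrib_left power_add mult.assoc right_diff_distrib sum_subtractf del: sum.atMost_Suc)
          moreover have "(\<Sum>l\<le>Suc p. \<Sum>i\<le>p. (-1) ^ (l + i) *
               chain_eval \<phi> (D q (singular_face p i (singular_face (Suc p) l \<tau>)))) = 0" for \<phi>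
            by (rule alternating_double_sum) (simp add: singular_face_face Suc)
          ultimately show ?thesis by (intro real_chain_eqI) simp
        qed
      qed
      ultimately have "z \<tau> \<in> reduced_cycle_set (Suc p) (ball_topology M ?x \<epsilon>1)"
        by (simp add: reduced_cycle_set_def real_cycle_set_def)
      then show ?thesis using \<epsilon>1(2)[OF x, of "Suc p"] by blast
    qed
    have "\<exists>b. b \<in> real_singular_chain_set (Suc (Suc p)) (ball_topology M (\<tau> (vertex 0)) \<epsilon>) \<and>
        real_chain_boundary (Suc (Suc p)) b = z \<tau>" if "small_simplex M \<delta>' (Suc p) \<tau>" for \<tau>
      by (use z[OF that] in \<open>auto simp: real_boundary_set_def\<close>)
    then obtain B where B: "\<And>\<tau>. small_simplex M \<delta>' (Suc p) \<tau> \<Longrightarrow>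
        B \<tau> \<in> real_singular_chain_set (Suc (Suc p)) (ball_topology M (\<tau> (vertex 0)) \<epsilon>) \<and>
        real_chain_boundary (Suc (Suc p)) (B \<tau>) = z \<tau>" by metis
    have bm': "mball_of M x \<epsilon>2 \<subseteq> mball_of M x \<epsilon>" for x using \<epsilon>2 by auto
    have "small_nullhomotopy M (Suc p) \<delta>' \<epsilon> \<Phi> (D(Suc p := B))"
      unfolding small_nullhomotopy_def
    proof (intro conjI allI impI)
      fix i \<tau> assume i: "i \<le> Suc p" and \<tau>: "small_simplex M \<delta>' i \<tau>"
      show "(D(Suc p := B)) i \<tau> \<in> real_singular_chain_set (Suc i) (ball_topology M (\<tau> (vertex 0)) \<epsilon>)"
      proof (cases "i = Suc p")
        case False
        then have "D i \<tau> \<in> real_singular_chain_set (Suc i) (ball_topology M (\<tau> (vertex 0)) \<epsilon>2)"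
          using small_nullhomotopyD(1)[OF D _ \<tau>] i by simp
        then show ?thesis using False real_chain_mono[OF _ bm'] by simp
      qed (use B \<tau> in auto)
    next
      fix \<tau> assume "small_simplex M \<delta>' 0 \<tau>"
      then have "real_chain_boundary 1 (D 0 \<tau>) = \<Phi> 0 \<tau>"
        by (rule small_nullhomotopyD(2)[OF D])
      then show "real_chain_boundary 1 ((D(Suc p := B)) 0 \<tau>) = \<Phi> 0 \<tau>" by simp
    next
      fix i \<tau> assume i: "i < Suc p" and \<tau>: "small_simplex M \<delta>' (Suc i) \<tau>"
      show "real_chain_boundary (Suc (Suc i)) ((D(Suc p := B)) (Suc i) \<tau>) =
        \<Phi> (Suc i) \<tau> - (\<Sum>l\<le>Suc i. real_smult ((-1) ^ l) ((D(Suc p := B)) i (singular_face (Suc i) l \<tau>)))"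
      proof (cases "i = p")
        case True
        then show ?thesis using B \<tau> by (simp add: z_def del: sum.atMost_Suc)
      next
        case False
        then have "i < p" using i by simp
        then have "real_chain_boundary (Suc (Suc i)) (D (Suc i) \<tau>) =
          \<Phi> (Suc i) \<tau> - (\<Sum>l\<le>Suc i. real_smult ((-1) ^ l) (D i (singular_face (Suc i) l \<tau>)))"
          by (rule small_nullhomotopyD(3)[OF D _ \<tau>])
        then show ?thesis using \<open>i < p\<close> by (simp del: sum.atMost_Suc)
      qed
    qed
    then show ?thesis by blast
  qed
  with \<delta>(1) show ?case by blast
qed

subsection \<open>Uniform subdivision over a compact set of simplices\<close>

lemma openin_simplex_subbasis:
  assumes "compactin (subtopology (powertop_real UNIV) (standard_simplex p)) C" "openin X U"
  shows "openin (simplex_topology p X) {\<sigma>. singular_simplex p X \<sigma> \<and> \<sigma> ` C \<subseteq> U}"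
proof -
  have "{\<sigma>. singular_simplex p X \<sigma> \<and> \<sigma> ` C \<subseteq> U} =
    {f. continuous_map (subtopology (powertop_real UNIV) (standard_simplex p)) X f \<and>
        f \<in> extensional (topspace (subtopology (powertop_real UNIV) (standard_simplex p))) \<and> f ` C \<subseteq> U}"
    by (auto simp: singular_simplex_def)
  then show ?thesis
    unfolding simplex_topology_def compact_open_topology_def
    using assms by (intro topology_generated_by_Basis) blast
qed

abbreviation simplex_id :: "nat \<Rightarrow> (nat \<Rightarrow> real) \<Rightarrow> (nat \<Rightarrow> real)" where
  "simplex_id p \<equiv> restrict id (standard_simplex p)"

abbreviation subdivided_id :: "nat \<Rightarrow> nat \<Rightarrow> (nat \<Rightarrow> real) chain" where
  "subdivided_id p m \<equiv> (singular_subdivision p ^^ m) (frag_of (simplex_id p))"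

lemma singular_simplex_id:
  "singular_simplex p (subtopology (powertop_real UNIV) (standard_simplex p)) (simplex_id p)"
  by (simp add: singular_simplex_def)

lemma subdivided_id_chain:
  "singular_chain p (subtopology (powertop_real UNIV) (standard_simplex p)) (subdivided_id p m)"
  by (intro singular_chain_subdivision_power) (simp add: singular_chain_of singular_simplex_id)

lemma naturality_subdivision_power:
  "singular_chain p X c \<Longrightarrow>
   (singular_subdivision p ^^ m) (chain_map p g c) = chain_map p g ((singular_subdivision p ^^ m) c)"
  by (induction m) (simp_all add: naturality_singular_subdivision[OF singular_chain_subdivision_power])

text \<open>By naturality the pieces of \<open>\<sigma>\<close> are its composites with a finite
  family of maps that does not depend on \<open>\<sigma>\<close>. Conditions on the pieces thus
  become conditions on the values of \<open>\<sigma>\<close> on fixed compact sets or at fixed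
  points.\<close>

lemma subdivision_simplex:
  assumes "singular_simplex p X \<sigma>"
  shows "(singular_subdivision p ^^ m) (frag_of \<sigma>) = chain_map p \<sigma> (subdivided_id p m)"
proof -
  have "chain_map p \<sigma> (subdivided_id p m) = (singular_subdivision p ^^ m) (chain_map p \<sigma> (frag_of (simplex_id p)))"
    by (rule naturality_subdivision_power[symmetric], unfold singular_chain_of) (rule singular_simplex_id)
  then show ?thesis by (simp add: singular_simplex_chain_map_id[OF assms] del: chain_map_of)
qed

lemma keys_chain_map: "Poly_Mapping.keys (chain_map p g c) \<subseteq> simplex_map p g ` Poly_Mapping.keys c"
  unfolding chain_map_def using keys_frag_extend[of "frag_of \<circ> simplex_map p g" c] by fastforce

text \<open>Demanding all levels from \<open>n\<close> on makes the property monotone in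
  \<open>n\<close>, so that the maximum of several levels can be taken.\<close>

definition subordinate :: "'a set set \<Rightarrow> nat \<Rightarrow> nat \<Rightarrow> ((nat \<Rightarrow> real) \<Rightarrow> 'a) \<Rightarrow> bool" where
  "subordinate \<V> p n \<sigma> \<longleftrightarrow> (\<forall>m\<ge>n. \<forall>\<tau>\<in>Poly_Mapping.keys ((singular_subdivision p ^^ m) (frag_of \<sigma>)).
     \<exists>V\<in>\<V>. \<tau> ` standard_simplex p \<subseteq> V)"

lemma iterated_subdivision_subordinate:
  assumes \<C>: "\<And>U. U \<in> \<C> \<Longrightarrow> openin X U" "topspace X \<subseteq> \<Union>\<C>" "singular_chain p X c"
  shows "\<exists>n. \<forall>m\<ge>n. \<forall>f\<in>Poly_Mapping.keys ((singular_subdivision p ^^ m) c). \<exists>V\<in>\<C>. f ` standard_simplex p \<subseteq> V"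
proof (rule sufficient_iterated_singular_subdivision_exists[of \<C> X p c, OF assms])
  fix n assume n: "\<And>m f. n \<le> m \<Longrightarrow> f \<in> Poly_Mapping.keys ((singular_subdivision p ^^ m) c) \<Longrightarrow>
      \<exists>V\<in>\<C>. f \<in> standard_simplex p \<rightarrow> V"
  show "\<exists>n. \<forall>m\<ge>n. \<forall>f\<in>Poly_Mapping.keys ((singular_subdivision p ^^ m) c). \<exists>V\<in>\<C>. f ` standard_simplex p \<subseteq> V"
    unfolding image_subset_iff_funcset by (intro exI[of _ n] allI impI ballI n)
qed

text \<open>The preimages of the members of \<open>\<V>\<close> cover the standard simplex, so some
  level \<open>n\<close> works for \<open>\<sigma>\<close>. That each of the finitely many compact
  pieces goes into a given open set is an open condition in the compact-open topology.\<close>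

lemma subordinate_neighbourhood:
  assumes \<V>: "\<And>V. V \<in> \<V> \<Longrightarrow> openin X V" "topspace X \<subseteq> \<Union>\<V>" and \<sigma>: "singular_simplex p X \<sigma>"
  shows "\<exists>W n. openin (simplex_topology p X) W \<and> \<sigma> \<in> W \<and> (\<forall>\<sigma>'\<in>W. subordinate \<V> p n \<sigma>')"
proof -
  let ?D = "subtopology (powertop_real UNIV) (standard_simplex p)"
  have cont: "continuous_map ?D X \<sigma>" using \<sigma> by (simp add: singular_simplex_def)
  let ?\<C> = "(\<lambda>V. {x \<in> topspace ?D. \<sigma> x \<in> V}) ` \<V>"
  have c1: "openin ?D U" if "U \<in> ?\<C>" for U
    using that \<V>(1) openin_continuous_map_preimage[OF cont] by blast
  have c2: "topspace ?D \<subseteq> \<Union>?\<C>"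
    using \<V>(2) cont unfolding continuous_map_def by fastforce
  have c3: "singular_chain p ?D (frag_of (simplex_id p))"
    unfolding singular_chain_of by (rule singular_simplex_id)
  have "\<exists>n. \<forall>m\<ge>n. \<forall>f\<in>Poly_Mapping.keys (subdivided_id p m). \<exists>U\<in>?\<C>. f ` standard_simplex p \<subseteq> U"
    by (rule iterated_subdivision_subordinate[OF _ c2 c3]) (rule c1)
  then obtain n where n: "\<forall>m\<ge>n. \<forall>f\<in>Poly_Mapping.keys (subdivided_id p m). \<exists>U\<in>?\<C>. f ` standard_simplex p \<subseteq> U"
    by (elim exE)
  have "\<exists>V\<in>\<V>. \<sigma> ` g ` standard_simplex p \<subseteq> V" if "g \<in> Poly_Mapping.keys (subdivided_id p n)" for g
  proof -
    from n[rule_format, OF order_refl that] obtain U where "U \<in> ?\<C>" "g ` standard_simplex p \<subseteq> U" by (rule bexE)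
    then show ?thesis by auto
  qed
  then obtain V where V: "\<And>g. g \<in> Poly_Mapping.keys (subdivided_id p n) \<Longrightarrow>
      V g \<in> \<V> \<and> \<sigma> ` g ` standard_simplex p \<subseteq> V g" by metis
  \<comment> \<open>The first factor keeps \<open>W\<close> a set of simplices even when the
    intersection is over the empty family.\<close>
  define W where "W = {\<sigma>'. singular_simplex p X \<sigma>'} \<inter> (\<Inter>g\<in>Poly_Mapping.keys (subdivided_id p n).
      {\<sigma>'. singular_simplex p X \<sigma>' \<and> \<sigma>' ` g ` standard_simplex p \<subseteq> V g})"
  have gc: "compactin ?D (g ` standard_simplex p)" if "g \<in> Poly_Mapping.keys (subdivided_id p n)" for g
  proof (rule image_compactin)
    show "compactin ?D (standard_simplex p)"
      using compactin_standard_simplex[of p] by (simp add: compactin_subtopology)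
    show "continuous_map ?D ?D g"
      using subdivided_id_chain[of p n] that by (auto simp: singular_chain_def singular_simplex_def)
  qed
  have "openin (simplex_topology p X) W"
  proof (cases "Poly_Mapping.keys (subdivided_id p n) = {}")
    case True
    then show ?thesis
      using openin_topspace[of "simplex_topology p X"] by (simp add: W_def del: keys_eq_empty)
  next
    case False
    have "openin (simplex_topology p X) {\<sigma>'. singular_simplex p X \<sigma>'}"
      using openin_topspace[of "simplex_topology p X"] by simp
    then show ?thesis
      unfolding W_def using False V gc \<V>(1)
      by (intro openin_Int openin_INT2 openin_simplex_subbasis) (auto simp del: keys_eq_empty)
  qed
  moreover have "\<sigma> \<in> W" using V \<sigma> by (auto simp: W_def)
  moreover have "subordinate \<V> p n \<sigma>'" if \<sigma>': "\<sigma>' \<in> W" for \<sigma>'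
    unfolding subordinate_def
  proof (intro allI impI ballI)
    fix m \<tau> assume m: "n \<le> m" and \<tau>: "\<tau> \<in> Poly_Mapping.keys ((singular_subdivision p ^^ m) (frag_of \<sigma>'))"
    have ss: "singular_simplex p X \<sigma>'" using \<sigma>' by (auto simp: W_def)
    \<comment> \<open>Subdivide \<open>n\<close> times first: each piece lies in some
      \<open>V g\<close>, and subdividing it further does not leave \<open>V g\<close>.\<close>
    let ?c = "(singular_subdivision p ^^ n) (frag_of \<sigma>')"
    have "(singular_subdivision p ^^ m) (frag_of \<sigma>') = (singular_subdivision p ^^ (m - n)) ?c"
      using funpow_add[of "m - n" n "singular_subdivision p :: 'a chain \<Rightarrow> _"] m by simp
    then have "\<tau> \<in> Poly_Mapping.keys (frag_extend (\<lambda>\<rho>. (singular_subdivision p ^^ (m - n)) (frag_of \<rho>)) ?c)"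
      using \<tau> singular_subdivision_power_extend[where z = ?c and p = p and m = "m - n"] by simp
    from subsetD[OF keys_frag_extend this] obtain \<rho> where \<rho>: "\<rho> \<in> Poly_Mapping.keys ?c"
      and \<tau>\<rho>: "\<tau> \<in> Poly_Mapping.keys ((singular_subdivision p ^^ (m - n)) (frag_of \<rho>))"
      by (rule UN_E)
    have "\<rho> \<in> simplex_map p \<sigma>' ` Poly_Mapping.keys (subdivided_id p n)"
      using \<rho> unfolding subdivision_simplex[OF ss] by (rule subsetD[OF keys_chain_map])
    then obtain g where g: "g \<in> Poly_Mapping.keys (subdivided_id p n)" "\<rho> = simplex_map p \<sigma>' g"
      by (elim imageE)
    have "\<rho> ` standard_simplex p \<subseteq> V g"
      using \<sigma>' g by (auto simp: W_def simplex_map_def)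
    moreover have "singular_chain p X ?c"
      by (intro singular_chain_subdivision_power) (simp add: singular_chain_of ss)
    then have "singular_simplex p X \<rho>" using \<rho> by (auto simp: singular_chain_def)
    ultimately have "singular_chain p (subtopology X (V g)) ((singular_subdivision p ^^ (m - n)) (frag_of \<rho>))"
      by (intro singular_chain_subdivision_power) (simp add: singular_chain_of singular_simplex_subtopology)
    then have "\<tau> ` standard_simplex p \<subseteq> V g" using \<tau>\<rho> by (auto simp: singular_chain_subtopology)
    then show "\<exists>V\<in>\<V>. \<tau> ` standard_simplex p \<subseteq> V" using V g(1) by blast
  qed
  ultimately show ?thesis by blast
qed

lemma subordinate_mono: "subordinate \<V> p n \<sigma> \<Longrightarrow> n \<le> n' \<Longrightarrow> subordinate \<V> p n' \<sigma>"
  unfolding subordinate_def by (meson order_trans)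

lemma subordinate_compact:
  assumes \<V>: "\<And>V. V \<in> \<V> \<Longrightarrow> openin X V" "topspace X \<subseteq> \<Union>\<V>" and C: "compactin (simplex_topology p X) C"
  shows "\<exists>n. \<forall>\<sigma>\<in>C. subordinate \<V> p n \<sigma>"
proof -
  have sub: "singular_simplex p X \<sigma>" if "\<sigma> \<in> C" for \<sigma>
    using C that compactin_subset_topspace by fastforce
  then have "\<forall>\<sigma>\<in>C. \<exists>W n. openin (simplex_topology p X) W \<and> \<sigma> \<in> W \<and> (\<forall>\<sigma>'\<in>W. subordinate \<V> p n \<sigma>')"
    using subordinate_neighbourhood[OF \<V>] by blast
  then obtain W n where W: "\<And>\<sigma>. \<sigma> \<in> C \<Longrightarrow> openin (simplex_topology p X) (W \<sigma>) \<and> \<sigma> \<in> W \<sigma> \<and> (\<forall>\<sigma>'\<in>W \<sigma>. subordinate \<V> p (n \<sigma>) \<sigma>')"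
    by metis
  obtain F where F: "finite F" "F \<subseteq> C" "C \<subseteq> (\<Union>\<sigma>\<in>F. W \<sigma>)"
  proof -
    have "\<exists>\<F>. finite \<F> \<and> \<F> \<subseteq> W ` C \<and> C \<subseteq> \<Union>\<F>"
      using W by (intro compactinD[OF C]) auto
    then show ?thesis using that by (metis finite_subset_image)
  qed
  have "subordinate \<V> p (Max (n ` F)) \<sigma>" if "\<sigma> \<in> C" for \<sigma>
  proof -
    have "\<sigma> \<in> (\<Union>\<sigma>\<in>F. W \<sigma>)" using F(3) that by (rule subsetD)
    then obtain \<rho> where \<rho>: "\<rho> \<in> F" "\<sigma> \<in> W \<rho>" by (rule UN_E)
    then have "subordinate \<V> p (n \<rho>) \<sigma>" using W[of \<rho>] F(2) by auto
    moreover have "n \<rho> \<le> Max (n ` F)" using F(1) \<rho>(1) by (intro Max_ge) auto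
    ultimately show ?thesis by (rule subordinate_mono)
  qed
  then show ?thesis by blast
qed

subsection \<open>Simple functions from a finite net\<close>

text \<open>A tuple is a function on all of \<open>nat\<close>; freezing the entries beyond
  \<open>n\<close> at \<open>c\<close> leaves finitely many values.\<close>

lemma simple_function_tuple:
  assumes "\<And>j. j \<le> n \<Longrightarrow> simple_function M (f j)"
  shows "simple_function M (\<lambda>x j. if j \<le> (n::nat) then f j x else c)"
  using assms
proof (induction n)
  case 0
  have "simple_function M (\<lambda>x. (\<lambda>y j. if j = 0 then y else c) (f 0 x))"
    using simple_function_compose[OF 0[OF order_refl], of "\<lambda>y j. if j = 0 then y else c"] by (simp add: o_def)
  also have "(\<lambda>x. (\<lambda>y j. if j = 0 then y else c) (f 0 x)) = (\<lambda>x j. if j \<le> (0::nat) then f j x else c)"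
    by (auto simp: fun_eq_iff)
  finally show ?case .
next
  case (Suc n)
  have "simple_function M (\<lambda>x. (\<lambda>x j. if j \<le> n then f j x else c) x)" using Suc by simp
  then have "simple_function M (\<lambda>x. (\<lambda>t y. t(Suc n := y)) (\<lambda>j. if j \<le> n then f j x else c) (f (Suc n) x))"
    using Suc.prems by (intro simple_function_compose2[where h = "\<lambda>t y. t(Suc n := y)"]) auto
  moreover have "(\<lambda>x. (\<lambda>t y. t(Suc n := y)) (\<lambda>j. if j \<le> n then f j x else c) (f (Suc n) x)) =
      (\<lambda>x j. if j \<le> Suc n then f j x else c)"
    by (auto simp: fun_eq_iff)
  ultimately show ?case by simp
qed

text \<open>Built by overriding on one open ball at a time: each step makes \<open>s\<close>
  constant on a Borel set and so keeps it simple.\<close>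

lemma finite_net_map:
  assumes "finite S" "\<And>x. x \<in> S \<Longrightarrow> x \<in> mspace M"
  shows "\<exists>s. simple_function (borel_of (mtopology_of M)) s \<and>
    (\<forall>y\<in>\<Union>x\<in>S. mball_of M x \<eta>. s y \<in> mspace M \<and> mdist M (s y) y < \<eta>)"
  using assms
proof (induction S rule: finite_induct)
  case empty
  then show ?case by auto
next
  case (insert x S)
  then obtain s where s: "simple_function (borel_of (mtopology_of M)) s"
    "\<forall>y\<in>\<Union>x\<in>S. mball_of M x \<eta>. s y \<in> mspace M \<and> mdist M (s y) y < \<eta>" by auto
  have "mball_of M x \<eta> \<in> sets (borel_of (mtopology_of M))"
    unfolding borel_of_def using openin_mball_of[of M x \<eta>]
    by (subst sets_measure_of) (auto dest: openin_subset simp del: topspace_mtopology_of)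
  moreover have "mball_of M x \<eta> \<inter> space (borel_of (mtopology_of M)) = mball_of M x \<eta>" by auto
  ultimately have "simple_function (borel_of (mtopology_of M)) (\<lambda>y. if y \<in> mball_of M x \<eta> then x else s y)"
    using s(1) by (intro simple_function_If_set) auto
  then show ?case
    using s(2) insert.prems by (intro exI[of _ "\<lambda>y. if y \<in> mball_of M x \<eta> then x else s y"]) auto
qed

lemma continuous_simplex_evaluation:
  assumes "v \<in> standard_simplex p"
  shows "continuous_map (simplex_topology p X) X (\<lambda>\<sigma>. \<sigma> v)"
  unfolding continuous_map_def
proof (intro conjI allI impI)
  show "(\<lambda>\<sigma>. \<sigma> v) \<in> topspace (simplex_topology p X) \<rightarrow> topspace X"
    using assms singular_simplex_in_space by fastforce
  fix U assume U: "openin X U"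
  have "compactin (subtopology (powertop_real UNIV) (standard_simplex p)) {v}" using assms by simp
  from openin_simplex_subbasis[OF this U]
  show "openin (simplex_topology p X) {\<sigma> \<in> topspace (simplex_topology p X). \<sigma> v \<in> U}" by simp
qed

lemma real_extend_compose:
  "real_extend F (real_chain_map p g c) = real_extend (\<lambda>\<sigma>. F (simplex_map p g \<sigma>)) c"
  by (intro real_chain_eqI) (simp add: real_chain_map_def)

text \<open>\<open>A\<close> is arbitrary, since fillings come from choice. The value depends on
  \<open>\<sigma>\<close> only through finitely many points
  \<open>s (r (\<sigma> (g (vertex j))))\<close>; evaluation at a fixed point is continuous, and
  \<open>s\<close> is simple.\<close>

lemma simple_function_subdivided:
  assumes s: "simple_function (borel_of (mtopology_of M)) s" and r: "continuous_map X (mtopology_of M) r"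
  shows "simple_function (simplex_borel p X) (\<lambda>\<sigma>. real_extend (\<lambda>\<rho>. A (\<lambda>j. s (\<rho> (vertex j))))
      (real_chain_map p r (real_frag ((singular_subdivision p ^^ m) (frag_of \<sigma>)))))"
    (is "simple_function ?M ?G")
proof -
  let ?D = "subtopology (powertop_real UNIV) (standard_simplex p)"
  let ?K = "Poly_Mapping.keys (subdivided_id p m)"
  \<comment> \<open>For \<open>j > p\<close> the vertex lies outside the simplex, where a singular
    simplex has the value \<open>undefined\<close>; hence the constant entry
    \<open>s undefined\<close>.\<close>
  have sf: "simple_function ?M (\<lambda>\<sigma>. \<Sum>g\<in>?K. real_smult (real_of_int (Poly_Mapping.lookup (subdivided_id p m) g))
      (A (\<lambda>j. if j \<le> p then s (r (\<sigma> (g (vertex j)))) else s undefined)))"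
  proof (rule simple_function_sum)
    fix g assume "g \<in> ?K"
    then have g: "singular_simplex p ?D g" using subdivided_id_chain[of p m] by (auto simp: singular_chain_def)
    have "simple_function ?M (\<lambda>\<sigma>. s (r (\<sigma> (g (vertex j)))))" if "j \<le> p" for j
    proof (rule simple_function_measurable_comp[OF _ s])
      have "g (vertex j) \<in> standard_simplex p"
        using singular_simplex_in_space[OF g, of "vertex j"] that by simp
      from continuous_map_compose[OF continuous_simplex_evaluation[OF this] r]
      show "(\<lambda>\<sigma>. r (\<sigma> (g (vertex j)))) \<in> ?M \<rightarrow>\<^sub>M borel_of (mtopology_of M)"
        by (intro measurable_borel_of) (simp add: o_def)
    qed
    from simple_function_tuple[OF this, of p]
    have "simple_function ?M (\<lambda>\<sigma> j. if j \<le> p then s (r (\<sigma> (g (vertex j)))) else s undefined)" by simp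
    from simple_function_compose[OF this, of "\<lambda>t. real_smult (real_of_int (Poly_Mapping.lookup (subdivided_id p m) g)) (A t)"]
    show "simple_function ?M (\<lambda>\<sigma>. real_smult (real_of_int (Poly_Mapping.lookup (subdivided_id p m) g))
      (A (\<lambda>j. if j \<le> p then s (r (\<sigma> (g (vertex j)))) else s undefined)))" by (simp add: o_def)
  qed
  have eq: "?G \<sigma> = (\<Sum>g\<in>?K. real_smult (real_of_int (Poly_Mapping.lookup (subdivided_id p m) g))
      (A (\<lambda>j. if j \<le> p then s (r (\<sigma> (g (vertex j)))) else s undefined)))" if "\<sigma> \<in> space ?M" for \<sigma>
  proof -
    have \<sigma>: "singular_simplex p X \<sigma>" using that by simp
    have "?G \<sigma> = real_extend (\<lambda>g. A (\<lambda>j. s (simplex_map p r (simplex_map p \<sigma> g) (vertex j)))) (real_frag (subdivided_id p m))"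
      unfolding subdivision_simplex[OF \<sigma>] real_chain_map_frag[symmetric] real_extend_compose ..
    also have "(\<lambda>g. A (\<lambda>j. s (simplex_map p r (simplex_map p \<sigma> g) (vertex j)))) =
        (\<lambda>g. A (\<lambda>j. if j \<le> p then s (r (\<sigma> (g (vertex j)))) else s undefined))"
      by (intro ext arg_cong[of _ _ A]) (simp add: simplex_map_def)
    also have "real_extend (\<lambda>g. A (\<lambda>j. if j \<le> p then s (r (\<sigma> (g (vertex j)))) else s undefined)) (real_frag (subdivided_id p m))
       = (\<Sum>g\<in>?K. real_smult (real_of_int (Poly_Mapping.lookup (subdivided_id p m) g))
      (A (\<lambda>j. if j \<le> p then s (r (\<sigma> (g (vertex j)))) else s undefined)))"
      unfolding real_extend_def keys_real_frag lookup_real_frag ..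
    finally show ?thesis .
  qed
  show ?thesis by (rule iffD2[OF simple_function_cong[OF eq] sf])
qed

subsection \<open>Boundaries of measure chains\<close>

lemma keys_real_chain_map: "Poly_Mapping.keys (real_chain_map p g c) \<subseteq> simplex_map p g ` Poly_Mapping.keys c"
proof
  fix \<tau> assume \<tau>: "\<tau> \<in> Poly_Mapping.keys (real_chain_map p g c)"
  show "\<tau> \<in> simplex_map p g ` Poly_Mapping.keys c"
  proof (rule ccontr)
    assume "\<tau> \<notin> simplex_map p g ` Poly_Mapping.keys c"
    then have "chain_eval (indicat_real {\<tau>}) (real_chain_map p g c) = 0"
      by (simp add: real_chain_map_def) (auto simp: chain_eval_def indicator_def intro!: sum.neutral)
    with \<tau> show False by (simp flip: lookup_eq_chain_eval add: in_keys_iff)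
  qed
qed

lemma chain_eval_diff_fun: "chain_eval (\<lambda>\<sigma>. \<phi> \<sigma> - \<psi> \<sigma>) c = chain_eval \<phi> c - chain_eval \<psi> c"
  by (simp add: chain_eval_def right_diff_distrib sum_subtractf)

text \<open>\<open>A\<close> is applied to whole sequences, so the equality must include the indices
  beyond the simplex, where both sides are \<open>s undefined\<close>.\<close>

lemma skip_face_vertices:
  assumes "singular_simplex (Suc p) X \<rho>" "l \<le> Suc p"
  shows "(\<lambda>j. s (singular_face (Suc p) l \<rho> (vertex j))) = skip l (\<lambda>j. s (\<rho> (vertex j)))"
proof
  fix j
  have "\<rho> x = undefined" if "x \<notin> standard_simplex (Suc p)" for x
    using assms(1) that by (auto simp: singular_simplex_def extensional_def)
  then show "s (singular_face (Suc p) l \<rho> (vertex j)) = skip l (\<lambda>j. s (\<rho> (vertex j))) j"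
    using assms(2) by (auto simp: singular_face_def skip_def simplical_face_vertex)
qed

text \<open>Local contractibility is asked of the target \<open>M\<close>, not of \<open>X\<close>;
  correspondingly the conclusion is about the image of \<open>c\<close> in \<open>M\<close>.\<close>

theorem measure_boundary_imp_boundary:
  assumes comp: "compact_space (mtopology_of M)" and lc: "locally_contractible (mtopology_of M)"
    and r: "continuous_map X (mtopology_of M) r"
    and c: "c \<in> real_cycle_set k X" and b: "iota_chain k X c \<in> measure_boundary_set k X"
  shows "real_chain_map k r c \<in> real_boundary_set k (mtopology_of M)"
proof -
  interpret Metric_space "mspace M" "mdist M" by simp
  have M: "uniformly_acyclic M" using comp lc by (rule locally_contractible_imp_uniformly_acyclic)
  \<comment> \<open>The bound 1 on the null-homotopy is arbitrary; only its existence
    counts.\<close>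
  obtain \<delta>1 where \<delta>1: "\<delta>1 > 0" "\<And>\<delta>' \<Phi>. \<delta>' \<le> \<delta>1 \<Longrightarrow> small_chain_map M k \<delta>' \<delta>1 \<Phi> \<Longrightarrow>
      \<exists>D. small_nullhomotopy M k \<delta>' 1 \<Phi> D"
    using small_nullhomotopy_exists[OF M zero_less_one, of k] by blast
  \<comment> \<open>\<open>Suc k\<close> is the degree of the simplices that are integrated. The
    radius \<open>\<delta>1/2\<close> leaves room for recentring: a filling is centred at a net
    point but has to lie in the \<open>\<delta>1\<close>-ball around the nearby vertex.\<close>
  obtain \<delta>2 A where \<delta>2: "\<delta>2 > 0" and A: "fills_tuples M (Suc k) \<delta>2 (\<delta>1/2) A"
    using fills_tuples_exists[OF M, of "\<delta>1/2" "Suc k"] \<delta>1(1) by auto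
  \<comment> \<open>Pieces are mapped into \<open>\<eta>\<close>-balls, so two vertices are less
    than \<open>2 * \<eta>\<close> apart; moving both to the net adds less than
    \<open>2 * \<eta>\<close>. The total must not exceed \<open>\<delta>2\<close>.\<close>
  define \<eta> where "\<eta> = min \<delta>1 \<delta>2 / 4"
  have \<eta>: "\<eta> > 0" "4 * \<eta> \<le> \<delta>1" "4 * \<eta> \<le> \<delta>2" using \<delta>1(1) \<delta>2 by (auto simp: \<eta>_def)
  obtain s where s: "simple_function (borel_of (mtopology_of M)) s"
    and sd: "\<And>y. y \<in> mspace M \<Longrightarrow> s y \<in> mspace M \<and> mdist M (s y) y < \<eta>"
  proof -
    have "mtotally_bounded (mspace M)"
      using comp by (intro compactin_imp_mtotally_bounded) (simp add: compact_space_def mtopology_of_def)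
    then obtain S where S: "finite S" "S \<subseteq> mspace M" "mspace M \<subseteq> (\<Union>x\<in>S. mball x \<eta>)"
      using \<eta>(1) unfolding mtotally_bounded_def by metis
    have "y \<in> (\<Union>x\<in>S. mball_of M x \<eta>)" if "y \<in> mspace M" for y
      using subsetD[OF S(3) that] by (simp add: mball_of_def)
    moreover obtain s where "simple_function (borel_of (mtopology_of M)) s"
      "\<forall>y\<in>\<Union>x\<in>S. mball_of M x \<eta>. s y \<in> mspace M \<and> mdist M (s y) y < \<eta>"
      using finite_net_map[OF S(1), of M \<eta>] S(2) by blast
    ultimately show ?thesis using that by blast
  qed
  let ?\<V> = "(\<lambda>x. {y \<in> topspace X. r y \<in> mball_of M x \<eta>}) ` mspace M"
  have \<V>: "\<And>V. V \<in> ?\<V> \<Longrightarrow> openin X V" "topspace X \<subseteq> \<Union>?\<V>"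
  proof -
    show "openin X V" if "V \<in> ?\<V>" for V
      using that openin_continuous_map_preimage[OF r openin_mball_of] by blast
    show "topspace X \<subseteq> \<Union>?\<V>"
    proof
      fix x assume x: "x \<in> topspace X"
      then have "r x \<in> mspace M" using continuous_map_image_subset_topspace[OF r] by auto
      then have "{y \<in> topspace X. r y \<in> mball_of M (r x) \<eta>} \<in> ?\<V>" "r x \<in> mball_of M (r x) \<eta>"
        using \<eta>(1) by auto
      with x show "x \<in> \<Union>?\<V>" by blast
    qed
  qed
  obtain \<mu> where \<mu>: "\<mu> \<in> measure_chain_set (Suc k) X" "measure_boundary (Suc k) X \<mu> = iota_chain k X c"
    using b by (auto simp: measure_boundary_set_def)
  then obtain C where C: "compactin (simplex_topology (Suc k) X) C"
    "\<And>A. A \<in> sets (simplex_borel (Suc k) X) \<Longrightarrow> A \<inter> C = {} \<Longrightarrow> \<mu> A = 0"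
    by (auto simp: measure_chain_set_iff compactly_determined_def)
  obtain n1 where n1: "\<And>\<sigma>. \<sigma> \<in> C \<Longrightarrow> subordinate ?\<V> (Suc k) n1 \<sigma>"
    using subordinate_compact[OF \<V> C(1)] by blast
  have cc: "c \<in> real_singular_chain_set k X" using c by (simp add: real_cycle_set_def)
  then have "compactin (simplex_topology k X) (Poly_Mapping.keys c)"
    by (intro finite_imp_compactin) (auto simp: real_singular_chain_set_def)
  then obtain n2 where n2: "\<And>\<sigma>. \<sigma> \<in> Poly_Mapping.keys c \<Longrightarrow> subordinate ?\<V> k n2 \<sigma>"
    using subordinate_compact[OF \<V>] by blast
  \<comment> \<open>One level that makes the pieces small both for the simplices in \<open>C\<close>
    and for those of \<open>c\<close>.\<close>
  define m where "m = max n1 n2"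
  have small: "small_simplex M (2 * \<eta>) p \<rho>"
    if \<rho>: "\<rho> \<in> Poly_Mapping.keys (real_chain_map p r (real_frag ((singular_subdivision p ^^ m) (frag_of \<sigma>))))"
      and \<sigma>: "singular_simplex p X \<sigma>" and f: "subordinate ?\<V> p n \<sigma>" and n: "n \<le> m" for p \<rho> \<sigma> n
  proof -
    let ?c = "(singular_subdivision p ^^ m) (frag_of \<sigma>)"
    obtain \<tau> where \<tau>: "\<tau> \<in> Poly_Mapping.keys ?c" "\<rho> = simplex_map p r \<tau>"
      using \<rho> keys_real_chain_map[of p r "real_frag ?c"] by auto
    have "singular_chain p X ?c" by (intro singular_chain_subdivision_power) (simp add: singular_chain_of \<sigma>)
    then have "singular_simplex p X \<tau>" using \<tau>(1) by (auto simp: singular_chain_def)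
    then have "singular_simplex p (mtopology_of M) \<rho>"
      unfolding \<tau>(2) by (rule singular_simplex_simplex_map[OF _ r])
    moreover obtain x where x: "x \<in> mspace M" "\<tau> ` standard_simplex p \<subseteq> {y \<in> topspace X. r y \<in> mball_of M x \<eta>}"
      using f n \<tau>(1) unfolding subordinate_def by blast
    have ball: "\<rho> y \<in> mball_of M x \<eta>" if "y \<in> standard_simplex p" for y
      using x(2) that by (auto simp: \<tau>(2) simplex_map_def)
    have "mdist M (\<rho> y) (\<rho> z) < 2 * \<eta>" if "y \<in> standard_simplex p" "z \<in> standard_simplex p" for y z
    proof -
      have "mdist M (\<rho> y) (\<rho> z) \<le> mdist M (\<rho> y) x + mdist M x (\<rho> z)"
        using ball[OF that(1)] ball[OF that(2)] x(1) by (intro triangle) auto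
      then show ?thesis using ball[OF that(1)] ball[OF that(2)] commute[of "\<rho> y" x] by auto
    qed
    ultimately show ?thesis by (simp add: small_simplex_def)
  qed
  define A' where "A' p \<rho> = A p (\<lambda>j. s (\<rho> (vertex j)))" for p \<rho>
  have st: "small_tuple M \<delta>2 p (\<lambda>j. s (\<rho> (vertex j)))" if \<rho>: "small_simplex M (2 * \<eta>) p \<rho>" for p \<rho>
    unfolding small_tuple_def
  proof (intro conjI allI impI)
    have v: "\<rho> (vertex j) \<in> mspace M" if "j \<le> p" for j
      using \<rho> that singular_simplex_in_space[of p "mtopology_of M" \<rho> "vertex j"] by (simp add: small_simplex_def)
    then show "s (\<rho> (vertex j)) \<in> mspace M" if "j \<le> p" for j using sd that by blast
    fix j l assume j: "j \<le> p" and l: "l \<le> p"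
    note vs = v[OF j] v[OF l] sd[OF v[OF j]] sd[OF v[OF l]]
    have "mdist M (s (\<rho> (vertex j))) (s (\<rho> (vertex l))) \<le>
        mdist M (s (\<rho> (vertex j))) (\<rho> (vertex j)) + mdist M (\<rho> (vertex j)) (s (\<rho> (vertex l)))"
      using vs by (intro triangle) auto
    also have "mdist M (\<rho> (vertex j)) (s (\<rho> (vertex l))) \<le>
        mdist M (\<rho> (vertex j)) (\<rho> (vertex l)) + mdist M (\<rho> (vertex l)) (s (\<rho> (vertex l)))"
      using vs by (intro triangle) auto
    also have "mdist M (\<rho> (vertex j)) (\<rho> (vertex l)) < 2 * \<eta>"
      using \<rho> j l by (simp add: small_simplex_def)
    finally show "mdist M (s (\<rho> (vertex j))) (s (\<rho> (vertex l))) < \<delta>2"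
      using vs \<eta> commute[of "s (\<rho> (vertex l))" "\<rho> (vertex l)"] by auto
  qed
  have A'_face: "real_chain_boundary (Suc p) (A' (Suc p) \<rho>) =
      (\<Sum>l\<le>Suc p. real_smult ((-1) ^ l) (A' p (singular_face (Suc p) l \<rho>)))"
    if \<rho>: "small_simplex M (2 * \<eta>) (Suc p) \<rho>" and p: "p < Suc k" for p \<rho>
  proof -
    have "singular_simplex (Suc p) (mtopology_of M) \<rho>" using \<rho> by (simp add: small_simplex_def)
    then show ?thesis
      using fills_tuplesD(4)[OF A p st[OF \<rho>]]
      by (simp add: A'_def skip_face_vertices del: sum.atMost_Suc)
  qed
  \<comment> \<open>Subdivide, map to \<open>M\<close>, and replace each piece by the filling of its
    net vertices. Off \<open>C\<close> the pieces may be large, but the value is still a chain of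
    \<open>M\<close>.\<close>
  define G where "G p \<sigma> = real_extend (A' p) (real_chain_map p r (real_frag ((singular_subdivision p ^^ m) (frag_of \<sigma>))))"
    for p \<sigma>
  have G_simple: "simple_function (simplex_borel p X) (G p)" for p
    using simple_function_subdivided[OF s r, of p "A p" m] by (simp add: G_def[abs_def] A'_def[abs_def])
  have G_in: "G p \<sigma> \<in> real_singular_chain_set p (mtopology_of M)" for p \<sigma>
    unfolding G_def A'_def by (intro real_chain_extend fills_tuplesD(1)[OF A])
  have "real_chain_boundary (Suc k) (G (Suc k) \<sigma>) =
      (\<Sum>i\<le>Suc k. real_smult ((-1) ^ i) (G k (singular_face (Suc k) i \<sigma>)))"
    if \<sigma>: "\<sigma> \<in> C" "singular_simplex (Suc k) X \<sigma>" for \<sigma>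
  proof -
    let ?c = "real_frag ((singular_subdivision (Suc k) ^^ m) (frag_of \<sigma>))"
    have s\<sigma>: "singular_chain (Suc k) X (frag_of \<sigma>)" using \<sigma>(2) by (simp add: singular_chain_of)
    have "n1 \<le> m" by (simp add: m_def)
    then have "real_chain_boundary (Suc k) (G (Suc k) \<sigma>) =
        real_extend (A' k) (real_chain_boundary (Suc k) (real_chain_map (Suc k) r ?c))"
      unfolding G_def
      using small[OF _ \<sigma>(2) n1[OF \<sigma>(1)]] A'_face[OF _ lessI] by (intro real_boundary_extend) blast
    also have "real_chain_boundary (Suc k) (real_chain_map (Suc k) r ?c) =
        real_chain_map k r (real_frag ((singular_subdivision k ^^ m) (chain_boundary (Suc k) (frag_of \<sigma>))))"
      using chain_boundary_subdivision_power[OF s\<sigma>, of m]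
      by (simp add: real_chain_boundary_map real_chain_boundary_frag)
    also have "real_frag ((singular_subdivision k ^^ m) (chain_boundary (Suc k) (frag_of \<sigma>))) =
        (\<Sum>i\<le>Suc k. real_smult ((-1) ^ i) (real_frag ((singular_subdivision k ^^ m) (frag_of (singular_face (Suc k) i \<sigma>)))))"
      by (subst singular_subdivision_power_extend)
         (simp add: chain_boundary_of frag_extend_sum frag_extend_cmul real_frag_sum real_frag_cmul del: sum.atMost_Suc)
    finally show ?thesis
      by (simp add: G_def real_chain_map_def real_extend_sum real_extend_smult del: sum.atMost_Suc)
  qed
  from boundary_chain_integral[OF \<mu>(1) C(2) cc \<mu>(2) G_simple G_simple this]
  have "real_extend (G k) c = real_chain_boundary (Suc k) (chain_integral (simplex_borel (Suc k) X) \<mu> (G (Suc k)))" ..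
  then have Gc: "real_extend (G k) c \<in> real_boundary_set k (mtopology_of M)"
    unfolding real_boundary_set_def using chain_integral_in[of _ "G (Suc k)"] G_in by blast
  define d where "d = real_chain_map k r (real_subdivision m k c)"
  have d: "d \<in> real_cycle_set k (mtopology_of M)"
    unfolding d_def
  proof (rule real_cycle_map[OF r])
    have "real_chain_boundary k (real_subdivision m k c) = real_subdivision m (k - 1) (real_chain_boundary k c)"
      using cc by (rule real_boundary_subdivision)
    also have "\<dots> = 0" using c by (simp add: real_cycle_set_def real_subdivision_def real_extend_def)
    finally show "real_subdivision m k c \<in> real_cycle_set k X"
      using real_subdivision_in[OF cc] by (simp add: real_cycle_set_def)
  qed
  have Gd: "real_extend (G k) c = real_extend (A' k) d"
    by (intro real_chain_eqI) (simp add: G_def[abs_def] d_def real_extend_compose real_subdivision_def)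
  have d_small: "small_simplex M (2 * \<eta>) k \<rho>" if "\<rho> \<in> Poly_Mapping.keys d" for \<rho>
  proof -
    have "d = (\<Sum>\<sigma>\<in>Poly_Mapping.keys c. real_smult (Poly_Mapping.lookup c \<sigma>)
        (real_chain_map k r (real_frag ((singular_subdivision k ^^ m) (frag_of \<sigma>)))))"
      by (simp add: d_def real_subdivision_def real_chain_map_def real_extend_def[of _ c] real_extend_sum real_extend_smult)
    with that obtain \<sigma> where \<sigma>: "\<sigma> \<in> Poly_Mapping.keys c"
      "\<rho> \<in> Poly_Mapping.keys (real_smult (Poly_Mapping.lookup c \<sigma>)
        (real_chain_map k r (real_frag ((singular_subdivision k ^^ m) (frag_of \<sigma>)))))"
      using Poly_Mapping.keys_sum by fastforce
    then show ?thesis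
      using cc by (intro small[of \<rho> k \<sigma> n2] n2) (auto simp: in_keys_iff m_def real_singular_chain_set_def)
  qed
  \<comment> \<open>On small simplices both \<open>A'\<close> and the identity commute with faces
    and preserve the augmentation, so their difference has a small null-homotopy.\<close>
  define \<Phi> where "\<Phi> p \<rho> = A' p \<rho> - Poly_Mapping.single \<rho> 1" for p \<rho>
  have "small_chain_map M k (2 * \<eta>) \<delta>1 \<Phi>"
    unfolding small_chain_map_def
  proof (intro conjI allI impI)
    fix i \<rho> assume i: "i \<le> k" and \<rho>: "small_simplex M (2 * \<eta>) i \<rho>"
    let ?x = "\<rho> (vertex 0)"
    have ss: "singular_simplex i (mtopology_of M) \<rho>" using \<rho> by (simp add: small_simplex_def)
    have x: "?x \<in> mspace M" using singular_simplex_in_space[OF ss, of "vertex 0"] by simp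
    have "mball_of M (s ?x) (\<delta>1/2) \<subseteq> mball_of M ?x \<delta>1"
      using sd[OF x] \<eta> x \<delta>1(1) commute[of ?x "s ?x"] by (intro mball_of_mono) auto
    then have "A' i \<rho> \<in> real_singular_chain_set i (ball_topology M ?x \<delta>1)"
      unfolding A'_def using fills_tuplesD(2)[OF A _ st[OF \<rho>]] i real_chain_mono by (simp add: real_chain_mono)
    moreover have "\<rho> ` standard_simplex i \<subseteq> mball_of M ?x \<delta>1"
    proof
      fix y assume "y \<in> \<rho> ` standard_simplex i"
      then obtain w where w: "w \<in> standard_simplex i" "y = \<rho> w" by blast
      have "mdist M ?x (\<rho> w) < 2 * \<eta>" using \<rho> w by (auto simp: small_simplex_def)
      then show "y \<in> mball_of M ?x \<delta>1"
        using x w singular_simplex_in_space[OF ss w(1)] \<eta> by auto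
    qed
    then have "Poly_Mapping.single \<rho> 1 \<in> real_singular_chain_set i (ball_topology M ?x \<delta>1)"
      by (simp add: real_chain_single singular_simplex_subtopology ss)
    ultimately show "\<Phi> i \<rho> \<in> real_singular_chain_set i (ball_topology M ?x \<delta>1)"
      unfolding \<Phi>_def by (rule real_chain_diff)
  next
    fix \<rho> assume "small_simplex M (2 * \<eta>) 0 \<rho>"
    then show "chain_eval (\<lambda>_. 1) (\<Phi> 0 \<rho>) = 0"
      using fills_tuplesD(3)[OF A st] by (simp add: \<Phi>_def A'_def)
  next
    fix i \<rho> assume i: "i < k" and \<rho>: "small_simplex M (2 * \<eta>) (Suc i) \<rho>"
    have "chain_eval \<phi> (real_chain_boundary (Suc i) (\<Phi> (Suc i) \<rho>)) =
        chain_eval \<phi> (\<Sum>l\<le>Suc i. real_smult ((-1) ^ l) (\<Phi> i (singular_face (Suc i) l \<rho>)))" for \<phi>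
      using A'_face[OF \<rho>] i
      by (simp add: \<Phi>_def real_chain_boundary_diff chain_eval_boundary[of _ _ "Poly_Mapping.single _ _"]
          right_diff_distrib sum_subtractf del: sum.atMost_Suc)
    then show "real_chain_boundary (Suc i) (\<Phi> (Suc i) \<rho>) =
        (\<Sum>l\<le>Suc i. real_smult ((-1) ^ l) (\<Phi> i (singular_face (Suc i) l \<rho>)))"
      by (intro real_chain_eqI)
  qed
  then obtain D where D: "small_nullhomotopy M k (2 * \<eta>) 1 \<Phi> D" using \<delta>1(2)[of "2 * \<eta>" \<Phi>] \<eta> by auto
  have D_in: "real_extend (D k) d \<in> real_singular_chain_set (Suc k) (mtopology_of M)"
    using small_nullhomotopyD(1)[OF D order_refl d_small] by (intro real_chain_extend) (simp add: real_chain_subtopology)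
  \<comment> \<open>The homotopy formula; its term D\<partial>d vanishes since \<open>d\<close> is a
    cycle.\<close>
  have "real_chain_boundary (Suc k) (real_extend (D k) d) = real_extend (\<Phi> k) d"
  proof (cases k)
    case 0
    have "chain_eval \<phi> (real_chain_boundary (Suc 0) (real_extend (D 0) d)) = chain_eval \<phi> (real_extend (\<Phi> 0) d)" for \<phi>
    proof -
      have "chain_eval \<phi> (real_chain_boundary (Suc 0) (real_extend (D 0) d)) =
          chain_eval (\<lambda>\<sigma>. chain_eval \<phi> (real_chain_boundary (Suc 0) (D 0 \<sigma>))) d"
        by (simp add: chain_eval_boundary)
      also have "\<dots> = chain_eval (\<lambda>\<sigma>. chain_eval \<phi> (\<Phi> 0 \<sigma>)) d"
        using small_nullhomotopyD(2)[OF D] d_small by (intro chain_eval_cong) (simp add: 0)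
      finally show ?thesis by simp
    qed
    then show ?thesis unfolding 0 by (intro real_chain_eqI)
  next
    case (Suc q)
    have "chain_eval \<phi> (real_chain_boundary (Suc k) (real_extend (D k) d)) = chain_eval \<phi> (real_extend (\<Phi> k) d)" for \<phi>
    proof -
      have "chain_eval \<phi> (real_chain_boundary (Suc k) (real_extend (D k) d)) =
          chain_eval (\<lambda>\<sigma>. chain_eval \<phi> (real_chain_boundary (Suc k) (D k \<sigma>))) d"
        by (simp add: chain_eval_boundary del: sum.atMost_Suc)
      also have "\<dots> = chain_eval (\<lambda>\<sigma>. chain_eval \<phi> (\<Phi> k \<sigma>) - (\<Sum>l\<le>k. (-1) ^ l * chain_eval \<phi> (D q (singular_face k l \<sigma>)))) d"
        using small_nullhomotopyD(3)[OF D, of q] d_small by (intro chain_eval_cong) (simp add: Suc del: sum.atMost_Suc)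
      also have "\<dots> = chain_eval (\<lambda>\<sigma>. chain_eval \<phi> (\<Phi> k \<sigma>)) d - chain_eval (\<lambda>\<sigma>. chain_eval \<phi> (D q \<sigma>)) (real_chain_boundary k d)"
        by (simp add: chain_eval_boundary Suc chain_eval_diff_fun del: sum.atMost_Suc)
      also have "real_chain_boundary k d = 0" using d by (simp add: real_cycle_set_def)
      finally show ?thesis by simp
    qed
    then show ?thesis by (intro real_chain_eqI)
  qed
  also have "real_extend (\<Phi> k) d = real_extend (A' k) d - d"
    by (intro real_chain_eqI) (simp add: \<Phi>_def chain_eval_diff_fun)
  finally have "real_extend (A' k) d - d \<in> real_boundary_set k (mtopology_of M)"
    using D_in unfolding real_boundary_set_def by (metis image_eqI)
  \<comment> \<open>The image of \<open>d\<close> under \<open>A'\<close> bounds by integration, and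
    its difference from \<open>d\<close> by the homotopy, so \<open>d\<close> bounds; subdivision
    leads back from \<open>d\<close> to the image of \<open>c\<close>.\<close>
  then have "real_extend (A' k) d - (real_extend (A' k) d - d) \<in> real_boundary_set k (mtopology_of M)"
    using Gc Gd real_boundary_diff by metis
  moreover have "real_chain_map k r (real_subdivision m k c - c) \<in> real_boundary_set k (mtopology_of M)"
    using real_boundary_map[OF r real_subdivision_homologous[OF c]] .
  ultimately have "d - (d - real_chain_map k r c) \<in> real_boundary_set k (mtopology_of M)"
    using real_boundary_diff by (fastforce simp: d_def real_chain_map_def real_extend_diff)
  then show ?thesis by simp
qed

subsection \<open>Pointed local contractibility\<close>

abbreviation I01 :: "real topology" where
  "I01 \<equiv> top_of_set {0..1}"

text \<open>The contraction keeps \<open>x\<close> fixed, so that contractions of several copies of \<open>X\<close> glued at \<open>x\<close>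
  fit together.\<close>

definition contracts_at :: "'a topology \<Rightarrow> 'a \<Rightarrow> bool" where
  "contracts_at X x \<longleftrightarrow> (\<forall>U. openin X U \<longrightarrow> x \<in> U \<longrightarrow>
     (\<exists>V. openin X V \<and> x \<in> V \<and> V \<subseteq> U \<and>
        homotopic_with (\<lambda>h. h x = x) (subtopology X V) (subtopology X U) id (\<lambda>_. x)))"

lemma contracts_at_open_subtopology:
  assumes e: "openin K e" "x \<in> e" and c: "contracts_at (subtopology K e) x"
  shows "contracts_at K x"
  unfolding contracts_at_def
proof (intro allI impI)
  fix U assume U: "openin K U" "x \<in> U"
  have "openin (subtopology K e) (U \<inter> e)" using U by (simp add: openin_subtopology_Int)
  then obtain V where V: "openin (subtopology K e) V" "x \<in> V" "V \<subseteq> U \<inter> e"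
    "homotopic_with (\<lambda>h. h x = x) (subtopology (subtopology K e) V) (subtopology (subtopology K e) (U \<inter> e)) id (\<lambda>_. x)"
    using c U e unfolding contracts_at_def by (metis IntI)
  have "subtopology (subtopology K e) V = subtopology K V"
    using V by (simp add: subtopology_subtopology Int_absorb1)
  moreover have "subtopology (subtopology K e) (U \<inter> e) = subtopology K (U \<inter> e)"
    by (simp add: subtopology_subtopology Int_commute Int_left_commute)
  ultimately have h: "homotopic_with (\<lambda>h. h x = x) (subtopology K V) (subtopology K (U \<inter> e)) id (\<lambda>_. x)"
    using V(4) by simp
  have "continuous_map (subtopology K (U \<inter> e)) (subtopology K U) id"
    by (auto simp: continuous_map_in_subtopology continuous_map_from_subtopology)
  from homotopic_with_compose_continuous_map_left[OF h this, of "\<lambda>h. h x = x"]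
  have "homotopic_with (\<lambda>h. h x = x) (subtopology K V) (subtopology K U) id (\<lambda>_. x)"
    by (simp add: o_def id_def)
  then show "\<exists>V. openin K V \<and> x \<in> V \<and> V \<subseteq> U \<and>
      homotopic_with (\<lambda>h. h x = x) (subtopology K V) (subtopology K U) id (\<lambda>_. x)"
    using V openin_trans_full[OF V(1) e(1)] by blast
qed

lemma contracts_at_open_subset:
  assumes e: "openin K e" "x \<in> e" and c: "contracts_at K x"
  shows "contracts_at (subtopology K e) x"
  unfolding contracts_at_def
proof (intro allI impI)
  fix U assume U: "openin (subtopology K e) U" "x \<in> U"
  then have "openin K U" "U \<subseteq> e" using e(1) by (auto simp: openin_open_subtopology)
  then obtain V where V: "openin K V" "x \<in> V" "V \<subseteq> U"
    "homotopic_with (\<lambda>h. h x = x) (subtopology K V) (subtopology K U) id (\<lambda>_. x)"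
    using c U unfolding contracts_at_def by meson
  then have "subtopology (subtopology K e) V = subtopology K V" "subtopology (subtopology K e) U = subtopology K U"
    using \<open>U \<subseteq> e\<close> by (auto simp: subtopology_subtopology Int_absorb1)
  moreover have "openin (subtopology K e) V" using V \<open>U \<subseteq> e\<close> e(1) by (auto simp: openin_open_subtopology)
  ultimately show "\<exists>V. openin (subtopology K e) V \<and> x \<in> V \<and> V \<subseteq> U \<and>
      homotopic_with (\<lambda>h. h x = x) (subtopology (subtopology K e) V) (subtopology (subtopology K e) U) id (\<lambda>_. x)"
    using V by metis
qed

lemma contracts_at_homeomorphic:
  assumes f: "homeomorphic_map X Y f" and x: "x \<in> topspace X" and c: "contracts_at X x"
  shows "contracts_at Y (f x)"
  unfolding contracts_at_def
proof (intro allI impI)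
  fix U assume U: "openin Y U" "f x \<in> U"
  obtain g where "homeomorphic_maps X Y f g" using f by (auto simp: homeomorphic_map_maps)
  then have fg: "continuous_map X Y f" "continuous_map Y X g" "\<And>x. x \<in> topspace X \<Longrightarrow> g (f x) = x"
    "\<And>y. y \<in> topspace Y \<Longrightarrow> f (g y) = y"
    by (auto simp: homeomorphic_maps_def)
  let ?U = "{z \<in> topspace X. f z \<in> U}"
  have "openin X ?U" using fg(1) U(1) by (rule openin_continuous_map_preimage)
  moreover have "x \<in> ?U" using x U by simp
  ultimately obtain V where V: "openin X V" "x \<in> V" "V \<subseteq> ?U"
    and h: "homotopic_with (\<lambda>h. h x = x) (subtopology X V) (subtopology X ?U) id (\<lambda>_. x)"
    using c unfolding contracts_at_def by blast
  let ?V = "{y \<in> topspace Y. g y \<in> V}"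
  have "continuous_map (subtopology Y ?V) (subtopology X V) g"
    using fg(2) by (auto simp: continuous_map_in_subtopology continuous_map_from_subtopology)
  from homotopic_with_compose_continuous_map_right[OF h this, of "\<lambda>h. h (f x) = x"]
  have h1: "homotopic_with (\<lambda>h. h (f x) = x) (subtopology Y ?V) (subtopology X ?U) g (\<lambda>_. x)"
    using fg(3)[OF x] by (simp add: o_def)
  have "continuous_map (subtopology X ?U) (subtopology Y U) f"
    using fg(1) by (auto simp: continuous_map_in_subtopology continuous_map_from_subtopology)
  from homotopic_with_compose_continuous_map_left[OF h1 this, of "\<lambda>h. h (f x) = f x"]
  have h2: "homotopic_with (\<lambda>h. h (f x) = f x) (subtopology Y ?V) (subtopology Y U) (f \<circ> g) (\<lambda>_. f x)"
    by (simp add: o_def)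
  have fx: "f x \<in> ?V" using x V fg(1,3) by (auto simp: continuous_map_def)
  have "homotopic_with (\<lambda>h. h (f x) = f x) (subtopology Y ?V) (subtopology Y U) id (\<lambda>_. f x)"
    using fx by (intro homotopic_with_eq[OF h2]) (auto simp: fg(4))
  moreover have "openin Y ?V" using fg(2) V(1) by (rule openin_continuous_map_preimage)
  moreover have "?V \<subseteq> U" using V(3) fg(4) by force
  ultimately show "\<exists>V. openin Y V \<and> f x \<in> V \<and> V \<subseteq> U \<and>
      homotopic_with (\<lambda>h. h (f x) = f x) (subtopology Y V) (subtopology Y U) id (\<lambda>_. f x)"
    using fx by blast
qed

text \<open>Near a point that is fixed by a deformation of a neighbourhood into \<open>A\<close>, local
  contractibility of \<open>A\<close> suffices: run the deformation first and the contraction inside \<open>A\<close> afterwards.\<close>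

lemma contracts_at_deformation:
  assumes W: "openin K W" "x \<in> W" and R: "continuous_map (prod_topology I01 (subtopology K W)) K R"
    and R0: "\<And>y. y \<in> W \<Longrightarrow> R (0, y) = y" and R1: "\<And>y. y \<in> W \<Longrightarrow> R (1, y) \<in> A"
    and Rx: "\<And>t. t \<in> {0..1} \<Longrightarrow> R (t, x) = x"
    and c: "contracts_at (subtopology K A) x"
  shows "contracts_at K x"
  unfolding contracts_at_def
proof (intro allI impI)
  fix U assume U: "openin K U" "x \<in> U"
  let ?P = "\<lambda>h. h x = x"
  have WK: "W \<subseteq> topspace K" using W(1) by (rule openin_subset)
  have xA: "x \<in> A" using R1[OF W(2)] Rx[of 1] by simp
  have "openin (subtopology K A) (U \<inter> A)" using U by (simp add: openin_subtopology_Int)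
  then obtain V' where V': "openin (subtopology K A) V'" "x \<in> V'" "V' \<subseteq> U \<inter> A"
    and h': "homotopic_with ?P (subtopology (subtopology K A) V') (subtopology (subtopology K A) (U \<inter> A)) id (\<lambda>_. x)"
    using c U xA unfolding contracts_at_def by (metis IntI)
  obtain G where G: "openin K G" "V' = G \<inter> A" using V'(1) by (auto simp: openin_subtopology)
  \<comment> \<open>The track of \<open>x\<close> under \<open>R\<close> is constant and hence in
    \<open>U\<close>; the tube lemma gives a neighbourhood \<open>V1\<close> of \<open>x\<close>
    whose points stay in \<open>U\<close> throughout.\<close>
  let ?N = "{z \<in> topspace (prod_topology I01 (subtopology K W)). R z \<in> U}"
  have "openin (prod_topology I01 (subtopology K W)) ?N"
    using R U(1) by (rule openin_continuous_map_preimage)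
  moreover have "compactin I01 {0..1}" by (simp add: compactin_subtopology)
  moreover have "x \<in> topspace (subtopology K W)" using W WK by auto
  moreover have "{0..1} \<times> {x} \<subseteq> ?N" using Rx U W WK by auto
  ultimately obtain T V1 where V1: "openin (subtopology K W) V1" "x \<in> V1" "{0..1} \<subseteq> T" "T \<times> V1 \<subseteq> ?N"
    using tube_lemma_left[of I01 "subtopology K W" ?N "{0..1}" x] by (elim meta_impE exE conjE)
  have R1c: "continuous_map (subtopology K W) K (\<lambda>y. R (1, y))"
    using continuous_map_o_Pair[OF R, of 1] by (simp add: o_def)
  \<comment> \<open>The deformation must also end in \<open>V'\<close>, where the contraction inside
    \<open>A\<close> is defined.\<close>
  let ?V = "V1 \<inter> {y \<in> topspace (subtopology K W). R (1, y) \<in> G}"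
  have "openin (subtopology K W) ?V"
    using V1(1) openin_continuous_map_preimage[OF R1c G(1)] by (rule openin_Int)
  then have oV: "openin K ?V" using W(1) by (rule openin_trans_full)
  have VW: "?V \<subseteq> W" by auto
  have RU: "R (t, y) \<in> U" if "t \<in> {0..1}" "y \<in> ?V" for t y
  proof -
    have "(t, y) \<in> T \<times> V1" using V1(3) that by auto
    then have "(t, y) \<in> ?N" using V1(4) by (rule rev_subsetD)
    then show ?thesis by simp
  qed
  have VU: "?V \<subseteq> U" using RU[of 0] R0 by fastforce
  have xV: "x \<in> ?V" using V1(2) W WK Rx[of 1] V'(2) G by auto
  have "continuous_map (prod_topology I01 (subtopology K ?V)) (subtopology K U) R"
  proof -
    have "prod_topology I01 (subtopology K ?V) = subtopology (prod_topology I01 (subtopology K W)) (topspace I01 \<times> ?V)"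
      using VW by (simp add: prod_topology_subtopology(2) subtopology_subtopology Times_Int_Times Int_absorb1)
    then show ?thesis
      using RU by (auto simp: continuous_map_in_subtopology R continuous_map_from_subtopology)
  qed
  then have h1: "homotopic_with ?P (subtopology K ?V) (subtopology K U) id (\<lambda>y. R (1, y))"
    using Rx R0 xV by (subst homotopic_with) (auto intro!: exI[of _ R])
  have "continuous_map (subtopology K ?V) (subtopology (subtopology K A) V') (\<lambda>y. R (1, y))"
  proof -
    have "continuous_map (subtopology K ?V) K (\<lambda>y. R (1, y))"
      using continuous_map_from_subtopology_mono[OF R1c VW] .
    then show ?thesis
      using R1 VW G(2) by (auto simp: continuous_map_in_subtopology)
  qed
  from homotopic_with_compose_continuous_map_right[OF h' this, of ?P]
  have h2: "homotopic_with ?P (subtopology K ?V) (subtopology (subtopology K A) (U \<inter> A)) (\<lambda>y. R (1, y)) (\<lambda>_. x)"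
    using Rx[of 1] by (simp add: o_def)
  have "continuous_map (subtopology (subtopology K A) (U \<inter> A)) (subtopology K U) id"
    by (auto simp: continuous_map_in_subtopology continuous_map_from_subtopology)
  from homotopic_with_compose_continuous_map_left[OF h2 this, of ?P]
  have "homotopic_with ?P (subtopology K ?V) (subtopology K U) (\<lambda>y. R (1, y)) (\<lambda>_. x)"
    by (simp add: o_def)
  with h1 have "homotopic_with ?P (subtopology K ?V) (subtopology K U) id (\<lambda>_. x)"
    by (rule homotopic_with_trans)
  with oV xV VU show "\<exists>V. openin K V \<and> x \<in> V \<and> V \<subseteq> U \<and>
      homotopic_with ?P (subtopology K V) (subtopology K U) id (\<lambda>_. x)"
    by blast
qed

lemma contracts_at_singleton: "contracts_at (subtopology K {x}) x"
  unfolding contracts_at_def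
proof (intro allI impI)
  fix U assume U: "openin (subtopology K {x}) U" "x \<in> U"
  then have "U \<subseteq> {x}" using openin_subset by force
  then have "homotopic_with (\<lambda>h. h x = x) (subtopology (subtopology K {x}) U) (subtopology (subtopology K {x}) U) id (\<lambda>_. x)"
    by (intro homotopic_with_equal) auto
  then show "\<exists>V. openin (subtopology K {x}) V \<and> x \<in> V \<and> V \<subseteq> U \<and>
     homotopic_with (\<lambda>h. h x = x) (subtopology (subtopology K {x}) V) (subtopology (subtopology K {x}) U) id (\<lambda>_. x)"
    using U by blast
qed

lemma continuous_map_coordinate:
  "continuous_map X (subtopology (powertop_real UNIV) S) f \<Longrightarrow> continuous_map X euclideanreal (\<lambda>x. f x i)"
  by (auto simp: continuous_map_in_subtopology continuous_map_componentwise_UNIV)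

lemma continuous_map_I01_fst: "continuous_map (prod_topology I01 X) euclideanreal fst"
  using continuous_map_fst[of I01 X] continuous_map_into_fulltopology by blast

text \<open>The straight-line homotopy deforms the whole space into \<open>{x}\<close>; the choice
  of small neighbourhoods is left to \<open>contracts_at_deformation\<close>.\<close>

lemma contracts_at_Euclidean:
  assumes "x \<in> topspace (Euclidean_space n)"
  shows "contracts_at (Euclidean_space n) x"
proof (rule contracts_at_deformation[where W = "topspace (Euclidean_space n)" and A = "{x}"])
  let ?R = "\<lambda>z::real \<times> (nat \<Rightarrow> real). \<lambda>i. (1 - fst z) * snd z i + fst z * x i"
  have c: "continuous_map (prod_topology I01 (Euclidean_space n)) euclideanreal (\<lambda>z. snd z i)" for i
  proof -
    note continuous_map_snd[of I01 "Euclidean_space n", unfolded Euclidean_space_def]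
    from continuous_map_coordinate[OF this] show ?thesis by (simp add: Euclidean_space_def)
  qed
  have "continuous_map (prod_topology I01 (Euclidean_space n)) euclideanreal (\<lambda>z. ?R z i)" for i
    by (intro continuous_intros c continuous_map_I01_fst) auto
  then show "continuous_map (prod_topology I01 (subtopology (Euclidean_space n) (topspace (Euclidean_space n))))
     (Euclidean_space n) ?R"
    using assms unfolding subtopology_topspace
    by (auto simp: Euclidean_space_def continuous_map_in_subtopology continuous_map_componentwise_UNIV)
qed (use assms in \<open>auto simp: contracts_at_singleton fun_eq_iff algebra_simps\<close>)

subsection \<open>Attaching a cell\<close>

text \<open>The topology comes from the product topology on \<open>nat \<Rightarrow> real\<close>,
  so this is Tychonoff: the disc is closed and lies in a product of intervals
  \<open>{-1..1}\<close>.\<close>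

lemma compact_space_unit_disc: "compact_space (subtopology (Euclidean_space n) (unit_disc n))"
proof -
  have "closedin (Euclidean_space n) (unit_disc n)"
  proof -
    have "continuous_map (Euclidean_space n) euclideanreal (\<lambda>x. \<Sum>i<n. (x i)\<^sup>2)"
      using continuous_map_coordinate[OF continuous_map_id] unfolding Euclidean_space_def id_def
      by (intro continuous_intros) auto
    from closedin_continuous_map_preimage[OF this, of "{..1}"]
    show ?thesis by (simp add: unit_disc_def)
  qed
  then have "closedin (powertop_real UNIV) (unit_disc n)"
    using closedin_Euclidean_space[of n] unfolding Euclidean_space_def[of n] topspace_subtopology
    by (simp add: closedin_closed_subtopology)
  moreover have "unit_disc n \<subseteq> UNIV \<rightarrow>\<^sub>E {-1..1}"
  proof (clarsimp simp: unit_disc_def topspace_Euclidean_space PiE_UNIV_domain)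
    fix x :: "nat \<Rightarrow> real" and i assume x: "\<forall>i\<ge>n. x i = 0" "(\<Sum>i<n. (x i)\<^sup>2) \<le> 1"
    have "(x i)\<^sup>2 \<le> 1"
    proof (cases "i < n")
      case True
      then have "(x i)\<^sup>2 \<le> (\<Sum>i<n. (x i)\<^sup>2)" by (intro member_le_sum) auto
      with x show ?thesis by simp
    qed (use x in auto)
    then show "-1 \<le> x i \<and> x i \<le> 1" by (simp add: abs_square_le_1 abs_le_iff)
  qed
  moreover have "compactin (powertop_real UNIV) (UNIV \<rightarrow>\<^sub>E {-1..1})"
    by (simp add: compactin_PiE)
  ultimately have "compactin (powertop_real UNIV) (unit_disc n)"
    using closed_compactin by blast
  moreover have "unit_disc n \<subseteq> {x. \<forall>i\<ge>n. x i = 0}" by (auto simp: unit_disc_def topspace_Euclidean_space)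
  ultimately show ?thesis
    unfolding Euclidean_space_def subtopology_subtopology
    by (intro compact_space_subtopology) (simp add: Int_absorb1)
qed

text \<open>Points of \<open>e\<close> have Euclidean neighbourhoods. For a point of
  \<open>A\<close>, the complement of the centre of the cell is pushed radially into
  \<open>A\<close> while \<open>A\<close> stays fixed, and \<open>contracts_at_deformation\<close>
  applies.\<close>

lemma contracts_at_attach_cell:
  assumes haus: "Hausdorff_space K" and A: "closedin K A" and top: "topspace K = A \<union> e" and disj: "A \<inter> e = {}"
    and \<Phi>: "continuous_map (subtopology (Euclidean_space n) (unit_disc n)) K \<Phi>"
    and hom: "homeomorphic_map (subtopology (Euclidean_space n) (unit_open_disc n)) (subtopology K e) \<Phi>"
    and bd: "\<Phi> ` unit_disc_boundary n \<subseteq> A"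
    and lcA: "\<And>x. x \<in> A \<Longrightarrow> contracts_at (subtopology K A) x"
    and x: "x \<in> topspace K"
  shows "contracts_at K x"
proof -
  let ?D = "subtopology (Euclidean_space n) (unit_disc n)"
  have oB: "openin (Euclidean_space n) (unit_open_disc n)"
  proof -
    have "continuous_map (Euclidean_space n) euclideanreal (\<lambda>x. \<Sum>i<n. (x i)\<^sup>2)"
      using continuous_map_coordinate[OF continuous_map_id] unfolding Euclidean_space_def id_def
      by (intro continuous_intros) auto
    from openin_continuous_map_preimage[OF this, of "{..<1}"]
    show ?thesis by (simp add: unit_open_disc_def)
  qed
  have Btop: "unit_open_disc n \<subseteq> topspace (Euclidean_space n)" by (auto simp: unit_open_disc_def)
  have Dtop: "topspace ?D = unit_disc n" by (auto simp: unit_disc_def)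
  have Dsplit: "unit_disc n = unit_open_disc n \<union> unit_disc_boundary n"
    by (auto simp: unit_disc_def unit_open_disc_def unit_disc_boundary_def)
  have esub: "e \<subseteq> topspace K" using top by auto
  have "topspace K - A = e" using top disj by auto
  then have eo: "openin K e" using A by (metis openin_diff openin_topspace)
  have \<Phi>B: "\<Phi> ` unit_open_disc n = e"
    using homeomorphic_imp_surjective_map[OF hom] Btop esub by (simp add: Int_absorb1)
  have inj: "inj_on \<Phi> (unit_open_disc n)"
    using homeomorphic_imp_injective_map[OF hom] Btop by (simp add: Int_absorb1)
  show ?thesis
  proof (cases "x \<in> e")
    case True
    then obtain z where z: "z \<in> unit_open_disc n" "x = \<Phi> z" using \<Phi>B by auto
    have "contracts_at (subtopology (Euclidean_space n) (unit_open_disc n)) z"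
      using z Btop by (intro contracts_at_open_subset[OF oB] contracts_at_Euclidean) auto
    then have "contracts_at (subtopology K e) x"
      unfolding z(2) using z Btop by (intro contracts_at_homeomorphic[OF hom]) auto
    then show ?thesis using contracts_at_open_subtopology[OF eo True] by blast
  next
    case False
    then have xA: "x \<in> A" using x top by auto
    \<comment> \<open>The centre of the cell. For \<open>n = 0\<close> the disc is this point,
      \<open>D'\<close> is empty and \<open>W\<close> is \<open>A\<close>.\<close>
    define o0 where "o0 = (\<lambda>i::nat. 0::real)"
    have o0: "o0 \<in> unit_open_disc n" by (simp add: o0_def unit_open_disc_def topspace_Euclidean_space)
    define W where "W = topspace K - {\<Phi> o0}"
    define D' where "D' = unit_disc n - {o0}"
    define nrm where "nrm z = sqrt (\<Sum>i<n. (z i)\<^sup>2)" for z :: "nat \<Rightarrow> real"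
    have nrm0: "nrm z \<noteq> 0" if "z \<in> D'" for z
    proof
      assume "nrm z = 0"
      then have "(\<Sum>i<n. (z i)\<^sup>2) = 0" by (simp add: nrm_def sum_nonneg)
      then have "z i = 0" if "i < n" for i using that by (simp add: sum_nonneg_eq_0_iff)
      moreover have "z i = 0" if "i \<ge> n" for i
        using \<open>z \<in> D'\<close> that by (auto simp: D'_def unit_disc_def topspace_Euclidean_space)
      ultimately have "z = o0" by (auto simp: o0_def fun_eq_iff not_less[symmetric])
      with that show False by (simp add: D'_def)
    qed
    have nrm_pos: "nrm z > 0" if "z \<in> D'" for z
      using nrm0[OF that] by (simp add: nrm_def less_le sum_nonneg)
    have nrm_le: "nrm z \<le> 1" if "z \<in> D'" for z
      using that by (auto simp: nrm_def D'_def unit_disc_def)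
    \<comment> \<open>Slides \<open>z\<close> along its ray to the sphere: the norm becomes
      \<open>(1 - t) * nrm z + t\<close>, and points of the sphere do not move.\<close>
    define \<rho> where "\<rho> p = (\<lambda>i. snd p i * ((1 - fst p) + fst p / nrm (snd p)))" for p :: "real \<times> (nat \<Rightarrow> real)"
    have \<rho>nrm: "nrm (\<rho> (t, z)) = (1 - t) * nrm z + t" if "t \<in> {0..1}" "z \<in> D'" for t z
    proof -
      have "nrm (\<rho> (t, z)) = sqrt ((\<Sum>i<n. (z i)\<^sup>2) * ((1 - t) + t / nrm z)\<^sup>2)"
        unfolding nrm_def[of "\<rho> (t, z)"] by (simp add: \<rho>_def power_mult_distrib sum_distrib_right)
      also have "\<dots> = nrm z * \<bar>(1 - t) + t / nrm z\<bar>"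
        by (simp add: real_sqrt_mult nrm_def)
      also have "\<dots> = nrm z * ((1 - t) + t / nrm z)"
        using that nrm_pos[OF that(2)] by simp
      also have "\<dots> = (1 - t) * nrm z + t" using nrm0[OF that(2)] by (simp add: field_simps)
      finally show ?thesis .
    qed
    have D'D: "D' \<subseteq> unit_disc n" by (auto simp: D'_def)
    have cD': "continuous_map (prod_topology I01 (subtopology ?D D')) euclideanreal (\<lambda>p. snd p i)" for i
    proof -
      have "continuous_map (prod_topology I01 (subtopology ?D D')) (subtopology ?D D') snd"
        by (rule continuous_map_snd)
      then show ?thesis
        unfolding Euclidean_space_def subtopology_subtopology by (rule continuous_map_coordinate)
    qed
    have topD': "topspace (subtopology ?D D') = D'" using Dtop D'D by auto
    have cnrm: "continuous_map (prod_topology I01 (subtopology ?D D')) euclideanreal (\<lambda>p. nrm (snd p))"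
      unfolding nrm_def by (intro continuous_intros cD') auto
    have "continuous_map (prod_topology I01 (subtopology ?D D')) euclideanreal (\<lambda>p. \<rho> p i)" for i
      unfolding \<rho>_def
      by (intro continuous_intros cD' continuous_map_I01_fst cnrm) (use nrm0 topD' in auto)
    moreover have \<rho>D: "\<rho> (t, z) \<in> unit_disc n" if "t \<in> {0..1}" "z \<in> D'" for t z
    proof -
      have "(1 - t) * nrm z + t \<le> (1 - t) * 1 + t"
        using that nrm_le[OF that(2)] by (intro add_right_mono mult_left_mono) auto
      then have "nrm (\<rho> (t, z)) \<le> 1" using \<rho>nrm[OF that] by simp
      moreover have "\<rho> (t, z) i = 0" if "i \<ge> n" for i
        using \<open>z \<in> D'\<close> that by (auto simp: D'_def unit_disc_def topspace_Euclidean_space \<rho>_def)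
      ultimately show ?thesis by (simp add: unit_disc_def topspace_Euclidean_space nrm_def)
    qed
    ultimately have \<rho>c: "continuous_map (prod_topology I01 (subtopology ?D D')) ?D \<rho>"
      using topD'
      by (auto simp: Euclidean_space_def continuous_map_in_subtopology continuous_map_componentwise_UNIV unit_disc_def
          topspace_Euclidean_space)
    have \<rho>1: "\<rho> (1, z) \<in> unit_disc_boundary n" if "z \<in> D'" for z
      using \<rho>D[of 1 z] \<rho>nrm[of 1 z] that by (simp add: unit_disc_def unit_disc_boundary_def nrm_def)
    have \<rho>b: "\<rho> (t, z) = z" if "z \<in> unit_disc_boundary n" for t z
      using that by (auto simp: \<rho>_def nrm_def unit_disc_boundary_def)
    have \<rho>0: "\<rho> (0, z) = z" for z by (simp add: \<rho>_def)
    define \<psi> where "\<psi> = inv_into (unit_open_disc n) \<Phi>"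
    \<comment> \<open>On the cell this is \<open>\<rho>\<close> in the coordinates of the disc.
      Using \<open>\<psi>\<close> only on the open cell makes it single-valued;
      \<open>R\<Phi>\<close> extends the formula to the sphere, where \<open>\<Phi>\<close> may fail
      to be injective.\<close>
    define R where "R p = (if snd p \<in> A then snd p else \<Phi> (\<rho> (fst p, \<psi> (snd p))))" for p
    have R\<Phi>: "R (t, \<Phi> z) = \<Phi> (\<rho> (t, z))" if "z \<in> unit_disc n" for t z
    proof (cases "z \<in> unit_open_disc n")
      case True
      then have "\<Phi> z \<notin> A" using \<Phi>B disj by auto
      moreover have "\<psi> (\<Phi> z) = z" using inj True by (simp add: \<psi>_def)
      ultimately show ?thesis by (simp add: R_def)
    next
      case False
      then have "z \<in> unit_disc_boundary n" using that Dsplit by auto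
      then show ?thesis using bd \<rho>b by (auto simp: R_def)
    qed
    have \<Phi>o0: "\<Phi> o0 \<in> e" using o0 \<Phi>B by auto
    have \<Phi>ne: "\<Phi> z \<noteq> \<Phi> o0" if "z \<in> D'" for z
      proof (cases "z \<in> unit_open_disc n")
        case True
        then show ?thesis using inj o0 that by (auto simp: inj_on_def D'_def)
      next
        case False
        then have "\<Phi> z \<in> A" using bd that Dsplit by (auto simp: D'_def)
        then show ?thesis using \<Phi>o0 disj by auto
      qed
    \<comment> \<open>\<open>D'\<close> is a union of fibres of \<open>\<Phi>\<close>, because the
      centre is the only point over \<open>\<Phi> o0\<close>; so \<open>\<Phi>\<close> stays proper
      after restriction.\<close>
    have pre: "{z \<in> topspace ?D. \<Phi> z \<in> \<Phi> ` D'} = D'"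
    proof (intro equalityI subsetI)
      fix z assume "z \<in> {z \<in> topspace ?D. \<Phi> z \<in> \<Phi> ` D'}"
      then obtain z' where z': "z \<in> unit_disc n" "z' \<in> D'" "\<Phi> z = \<Phi> z'" unfolding Dtop by blast
      then have "z \<noteq> o0" using \<Phi>ne[OF z'(2)] by metis
      then show "z \<in> D'" using z' by (simp add: D'_def)
    next
      fix z assume "z \<in> D'"
      then show "z \<in> {z \<in> topspace ?D. \<Phi> z \<in> \<Phi> ` D'}" unfolding Dtop using D'D by blast
    qed
    have \<Phi>neq: "\<Phi> z \<in> W" if "z \<in> D'" for z
    proof -
      have "\<Phi> z \<in> topspace K" using \<Phi> that D'D Dtop by (auto simp: continuous_map_def)
      then show ?thesis using \<Phi>ne[OF that] by (simp add: W_def)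
    qed
    have WK: "W \<subseteq> topspace K" by (auto simp: W_def)
    have Wo: "openin K W"
      unfolding W_def using haus \<Phi>o0 esub by (intro openin_diff closedin_Hausdorff_singleton) auto
    have AW: "A \<subseteq> W" using \<Phi>o0 disj top by (auto simp: W_def)
    have proper: "proper_map ?D K \<Phi>"
      using compact_space_unit_disc haus \<Phi> by (intro continuous_imp_proper_map Hausdorff_imp_kc_space)
    have WeqU: "W = A \<union> \<Phi> ` D'"
    proof -
      have "y \<in> \<Phi> ` D'" if "y \<in> e" "y \<noteq> \<Phi> o0" for y
        using that \<Phi>B Dsplit by (auto simp: D'_def)
      then have "W \<subseteq> A \<union> \<Phi> ` D'" unfolding W_def top by blast
      moreover have "\<Phi> ` D' \<subseteq> W" using \<Phi>neq by blast
      ultimately show ?thesis using AW by blast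
    qed
    have closed\<Phi>: "closedin (subtopology K W) (\<Phi> ` D')"
    proof -
      have "closedin K (\<Phi> ` unit_disc n)"
        using proper_imp_closed_map[OF proper] Dtop by (metis closed_map_def closedin_topspace)
      moreover have "\<Phi> ` unit_disc n \<inter> W = \<Phi> ` D'"
      proof (intro equalityI subsetI)
        fix y assume "y \<in> \<Phi> ` unit_disc n \<inter> W"
        then obtain z where z: "z \<in> unit_disc n" "y = \<Phi> z" "y \<noteq> \<Phi> o0" unfolding W_def by blast
        then have "z \<noteq> o0" by metis
        then show "y \<in> \<Phi> ` D'" using z by (simp add: D'_def)
      next
        fix y assume "y \<in> \<Phi> ` D'"
        then show "y \<in> \<Phi> ` unit_disc n \<inter> W" using \<Phi>neq D'D by blast
      qed
      ultimately show ?thesis by (metis closedin_subtopology)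
    qed
    \<comment> \<open>Continuity of \<open>R\<close> is to be checked on the disc. The product of
      \<open>\<Phi>\<close> with the interval is a quotient map because proper maps are closed and
      stable under products.\<close>
    have quot: "quotient_map (prod_topology I01 (subtopology ?D D')) (prod_topology I01 (subtopology K (\<Phi> ` D'))) (\<lambda>(t, z). (t, \<Phi> z))"
    proof (rule continuous_closed_imp_quotient_map)
      have p: "proper_map (subtopology ?D D') (subtopology K (\<Phi> ` D')) \<Phi>"
        using proper pre by (rule proper_map_restriction)
      have "proper_map (prod_topology I01 (subtopology ?D D')) (prod_topology I01 (subtopology K (\<Phi> ` D'))) (\<lambda>(t, z). (id t, \<Phi> z))"
        unfolding proper_map_prod using p proper_map_id[of I01] by blast
      then show "closed_map (prod_topology I01 (subtopology ?D D')) (prod_topology I01 (subtopology K (\<Phi> ` D'))) (\<lambda>(t, z). (t, \<Phi> z))"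
        by (simp add: proper_imp_closed_map)
      have "continuous_map (subtopology ?D D') (subtopology K (\<Phi> ` D')) \<Phi>"
        using \<Phi> by (auto simp: continuous_map_in_subtopology continuous_map_from_subtopology)
      then show "continuous_map (prod_topology I01 (subtopology ?D D')) (prod_topology I01 (subtopology K (\<Phi> ` D'))) (\<lambda>(t, z). (t, \<Phi> z))"
        unfolding case_prod_unfold
        by (intro continuous_map_pairedI continuous_map_fst continuous_map_compose[OF continuous_map_snd, unfolded o_def])
      show "(\<lambda>(t, z). (t, \<Phi> z)) ` topspace (prod_topology I01 (subtopology ?D D')) = topspace (prod_topology I01 (subtopology K (\<Phi> ` D')))"
        using topD' \<Phi>neq WK by (auto simp: topspace_subtopology)
    qed
    have "continuous_map (prod_topology I01 (subtopology ?D D')) K (R \<circ> (\<lambda>(t, z). (t, \<Phi> z)))"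
    proof (rule continuous_map_eq[OF continuous_map_compose[OF \<rho>c \<Phi>]])
      fix p assume "p \<in> topspace (prod_topology I01 (subtopology ?D D'))"
      then show "(\<Phi> \<circ> \<rho>) p = (R \<circ> (\<lambda>(t, z). (t, \<Phi> z))) p"
        using R\<Phi> D'D topD' by auto
    qed
    from continuous_compose_quotient_map[OF quot this]
    have cR2: "continuous_map (prod_topology I01 (subtopology K (\<Phi> ` D'))) K R" .
    have cR1: "continuous_map (prod_topology I01 (subtopology K A)) K R"
    proof (rule continuous_map_eq)
      show "continuous_map (prod_topology I01 (subtopology K A)) K snd"
        by (meson continuous_map_snd continuous_map_into_fulltopology)
    qed (auto simp: R_def)
    have cR: "continuous_map (prod_topology I01 (subtopology K W)) K R"
    proof (rule pasting_lemma_closed[where I = "{True, False}" and T = "\<lambda>b. {0..1} \<times> (if b then A else \<Phi> ` D')" and f = "\<lambda>_. R"])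
      show "closedin (prod_topology I01 (subtopology K W)) ({0..1} \<times> (if b then A else \<Phi> ` D'))" for b
        using closed\<Phi> closedin_subset_topspace[OF A AW] closedin_topspace[of I01]
        by (auto simp: closedin_prod_Times_iff)
      have "subtopology (prod_topology I01 (subtopology K W)) ({0..1} \<times> S) = prod_topology I01 (subtopology K S)" if "S \<subseteq> W" for S
        using that by (simp add: prod_topology_subtopology(2) subtopology_subtopology Times_Int_Times Int_absorb1)
      then show "continuous_map (subtopology (prod_topology I01 (subtopology K W)) ({0..1} \<times> (if b then A else \<Phi> ` D'))) K R" for b
        using cR1 cR2 WeqU by auto
    qed (use WeqU in auto)
    show ?thesis
    proof (rule contracts_at_deformation[OF Wo _ cR])
      show "x \<in> W" using xA AW by auto
      show "R (0, y) = y" if yW: "y \<in> W" for y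
      proof (cases "y \<in> A")
        case False
        then obtain z where "z \<in> D'" "y = \<Phi> z" using yW WeqU by auto
        then show ?thesis using R\<Phi>[of z 0] \<rho>0 D'D by auto
      qed (simp add: R_def)
      show "R (1, y) \<in> A" if yW: "y \<in> W" for y
      proof (cases "y \<in> A")
        case False
        then obtain z where "z \<in> D'" "y = \<Phi> z" using yW WeqU by auto
        then have "R (1, y) = \<Phi> (\<rho> (1, z))" using R\<Phi>[of z 1] D'D by auto
        moreover have "\<rho> (1, z) \<in> unit_disc_boundary n" using \<open>z \<in> D'\<close> by (rule \<rho>1)
        ultimately show ?thesis using bd by auto
      qed (simp add: R_def)
      show "R (t, x) = x" for t using xA by (simp add: R_def)
      show "contracts_at (subtopology K A) x" using lcA xA by blast
    qed
  qed
qed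

subsection \<open>Finite CW-complexes\<close>

text \<open>Induction on the number of cells, removing one of maximal dimension: boundaries meet
  only cells of smaller dimension, so the remaining family has the same properties, and the removed
  cell is attached to a compact, hence closed, set.\<close>

lemma cell_union:
  assumes haus: "Hausdorff_space K" and fin: "finite F" and disj: "disjoint F" and sub: "\<Union>F \<subseteq> topspace K"
    and cells: "\<And>e. e \<in> F \<Longrightarrow>
        continuous_map (subtopology (Euclidean_space (dm e)) (unit_disc (dm e))) K (\<Phi> e) \<and>
        homeomorphic_map (subtopology (Euclidean_space (dm e)) (unit_open_disc (dm e))) (subtopology K e) (\<Phi> e) \<and>
        \<Phi> e ` unit_disc_boundary (dm e) \<subseteq> \<Union>{e'\<in>F. dm e' < dm e}"
  shows "compactin K (\<Union>F)" "\<And>x. x \<in> \<Union>F \<Longrightarrow> contracts_at (subtopology K (\<Union>F)) x"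
proof -
  have disc: "unit_disc n = unit_open_disc n \<union> unit_disc_boundary n" for n
    by (auto simp: unit_disc_def unit_open_disc_def unit_disc_boundary_def)
  have Btop: "unit_open_disc n \<subseteq> topspace (Euclidean_space n)" for n by (auto simp: unit_open_disc_def)
  have Dtop: "topspace (subtopology (Euclidean_space n) (unit_disc n)) = unit_disc n" for n by (auto simp: unit_disc_def)
  have open_cell: "\<Phi> e ` unit_open_disc (dm e) = e"
    if hm: "homeomorphic_map (subtopology (Euclidean_space (dm e)) (unit_open_disc (dm e))) (subtopology K e) (\<Phi> e)"
      and e: "e \<subseteq> topspace K" for e
    using homeomorphic_imp_surjective_map[OF hm] Btop e by (simp add: Int_absorb1)
  \<comment> \<open>Stated for an arbitrary family, because the induction also uses it for the
    family without the removed cell.\<close>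
  have comp: "compactin K (\<Union>F)"
    if fin: "finite F" and sub: "\<Union>F \<subseteq> topspace K"
    and cells: "\<And>e. e \<in> F \<Longrightarrow>
        continuous_map (subtopology (Euclidean_space (dm e)) (unit_disc (dm e))) K (\<Phi> e) \<and>
        homeomorphic_map (subtopology (Euclidean_space (dm e)) (unit_open_disc (dm e))) (subtopology K e) (\<Phi> e) \<and>
        \<Phi> e ` unit_disc_boundary (dm e) \<subseteq> \<Union>{e'\<in>F. dm e' < dm e}" for F
  proof -
    have de: "\<Phi> e ` unit_disc (dm e) \<subseteq> \<Union>F \<and> e \<subseteq> \<Phi> e ` unit_disc (dm e)" if e: "e \<in> F" for e
    proof -
      have "e \<subseteq> topspace K" using sub e by auto
      then have "\<Phi> e ` unit_open_disc (dm e) = e" using open_cell cells[OF e] by simp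
      moreover have "\<Phi> e ` unit_disc_boundary (dm e) \<subseteq> \<Union>F"
      proof -
        have "\<Union>{e'\<in>F. dm e' < dm e} \<subseteq> \<Union>F" by auto
        with cells[OF e] show ?thesis by (metis order_trans)
      qed
      ultimately show ?thesis using e unfolding disc image_Un by auto
    qed
    have "\<Union>F = (\<Union>e\<in>F. \<Phi> e ` unit_disc (dm e))"
    proof (rule equalityI)
      show "\<Union>F \<subseteq> (\<Union>e\<in>F. \<Phi> e ` unit_disc (dm e))"
        using de by (intro Union_least) (metis UN_upper order_trans)
      show "(\<Union>e\<in>F. \<Phi> e ` unit_disc (dm e)) \<subseteq> \<Union>F"
        using de by (intro UN_least) metis
    qed
    moreover have "compactin K (\<Phi> e ` unit_disc (dm e))" if "e \<in> F" for e
      using image_compactin[OF compact_space_unit_disc[of "dm e", unfolded compact_space_def Dtop]] cells[OF that] by blast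
    ultimately show ?thesis using fin by (auto intro!: compactin_Union)
  qed
  show "compactin K (\<Union>F)" using comp[OF fin sub cells] .
  show "contracts_at (subtopology K (\<Union>F)) x" if "x \<in> \<Union>F" for x
    using fin disj sub cells that
  proof (induction "card F" arbitrary: F x)
    case 0
    then show ?case by simp
  next
    case (Suc m)
    then obtain e where e: "e \<in> F" "dm e = Max (dm ` F)"
      by (metis Sup_empty card.empty empty_iff obtains_MAX)
    have emax: "dm e' \<le> dm e" if "e' \<in> F" for e' using e(2) Suc.prems(1) that by simp
    let ?F = "F - {e}"
    have F: "F = insert e ?F" using e by auto
    have cells': "continuous_map (subtopology (Euclidean_space (dm e')) (unit_disc (dm e'))) K (\<Phi> e') \<and>
        homeomorphic_map (subtopology (Euclidean_space (dm e')) (unit_open_disc (dm e'))) (subtopology K e') (\<Phi> e') \<and>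
        \<Phi> e' ` unit_disc_boundary (dm e') \<subseteq> \<Union>{e''\<in>?F. dm e'' < dm e'}" if "e' \<in> ?F" for e'
    proof -
      have "{e''\<in>?F. dm e'' < dm e'} = {e''\<in>F. dm e'' < dm e'}" using emax that by force
      then show ?thesis using Suc.prems(4)[of e'] that by simp
    qed
    have F': "finite ?F" "disjoint ?F" "\<Union>?F \<subseteq> topspace K" "m = card ?F"
      using Suc.prems(1-3) Suc.hyps(2) e(1) by (auto simp: pairwise_def disjoint_def)
    have IH: "contracts_at (subtopology K (\<Union>?F)) y" if "y \<in> \<Union>?F" for y
      using Suc.hyps(1)[OF F'(4,1,2,3) cells' that] .
    have clo: "closedin K (\<Union>?F)"
      using compactin_imp_closedin[OF haus comp[OF F'(1,3) cells']] .
    have esub: "e \<subseteq> \<Union>F" "e \<subseteq> topspace K" using e Suc.prems(3) by auto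
    note ce = Suc.prems(4)[OF e(1)]
    have "\<Union>{e'\<in>F. dm e' < dm e} \<subseteq> \<Union>?F" by auto
    then have bd: "\<Phi> e ` unit_disc_boundary (dm e) \<subseteq> \<Union>?F" using ce by (metis order_trans)
    show ?case
    proof (rule contracts_at_attach_cell[where A = "\<Union>?F" and e = e and \<Phi> = "\<Phi> e" and n = "dm e"])
      show "Hausdorff_space (subtopology K (\<Union>F))" using haus by (rule Hausdorff_space_subtopology)
      show "closedin (subtopology K (\<Union>F)) (\<Union>?F)" using clo by (rule closedin_subset_topspace) auto
      show "topspace (subtopology K (\<Union>F)) = \<Union>?F \<union> e" using Suc.prems(3) e by auto
      have "e' \<inter> e = {}" if "e' \<in> ?F" for e'
        using Suc.prems(2) e(1) that unfolding pairwise_def disjnt_def by blast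
      then show "\<Union>?F \<inter> e = {}" by blast
      show "continuous_map (subtopology (Euclidean_space (dm e)) (unit_disc (dm e))) (subtopology K (\<Union>F)) (\<Phi> e)"
      proof -
        have "\<Phi> e ` unit_open_disc (dm e) = e" using ce open_cell[OF _ esub(2)] by simp
        then have "\<Phi> e ` unit_disc (dm e) \<subseteq> \<Union>F" using bd esub(1) unfolding disc image_Un by auto
        then show ?thesis using ce unfolding continuous_map_in_subtopology Dtop by (simp add: image_subset_iff_funcset)
      qed
      have "subtopology (subtopology K (\<Union>F)) e = subtopology K e"
        using esub(1) by (simp add: subtopology_subtopology Int_absorb1)
      then show "homeomorphic_map (subtopology (Euclidean_space (dm e)) (unit_open_disc (dm e)))
          (subtopology (subtopology K (\<Union>F)) e) (\<Phi> e)" using ce by simp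
      show "\<Phi> e ` unit_disc_boundary (dm e) \<subseteq> \<Union>?F" by (rule bd)
      have "subtopology (subtopology K (\<Union>F)) (\<Union>?F) = subtopology K (\<Union>?F)"
        by (simp add: subtopology_subtopology Int_absorb1 Union_mono)
      then show "contracts_at (subtopology (subtopology K (\<Union>F)) (\<Union>?F)) y" if "y \<in> \<Union>?F" for y
        using IH[OF that] by simp
      show "x \<in> topspace (subtopology K (\<Union>F))" using Suc.prems(3,5) by auto
    qed
  qed
qed

theorem finite_CW_complex_properties:
  assumes "finite_CW_complex K"
  shows "compact_space K" "\<And>x. x \<in> topspace K \<Longrightarrow> contracts_at K x"
proof -
  obtain \<E> dm \<Phi> where fin: "finite \<E>" and CW: "CW_structure K \<E> dm \<Phi>"
    using assms by (auto simp: finite_CW_complex_def)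
  then have top: "\<Union>\<E> = topspace K" by (simp add: CW_structure_def)
  have haus: "Hausdorff_space K" and disj: "disjoint \<E>" and sub: "\<Union>\<E> \<subseteq> topspace K"
    using CW unfolding CW_structure_def by simp_all
  have cells: "continuous_map (subtopology (Euclidean_space (dm e)) (unit_disc (dm e))) K (\<Phi> e) \<and>
        homeomorphic_map (subtopology (Euclidean_space (dm e)) (unit_open_disc (dm e))) (subtopology K e) (\<Phi> e) \<and>
        \<Phi> e ` unit_disc_boundary (dm e) \<subseteq> \<Union>{e'\<in>\<E>. dm e' < dm e}" if "e \<in> \<E>" for e
    using CW that unfolding CW_structure_def by simp
  have comp: "compactin K (\<Union>\<E>)" by (rule cell_union(1)[OF haus fin disj sub cells])
  note lc = cell_union(2)[OF haus fin disj sub cells]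
  from comp show "compact_space K" by (simp add: top compact_space_def)
  show "contracts_at K x" if "x \<in> topspace K" for x
    using lc[of x] that by (simp add: top)
qed

subsection \<open>Copies of a space identified in finitely many points\<close>

text \<open>The sheets are indexed by a compact set \<open>E\<close> of reals; \<open>q (s, y)\<close> is the point \<open>y\<close> of the
  sheet \<open>s\<close>. A convergent space arises from \<open>E = {0} \<union> {1 / (n + 1) | n}\<close>, its finite unions
  of sheets from finite subsets of this set.\<close>

locale sheeted_space =
  fixes X Y :: "'a topology" and E :: "real set" and q :: "real \<times> 'a \<Rightarrow> 'a" and P :: "'a set"
  assumes hausX: "Hausdorff_space X" and hausY: "Hausdorff_space Y" and compY: "compact_space Y" and compE: "compact E"
    and q_cont: "continuous_map (prod_topology (top_of_set E) Y) X q"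
    and q_surj: "q ` (E \<times> topspace Y) = topspace X"
    and q_eqD: "\<And>s y s' y'. s \<in> E \<Longrightarrow> s' \<in> E \<Longrightarrow> y \<in> topspace Y \<Longrightarrow> y' \<in> topspace Y \<Longrightarrow>
        q (s, y) = q (s', y') \<Longrightarrow> y = y' \<and> (s = s' \<or> y \<in> P)"
    and q_P: "\<And>s y. s \<in> E \<Longrightarrow> y \<in> P \<Longrightarrow> q (s, y) = y"
    and P_sub: "P \<subseteq> topspace Y" and P_fin: "finite P"
    and zero_E: "0 \<in> E" and q_zero: "\<And>y. y \<in> topspace Y \<Longrightarrow> q (0, y) = y"
    and isolated: "\<And>s. s \<in> E \<Longrightarrow> s \<noteq> 0 \<Longrightarrow> openin (top_of_set E) {s}"
    and contracts: "\<And>y. y \<in> topspace Y \<Longrightarrow> contracts_at Y y"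
begin

abbreviation EY :: "(real \<times> 'a) topology" where
  "EY \<equiv> prod_topology (top_of_set E) Y"

section \<open>The sheeted space as a quotient\<close>

lemma compact_EY: "compact_space EY"
  using compE compY by (simp add: compact_space_prod_topology compact_space_subtopology)

lemma q_proper: "proper_map EY X q"
  using compact_EY hausX q_cont by (intro continuous_imp_proper_map Hausdorff_imp_kc_space)

lemma q_quotient: "quotient_map EY X q"
  using q_cont proper_imp_closed_map[OF q_proper] q_surj by (intro continuous_closed_imp_quotient_map) auto

lemma q_cases:
  assumes "x \<in> topspace X"
  obtains s y where "s \<in> E" "y \<in> topspace Y" "x = q (s, y)"
proof -
  have "x \<in> q ` (E \<times> topspace Y)" using assms q_surj by simp
  then show thesis by (elim imageE SigmaE) (auto intro: that)
qed

lemma compact_X: "compact_space X"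
proof -
  have "compactin X (q ` topspace EY)"
    using compact_EY q_cont unfolding compact_space_def by (rule image_compactin)
  then show ?thesis using q_surj by (simp add: compact_space_def)
qed

text \<open>Makes \<open>S \<times> V\<close> a union of fibres of \<open>q\<close>: identifications
  happen only over \<open>P\<close>, and there between all sheets at once, so either every sheet is
  taken or \<open>P\<close> is avoided.\<close>

definition sat :: "real set \<Rightarrow> 'a set \<Rightarrow> bool" where
  "sat S V \<longleftrightarrow> S \<subseteq> E \<and> V \<subseteq> topspace Y \<and> (S = E \<or> V \<inter> P = {})"

lemma sat_preimage:
  assumes "sat S V"
  shows "{z \<in> topspace EY. q z \<in> q ` (S \<times> V)} = S \<times> V"
proof (intro equalityI subsetI)
  fix z assume "z \<in> {z \<in> topspace EY. q z \<in> q ` (S \<times> V)}"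
  then obtain s y s' y' where *: "z = (s, y)" "s \<in> E" "y \<in> topspace Y" "s' \<in> S" "y' \<in> V" "q (s, y) = q (s', y')"
    by auto
  then have "y = y' \<and> (s = s' \<or> y \<in> P)" using assms by (intro q_eqD) (auto simp: sat_def)
  with * assms show "z \<in> S \<times> V" by (auto simp: sat_def)
qed (use assms in \<open>auto simp: sat_def\<close>)

lemma openin_sheets:
  assumes "sat S V" "openin (top_of_set E) S" "openin Y V"
  shows "openin X (q ` (S \<times> V))"
proof -
  have "openin EY (S \<times> V)" using assms by (simp add: openin_prod_Times_iff)
  moreover have sub: "q ` (S \<times> V) \<subseteq> topspace X" using assms(1) q_surj by (auto simp: sat_def)
  note conjunct2[OF q_quotient[unfolded quotient_map_def], rule_format, OF sub]
  ultimately show ?thesis unfolding sat_preimage[OF assms(1)] by simp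
qed

definition fold :: "'a \<Rightarrow> 'a" where
  "fold x = (SOME y. y \<in> topspace Y \<and> (\<exists>s\<in>E. x = q (s, y)))"

text \<open>Over a point of \<open>P\<close> every index of \<open>E\<close> qualifies and the
  choice is arbitrary; the uses below are arranged so that it does not matter.\<close>

definition sheet :: "'a \<Rightarrow> real" where
  "sheet x = (SOME s. s \<in> E \<and> x = q (s, fold x))"

lemma fold_q: "s \<in> E \<Longrightarrow> y \<in> topspace Y \<Longrightarrow> fold (q (s, y)) = y"
  unfolding fold_def using q_eqD by (intro some_equality) metis+

lemma sheet_q:
  assumes "s \<in> E" "y \<in> topspace Y"
  shows "sheet (q (s, y)) \<in> E" "q (sheet (q (s, y)), y) = q (s, y)" "y \<notin> P \<Longrightarrow> sheet (q (s, y)) = s"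
proof -
  have "\<exists>s'. s' \<in> E \<and> q (s, y) = q (s', fold (q (s, y)))"
    using assms fold_q by (intro exI[of _ s]) simp
  from someI_ex[OF this] show 1: "sheet (q (s, y)) \<in> E" "q (sheet (q (s, y)), y) = q (s, y)"
    unfolding sheet_def fold_q[OF assms] by auto
  show "sheet (q (s, y)) = s" if "y \<notin> P"
    using q_eqD[OF 1(1) assms(1) assms(2) assms(2) 1(2)] that by simp
qed

text \<open>\<open>q\<close> is proper, and its product with the identity of the interval is again
  proper, hence closed.\<close>

lemma q_quotient_homotopy:
  assumes sat: "sat S V"
  shows "quotient_map (prod_topology I01 (subtopology EY (S \<times> V)))
      (prod_topology I01 (subtopology X (q ` (S \<times> V)))) (\<lambda>(t, z). (t, q z))"
proof (rule continuous_closed_imp_quotient_map)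
  have p: "proper_map (subtopology EY (S \<times> V)) (subtopology X (q ` (S \<times> V))) q"
    using q_proper sat_preimage[OF sat] by (rule proper_map_restriction)
  have "proper_map (prod_topology I01 (subtopology EY (S \<times> V)))
      (prod_topology I01 (subtopology X (q ` (S \<times> V)))) (\<lambda>(t, z). (id t, q z))"
    unfolding proper_map_prod using p proper_map_id[of I01] by blast
  then show "closed_map (prod_topology I01 (subtopology EY (S \<times> V)))
      (prod_topology I01 (subtopology X (q ` (S \<times> V)))) (\<lambda>(t, z). (t, q z))"
    by (simp add: proper_imp_closed_map)
  have "continuous_map (subtopology EY (S \<times> V)) (subtopology X (q ` (S \<times> V))) q"
    using q_cont by (auto simp: continuous_map_in_subtopology continuous_map_from_subtopology)
  then show "continuous_map (prod_topology I01 (subtopology EY (S \<times> V)))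
      (prod_topology I01 (subtopology X (q ` (S \<times> V)))) (\<lambda>(t, z). (t, q z))"
    unfolding case_prod_unfold
    by (intro continuous_map_pairedI continuous_map_fst continuous_map_compose[OF continuous_map_snd, unfolded o_def])
  have "topspace (subtopology EY (S \<times> V)) = S \<times> V" using sat by (auto simp: sat_def)
  moreover have "topspace (subtopology X (q ` (S \<times> V))) = q ` (S \<times> V)"
    using sat q_surj by (auto simp: sat_def)
  ultimately show "(\<lambda>(t, z). (t, q z)) ` topspace (prod_topology I01 (subtopology EY (S \<times> V))) =
      topspace (prod_topology I01 (subtopology X (q ` (S \<times> V))))"
    by (simp only: topspace_prod_topology) force
qed

text \<open>A homotopy in \<open>Y\<close> acts on all sheets at once, provided that it fixes the identification points.\<close>

definition spread :: "(real \<times> 'a \<Rightarrow> 'a) \<Rightarrow> real \<times> 'a \<Rightarrow> 'a" where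
  "spread H p = q (sheet (snd p), H (fst p, fold (snd p)))"

text \<open>Off \<open>P\<close> the index \<open>s\<close> is recovered by \<open>sheet\<close>. On
  \<open>P\<close> it is lost, but there the homotopy stands still and all sheets agree.\<close>

lemma spread_q:
  assumes "sat S V" "s \<in> S" "y \<in> V" "t \<in> {0..1}" "\<And>t p. t \<in> {0..1} \<Longrightarrow> p \<in> V \<inter> P \<Longrightarrow> H (t, p) = p"
  shows "spread H (t, q (s, y)) = q (s, H (t, y))"
proof -
  have sy: "s \<in> E" "y \<in> topspace Y" using assms by (auto simp: sat_def)
  show ?thesis
  proof (cases "y \<in> P")
    case True
    then have "H (t, y) = y" using assms by simp
    then show ?thesis using sheet_q(2)[OF sy] by (simp add: spread_def fold_q[OF sy])
  next
    case False
    then show ?thesis using sheet_q(3)[OF sy] by (simp add: spread_def fold_q[OF sy])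
  qed
qed

text \<open>Composed with the quotient map, \<open>spread H\<close> becomes
  \<open>q (s, H (t, y))\<close>, whose continuity is clear.\<close>

lemma spread_continuous:
  assumes sat: "sat S V" and H: "continuous_map (prod_topology I01 (subtopology Y V)) Y H"
    and HP: "\<And>t p. t \<in> {0..1} \<Longrightarrow> p \<in> V \<inter> P \<Longrightarrow> H (t, p) = p"
  shows "continuous_map (prod_topology I01 (subtopology X (q ` (S \<times> V)))) X (spread H)"
proof (rule continuous_compose_quotient_map[OF q_quotient_homotopy[OF sat]])
  let ?T = "prod_topology I01 (subtopology EY (S \<times> V))"
  have c1: "continuous_map ?T (subtopology EY (S \<times> V)) snd" by (rule continuous_map_snd)
  have c1': "continuous_map ?T EY snd" using c1 by (rule continuous_map_into_fulltopology)
  have s: "continuous_map ?T (top_of_set E) (\<lambda>p. fst (snd p))"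
    using continuous_map_compose[OF c1' continuous_map_fst] by (simp add: o_def)
  have y: "continuous_map ?T Y (\<lambda>p. snd (snd p))"
    using continuous_map_compose[OF c1' continuous_map_snd] by (simp add: o_def)
  have yV: "continuous_map ?T (subtopology Y V) (\<lambda>p. snd (snd p))"
    using y by (auto simp: continuous_map_in_subtopology)
  have "continuous_map ?T (prod_topology I01 (subtopology Y V)) (\<lambda>p. (fst p, snd (snd p)))"
    using yV by (intro continuous_map_pairedI continuous_map_fst)
  from continuous_map_compose[OF this H]
  have "continuous_map ?T Y (\<lambda>p. H (fst p, snd (snd p)))" by (simp add: o_def)
  with s have "continuous_map ?T EY (\<lambda>p. (fst (snd p), H (fst p, snd (snd p))))"
    by (intro continuous_map_pairedI)
  from continuous_map_compose[OF this q_cont]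
  have c: "continuous_map ?T X (\<lambda>p. q (fst (snd p), H (fst p, snd (snd p))))" by (simp add: o_def)
  show "continuous_map ?T X (spread H \<circ> (\<lambda>(t, z). (t, q z)))"
  proof (rule continuous_map_eq[OF c])
    fix p assume "p \<in> topspace ?T"
    then obtain t s y where p: "p = (t, s, y)" "t \<in> {0..1}" "s \<in> S" "y \<in> V" by (cases p) auto
    show "q (fst (snd p), H (fst p, snd (snd p))) = (spread H \<circ> (\<lambda>(t, z). (t, q z))) p"
      using spread_q[OF sat p(3,4,2) HP] by (simp add: p(1))
  qed
qed

text \<open>If 0 is isolated too, a point off \<open>P\<close> has small neighbourhoods in a single
  sheet; at a point of \<open>P\<close> the pointed contractions of all sheets run
  simultaneously.\<close>

lemma locally_contractible_X:
  assumes discrete: "openin (top_of_set E) {0}"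
  shows "locally_contractible X"
  unfolding locally_contractible_def
proof (intro ballI allI impI)
  fix x U assume x: "x \<in> topspace X" and U: "openin X U" "x \<in> U"
  obtain s0 y0 where sy: "s0 \<in> E" "y0 \<in> topspace Y" "x = q (s0, y0)" using q_cases[OF x] by metis
  define S where "S = (if y0 \<in> P then E else {s0})"
  have S: "S \<subseteq> E" "s0 \<in> S" "compactin (top_of_set E) S" "openin (top_of_set E) S"
    using sy compE discrete isolated[of s0] by (auto simp: S_def compactin_subtopology)
  have Sx: "q (s, y0) = x" if "s \<in> S" for s
    using that sy q_P by (auto simp: S_def split: if_splits)
  let ?N = "{z \<in> topspace EY. q z \<in> U}"
  have N: "openin EY ?N" using q_cont U(1) by (rule openin_continuous_map_preimage)
  have SN: "S \<times> {y0} \<subseteq> ?N" using S(1) sy(2) Sx U(2) by auto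
  \<comment> \<open>\<open>S\<close> is compact, so by the tube lemma one \<open>O1\<close> serves
    all its sheets.\<close>
  obtain T O1 where O1: "openin Y O1" "y0 \<in> O1" "S \<subseteq> T" "T \<times> O1 \<subseteq> ?N"
    using tube_lemma_left[OF N S(3) sy(2) SN] by (elim exE conjE)
  \<comment> \<open>Without the other points of \<open>P\<close>, the only identification point that
    \<open>V\<close> can contain is \<open>y0\<close>, which the contraction fixes.\<close>
  define O2 where "O2 = O1 - (P - {y0})"
  have "closedin Y (P - {y0})"
    using hausY P_fin P_sub by (intro closedin_Hausdorff_finite) auto
  then have O2: "openin Y O2" "y0 \<in> O2" using O1 by (auto simp: O2_def intro: openin_diff)
  then obtain V where V: "openin Y V" "y0 \<in> V" "V \<subseteq> O2"
    and h: "homotopic_with (\<lambda>h. h y0 = y0) (subtopology Y V) (subtopology Y O2) id (\<lambda>_. y0)"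
    using contracts[OF sy(2)] unfolding contracts_at_def by blast
  obtain H where H: "continuous_map (prod_topology I01 (subtopology Y V)) (subtopology Y O2) H"
    "\<And>y. H (0, y) = y" "\<And>y. H (1, y) = y0" "\<And>t. t \<in> {0..1} \<Longrightarrow> H (t, y0) = y0"
    using h unfolding homotopic_with_def by auto
  have VY: "V \<subseteq> topspace Y" using V(1) by (rule openin_subset)
  have VP: "V \<inter> P \<subseteq> {y0}" using V(3) by (auto simp: O2_def)
  have sat: "sat S V" using S(1) VY VP by (auto simp: sat_def S_def)
  have HP: "H (t, p) = p" if "t \<in> {0..1}" "p \<in> V \<inter> P" for t p
  proof -
    have "p = y0" using VP that(2) by blast
    then show ?thesis using H(4)[OF that(1)] by simp
  qed
  have HY: "continuous_map (prod_topology I01 (subtopology Y V)) Y H"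
    using H(1) by (rule continuous_map_into_fulltopology)
  let ?W = "q ` (S \<times> V)"
  have Wt: "topspace (subtopology X ?W) = ?W" using sat q_surj by (auto simp: sat_def)
  have HU: "spread H (t, z) \<in> U" if t: "t \<in> {0..1}" and z: "z \<in> ?W" for t z
  proof -
    obtain s y where z': "s \<in> S" "y \<in> V" "z = q (s, y)" using z by auto
    have "(t, y) \<in> topspace (prod_topology I01 (subtopology Y V))" using t z'(2) VY by auto
    then have "H (t, y) \<in> O2" using H(1) by (auto simp: continuous_map_def)
    then have "(s, H (t, y)) \<in> T \<times> O1" using z'(1) O1(3) by (auto simp: O2_def)
    then have "q (s, H (t, y)) \<in> U" using O1(4) by blast
    then show ?thesis using spread_q[OF sat z'(1,2) t HP] z'(3) by simp
  qed
  have "homotopic_with (\<lambda>_. True) (subtopology X ?W) (subtopology X U) id (\<lambda>_. x)"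
  proof (subst homotopic_with, simp, intro exI[of _ "spread H"] conjI ballI)
    show "continuous_map (prod_topology I01 (subtopology X ?W)) (subtopology X U) (spread H)"
      unfolding continuous_map_in_subtopology
      using spread_continuous[OF sat HY HP] HU Wt by auto
    fix z assume "z \<in> topspace (subtopology X ?W)"
    then obtain s y where z': "s \<in> S" "y \<in> V" "z = q (s, y)" unfolding Wt by auto
    show "spread H (0, z) = id z" using spread_q[OF sat z'(1,2) _ HP, of 0] z'(3) H(2) by simp
    show "spread H (1, z) = x" using spread_q[OF sat z'(1,2) _ HP, of 1] z'(3) H(3) Sx[OF z'(1)] by simp
  qed simp
  moreover have "openin X ?W" using sat S(4) V(1) by (rule openin_sheets)
  moreover have "x \<in> ?W" using S(2) V(2) sy(3) by blast
  moreover have "?W \<subseteq> U"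
  proof
    fix z assume z: "z \<in> ?W"
    then obtain s y where z': "s \<in> S" "y \<in> V" "z = q (s, y)" by auto
    show "z \<in> U" using HU[OF _ z, of 0] spread_q[OF sat z'(1,2) _ HP, of 0] z'(3) H(2) by simp
  qed
  ultimately show "\<exists>V a. openin X V \<and> x \<in> V \<and> V \<subseteq> U \<and>
      homotopic_with (\<lambda>_. True) (subtopology X V) (subtopology X U) id (\<lambda>_. a)" by blast
qed

section \<open>A neighbourhood that deforms into the identification points\<close>

lemma disjoint_neighbourhoods:
  "\<exists>U. \<forall>p\<in>P. openin Y (U p) \<and> p \<in> U p \<and> (\<forall>p'\<in>P. p \<noteq> p' \<longrightarrow> U p \<inter> U p' = {})"
proof -
  have "\<exists>S T. openin Y S \<and> openin Y T \<and> p \<in> S \<and> p' \<in> T \<and> S \<inter> T = {}" if "p \<in> P" "p' \<in> P" "p \<noteq> p'" for p p'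
    using hausY that P_sub unfolding Hausdorff_space_def disjnt_def by blast
  then obtain S T where ST: "\<And>p p'. p \<in> P \<Longrightarrow> p' \<in> P \<Longrightarrow> p \<noteq> p' \<Longrightarrow>
      openin Y (S p p') \<and> openin Y (T p p') \<and> p \<in> S p p' \<and> p' \<in> T p p' \<and> S p p' \<inter> T p p' = {}" by metis
  \<comment> \<open>The chosen \<open>S\<close> and \<open>T\<close> are not symmetric in the pair,
    so both orders are taken into account.\<close>
  define U where "U p = (\<Inter>p'\<in>P - {p}. S p p' \<inter> T p' p) \<inter> topspace Y" for p
  have "openin Y (U p)" if "p \<in> P" for p
    unfolding U_def using P_fin ST that by (intro openin_INT openin_Int) auto
  moreover have "p \<in> U p" if "p \<in> P" for p
    using ST that P_sub by (auto simp: U_def)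
  moreover have "U p \<inter> U p' = {}" if "p \<in> P" "p' \<in> P" "p \<noteq> p'" for p p'
  proof -
    have "U p \<subseteq> S p p'" "U p' \<subseteq> T p p'" using that by (auto simp: U_def)
    then show ?thesis using ST[OF that] by blast
  qed
  ultimately show ?thesis by blast
qed

text \<open>The points of \<open>P\<close> have disjoint contracting neighbourhoods, so their
  contractions paste to one homotopy. It fixes \<open>P\<close> because the contractions are
  pointed, which is what \<open>spread\<close> requires.\<close>

lemma identification_neighbourhood:
  obtains V H where "openin Y V" "P \<subseteq> V" "continuous_map (prod_topology I01 (subtopology Y V)) Y H"
    "\<And>y. y \<in> V \<Longrightarrow> H (0, y) = y" "\<And>y. y \<in> V \<Longrightarrow> H (1, y) \<in> P"
    "\<And>t p. t \<in> {0..1} \<Longrightarrow> p \<in> P \<Longrightarrow> H (t, p) = p"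
proof -
  obtain U where U: "\<And>p. p \<in> P \<Longrightarrow> openin Y (U p) \<and> p \<in> U p \<and> (\<forall>p'\<in>P. p \<noteq> p' \<longrightarrow> U p \<inter> U p' = {})"
    using disjoint_neighbourhoods by blast
  have "\<exists>V H. openin Y V \<and> p \<in> V \<and> V \<subseteq> U p \<and> continuous_map (prod_topology I01 (subtopology Y V)) (subtopology Y (U p)) H \<and>
      (\<forall>y. H (0, y) = y) \<and> (\<forall>y. H (1, y) = p) \<and> (\<forall>t\<in>{0..1}. H (t, p) = p)" if p: "p \<in> P" for p
  proof -
    obtain V where V: "openin Y V" "p \<in> V" "V \<subseteq> U p"
      "homotopic_with (\<lambda>h. h p = p) (subtopology Y V) (subtopology Y (U p)) id (\<lambda>_. p)"
      using contracts[of p] p P_sub U[OF p] unfolding contracts_at_def by blast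
    then show ?thesis unfolding homotopic_with_def by auto
  qed
  then obtain V H where VH: "\<And>p. p \<in> P \<Longrightarrow> openin Y (V p) \<and> p \<in> V p \<and> V p \<subseteq> U p \<and>
      continuous_map (prod_topology I01 (subtopology Y (V p))) (subtopology Y (U p)) (H p) \<and>
      (\<forall>y. H p (0, y) = y) \<and> (\<forall>y. H p (1, y) = p) \<and> (\<forall>t\<in>{0..1}. H p (t, p) = p)" by metis
  define near where "near y = (THE p. p \<in> P \<and> y \<in> V p)" for y
  have near: "near y = p" if "p \<in> P" "y \<in> V p" for p y
    unfolding near_def
  proof (rule the_equality)
    fix p' assume p': "p' \<in> P \<and> y \<in> V p'"
    then have "y \<in> U p \<inter> U p'" using VH that by blast
    then show "p' = p" using U[OF that(1)] p' by (metis empty_iff)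
  qed (use that in simp)
  let ?V = "\<Union>p\<in>P. V p"
  define K where "K z = H (near (snd z)) z" for z
  show thesis
  proof (rule that[of ?V K])
    show "openin Y ?V" using VH by blast
    show "P \<subseteq> ?V" using VH by blast
    show "continuous_map (prod_topology I01 (subtopology Y ?V)) Y K"
    proof (rule pasting_lemma[where I = P and T = "\<lambda>p. {0..1} \<times> V p" and f = H])
      fix p assume p: "p \<in> P"
      have "V p \<inter> ?V = V p" using p by blast
      then have "openin (subtopology Y ?V) (V p)"
        using openin_subtopology_Int[of Y "V p" ?V] VH[OF p] by simp
      then show "openin (prod_topology I01 (subtopology Y ?V)) ({0..1} \<times> V p)"
        using openin_topspace[of I01] by (simp add: openin_prod_Times_iff)
      have "?V \<inter> V p = V p" using p by blast
      then have "subtopology (prod_topology I01 (subtopology Y ?V)) ({0..1} \<times> V p) = prod_topology I01 (subtopology Y (V p))"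
        by (simp add: prod_topology_subtopology(2) subtopology_subtopology Times_Int_Times)
      then show "continuous_map (subtopology (prod_topology I01 (subtopology Y ?V)) ({0..1} \<times> V p)) Y (H p)"
        using VH[OF p] continuous_map_into_fulltopology by metis
    next
      fix p p' z assume "p \<in> P" "p' \<in> P"
        "z \<in> topspace (prod_topology I01 (subtopology Y ?V)) \<inter> {0..1} \<times> V p \<inter> {0..1} \<times> V p'"
      then have "near (snd z) = p" "near (snd z) = p'" by (auto intro: near)
      then show "H p z = H p' z" by simp
    next
      fix z assume "z \<in> topspace (prod_topology I01 (subtopology Y ?V))"
      then obtain p where "p \<in> P" "snd z \<in> V p" "fst z \<in> {0..1}" by (cases z) auto
      then show "\<exists>p. p \<in> P \<and> z \<in> {0..1} \<times> V p \<and> K z = H p z"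
        by (intro exI[of _ p]) (auto simp: K_def near mem_Times_iff)
    qed
    show "K (0, y) = y" "K (1, y) \<in> P" if "y \<in> ?V" for y
      using that VH by (auto simp: K_def near)
    show "K (t, p) = p" if "t \<in> {0..1}" "p \<in> P" for t p
      using that VH[OF that(2)] near[of p p] by (simp add: K_def)
  qed
qed

subsection \<open>Folding all but finitely many sheets\<close>

text \<open>Unambiguous over \<open>P\<close>, although \<open>sheet\<close> is not: there
  \<open>fold x = x\<close>.\<close>

definition fold_except :: "real set \<Rightarrow> 'a \<Rightarrow> 'a" where
  "fold_except A x = (if sheet x \<in> A then x else fold x)"

lemma fold_except_q:
  assumes "s \<in> E" "y \<in> topspace Y"
  shows "fold_except A (q (s, y)) = q (if s \<in> A then s else 0, y)"
proof (cases "y \<in> P")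
  case True
  then show ?thesis using assms q_P zero_E fold_q[OF assms] by (auto simp: fold_except_def)
next
  case False
  then show ?thesis using sheet_q(3)[OF assms] fold_q[OF assms] q_zero[OF assms(2)] by (simp add: fold_except_def)
qed

text \<open>A finite set of isolated points is open and closed in \<open>E\<close>, so the map may
  be defined separately over \<open>A\<close> and \<open>E - A\<close>. The index 0 is kept out of
  \<open>A\<close> because it may be a limit of other indices.\<close>

lemma fold_except_continuous:
  assumes A: "finite A" "A \<subseteq> E - {0}"
  shows "continuous_map X (subtopology X (q ` (insert 0 A \<times> topspace Y))) (fold_except A)"
proof -
  have "continuous_map X X (fold_except A)"
  proof (rule continuous_compose_quotient_map[OF q_quotient])
    let ?T = "\<lambda>b. (if b then A else E - A) \<times> topspace Y"
    let ?f = "\<lambda>b z. if b then q z else q (0, snd z)"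
    have c0: "continuous_map EY X (\<lambda>z. q (0, snd z))"
    proof -
      have "continuous_map EY EY (\<lambda>z. (0, snd z))"
        using zero_E by (intro continuous_map_pairedI continuous_map_snd) simp
      from continuous_map_compose[OF this q_cont] show ?thesis by (simp add: o_def)
    qed
    show "continuous_map EY X (fold_except A \<circ> q)"
    proof (rule pasting_lemma[where I = "{True, False}" and T = ?T and f = ?f])
      have "A = (\<Union>s\<in>A. {s})" by simp
      moreover have "openin (top_of_set E) (\<Union>s\<in>A. {s})" using isolated A by (intro openin_Union) auto
      ultimately have "openin (top_of_set E) A" by simp
      moreover have "closedin (top_of_set E) A"
        using A by (intro closedin_Hausdorff_finite Hausdorff_space_subtopology) auto
      then have "openin (top_of_set E) (E - A)" by (metis openin_diff openin_topspace topspace_euclidean_subtopology)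
      ultimately show "openin EY (?T b)" for b by (simp add: openin_prod_Times_iff)
      show "continuous_map (subtopology EY (?T b)) X (?f b)" for b
        using q_cont c0 by (cases b) (auto intro: continuous_map_from_subtopology)
      show "?f i z = ?f j z" if "z \<in> topspace EY \<inter> ?T i \<inter> ?T j" for i j z
        using that by (auto split: if_splits)
      show "\<exists>j. j \<in> {True, False} \<and> z \<in> ?T j \<and> (fold_except A \<circ> q) z = ?f j z" if "z \<in> topspace EY" for z
        using that fold_except_q by (intro exI[of _ "fst z \<in> A"]) (cases z, auto)
    qed
  qed
  moreover have "fold_except A x \<in> q ` (insert 0 A \<times> topspace Y)" if xX: "x \<in> topspace X" for x
  proof -
    obtain s y where "s \<in> E" "y \<in> topspace Y" "x = q (s, y)" using xX by (rule q_cases)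
    then show ?thesis using fold_except_q by auto
  qed
  ultimately show ?thesis by (auto simp: continuous_map_in_subtopology)
qed

text \<open>Off \<open>P\<close> the index of the sheet is a continuous function with values in a countable set, hence
  constant on connected sets.\<close>

lemma simplex_in_sheet:
  assumes E: "countable E" and \<tau>: "singular_simplex k X \<tau>" and "\<tau> ` standard_simplex k \<inter> P = {}"
  shows "\<exists>s\<in>E. \<tau> ` standard_simplex k \<subseteq> q ` ({s} \<times> topspace Y)"
proof -
  let ?V = "topspace Y - P"
  let ?W = "q ` (E \<times> ?V)"
  have sat: "sat E ?V" by (auto simp: sat_def)
  have "openin Y ?V"
    using hausY P_fin P_sub by (intro openin_diff closedin_Hausdorff_finite) auto
  moreover have "openin (top_of_set E) E" using openin_topspace[of "top_of_set E"] by simp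
  ultimately have oW: "openin X ?W" using sat openin_sheets by blast
  have \<tau>W: "\<tau> x \<in> ?W" if xs: "x \<in> standard_simplex k" for x
  proof -
    obtain s y where sy: "s \<in> E" "y \<in> topspace Y" "\<tau> x = q (s, y)"
      using singular_simplex_in_space[OF \<tau> xs] by (rule q_cases)
    have "y \<notin> P"
    proof
      assume "y \<in> P"
      then have "\<tau> x \<in> P" using sy q_P by simp
      then show False using assms(3) xs by blast
    qed
    then show ?thesis using sy by blast
  qed
  \<comment> \<open>Off \<open>P\<close>, \<open>q\<close> restricts to a quotient map onto an open
    set, and \<open>sheet \<circ> q\<close> is the first projection; so \<open>sheet\<close> is
    continuous there.\<close>
  have "quotient_map (subtopology EY (E \<times> ?V)) (subtopology X ?W) q"
    using q_quotient sat_preimage[OF sat] oW by (intro quotient_map_restriction) auto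
  moreover have "continuous_map (subtopology EY (E \<times> ?V)) (top_of_set E) (sheet \<circ> q)"
  proof (rule continuous_map_eq)
    show "continuous_map (subtopology EY (E \<times> ?V)) (top_of_set E) fst"
      by (intro continuous_map_from_subtopology continuous_map_fst)
  qed (auto simp: sheet_q)
  ultimately have cs: "continuous_map (subtopology X ?W) (top_of_set E) sheet"
    by (rule continuous_compose_quotient_map)
  have "continuous_map (subtopology (powertop_real UNIV) (standard_simplex k)) (subtopology X ?W) \<tau>"
    using \<tau> \<tau>W by (auto simp: singular_simplex_def continuous_map_in_subtopology)
  from continuous_map_compose[OF this cs]
  have c: "continuous_map (subtopology (powertop_real UNIV) (standard_simplex k)) (top_of_set E) (sheet \<circ> \<tau>)" .
  have "connectedin (subtopology (powertop_real UNIV) (standard_simplex k)) (standard_simplex k)"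
    using connectedin_standard_simplex[of k] by (simp add: connectedin_subtopology)
  from connectedin_continuous_map_image[OF c this]
  have conn: "connected ((sheet \<circ> \<tau>) ` standard_simplex k)" and sub: "(sheet \<circ> \<tau>) ` standard_simplex k \<subseteq> E"
    by (auto simp: connectedin_subtopology)
  have const: "sheet (\<tau> x) = sheet (\<tau> y)" if "x \<in> standard_simplex k" "y \<in> standard_simplex k" for x y
  proof (rule ccontr)
    assume "sheet (\<tau> x) \<noteq> sheet (\<tau> y)"
    moreover have "sheet (\<tau> x) \<in> (sheet \<circ> \<tau>) ` standard_simplex k" "sheet (\<tau> y) \<in> (sheet \<circ> \<tau>) ` standard_simplex k"
      using that by auto
    ultimately have "uncountable ((sheet \<circ> \<tau>) ` standard_simplex k)" using conn connected_uncountable by metis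
    then show False using countable_subset[OF sub E] by simp
  qed
  let ?s = "sheet (\<tau> (vertex 0))"
  have "\<tau> x \<in> q ` ({?s} \<times> topspace Y)" if x: "x \<in> standard_simplex k" for x
  proof -
    obtain s y where sy: "s \<in> E" "y \<in> ?V" "\<tau> x = q (s, y)" using \<tau>W[OF x] by auto
    have "sheet (\<tau> x) = s" using sy sheet_q(3)[of s y] by simp
    then have "?s = s" using const[of x "vertex 0"] x by simp
    then show ?thesis using sy by blast
  qed
  moreover have "?s \<in> E" using sub by auto
  ultimately show ?thesis by blast
qed

lemma keys_real_extend: "Poly_Mapping.keys (real_extend F c) \<subseteq> (\<Union>\<sigma>\<in>Poly_Mapping.keys c. Poly_Mapping.keys (F \<sigma>))"
proof -
  have "Poly_Mapping.keys (real_smult a d) \<subseteq> Poly_Mapping.keys d" for a d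
    by (auto simp: in_keys_iff)
  then show ?thesis
    unfolding real_extend_def using Poly_Mapping.keys_sum by (fastforce dest: subsetD)
qed

text \<open>\<open>A\<close> depends on \<open>c\<close>: it collects the sheets of those pieces of
  the subdivided cycle that leave a neighbourhood of \<open>P\<close>. The cycle has finitely many
  pieces, so these sheets are finite in number.\<close>

lemma fold_except_homologous:
  assumes E: "countable E" and c: "c \<in> real_cycle_set k X"
  obtains A where "finite A" "A \<subseteq> E - {0}" "c - real_chain_map k (fold_except A) c \<in> real_boundary_set k X"
proof -
  obtain V H where V: "openin Y V" "P \<subseteq> V" and H: "continuous_map (prod_topology I01 (subtopology Y V)) Y H"
    and H0: "\<And>y. y \<in> V \<Longrightarrow> H (0, y) = y" and H1: "\<And>y. y \<in> V \<Longrightarrow> H (1, y) \<in> P"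
    and HP': "\<And>t p. t \<in> {0..1} \<Longrightarrow> p \<in> P \<Longrightarrow> H (t, p) = p"
    by (rule identification_neighbourhood) (rule that)
  have HP: "H (t, p) = p" if "t \<in> {0..1}" "p \<in> V \<inter> P" for t p using HP' that by blast
  have VY: "V \<subseteq> topspace Y" using V(1) by (rule openin_subset)
  have sat: "sat E V" using VY by (simp add: sat_def)
  let ?W = "q ` (E \<times> V)"
  have Wsub: "?W \<subseteq> topspace X" using VY q_surj by auto
  have oW: "openin X ?W"
    using sat V(1) openin_topspace[of "top_of_set E"] by (intro openin_sheets) auto
  have PX: "P \<subseteq> topspace X"
  proof
    fix p assume p: "p \<in> P"
    then have "q (0, p) \<in> topspace X" using q_surj zero_E P_sub by blast
    then show "p \<in> topspace X" using q_P[OF zero_E p] by simp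
  qed
  have PW: "P \<subseteq> ?W"
  proof
    fix p assume p: "p \<in> P"
    then have "q (0, p) \<in> ?W" using V(2) zero_E by blast
    then show "p \<in> ?W" using q_P[OF zero_E p] by simp
  qed
  \<comment> \<open>A piece subordinate to this cover lies near \<open>P\<close> or misses
    \<open>P\<close>; in the second case it lies in one sheet.\<close>
  let ?\<V> = "{?W, topspace X - P}"
  have "openin X (topspace X - P)"
    using hausX P_fin PX by (intro openin_diff closedin_Hausdorff_finite) auto
  then have \<V>: "\<And>U. U \<in> ?\<V> \<Longrightarrow> openin X U" "topspace X \<subseteq> \<Union>?\<V>" using oW PW by auto
  have cc: "c \<in> real_singular_chain_set k X" using c by (simp add: real_cycle_set_def)
  then have "compactin (simplex_topology k X) (Poly_Mapping.keys c)"
    by (intro finite_imp_compactin) (auto simp: real_singular_chain_set_def)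
  then obtain m where m: "\<And>\<sigma>. \<sigma> \<in> Poly_Mapping.keys c \<Longrightarrow> subordinate ?\<V> k m \<sigma>"
    using subordinate_compact[OF \<V>] by blast
  define c' where "c' = real_subdivision m k c"
  have c': "c' \<in> real_singular_chain_set k X" unfolding c'_def using cc by (rule real_subdivision_in)
  have c'_cycle: "c' \<in> real_cycle_set k X"
  proof -
    have "real_chain_boundary k c' = real_subdivision m (k - 1) (real_chain_boundary k c)"
      unfolding c'_def using cc by (rule real_boundary_subdivision)
    also have "\<dots> = 0" using c by (simp add: real_cycle_set_def real_subdivision_def real_extend_def)
    finally show ?thesis using c' by (simp add: real_cycle_set_def)
  qed
  let ?inW = "\<lambda>\<tau>. \<tau> ` standard_simplex k \<subseteq> ?W"
  have "\<exists>s\<in>E. \<tau> ` standard_simplex k \<subseteq> q ` ({s} \<times> topspace Y)"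
    if \<tau>: "\<tau> \<in> Poly_Mapping.keys c'" and n: "\<not> ?inW \<tau>" for \<tau>
  proof -
    obtain \<sigma> where \<sigma>: "\<sigma> \<in> Poly_Mapping.keys c" "\<tau> \<in> Poly_Mapping.keys ((singular_subdivision k ^^ m) (frag_of \<sigma>))"
      using subsetD[OF keys_real_extend \<tau>[unfolded c'_def real_subdivision_def]] by auto
    then have "\<tau> ` standard_simplex k \<subseteq> topspace X - P"
      using m[OF \<sigma>(1)] n unfolding subordinate_def by blast
    moreover have "singular_simplex k X \<tau>" using \<tau> c' by (auto simp: real_singular_chain_set_def)
    ultimately show ?thesis using E by (intro simplex_in_sheet) auto
  qed
  then obtain t where t: "\<And>\<tau>. \<tau> \<in> Poly_Mapping.keys c' \<Longrightarrow> \<not> ?inW \<tau> \<Longrightarrow>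
      t \<tau> \<in> E \<and> \<tau> ` standard_simplex k \<subseteq> q ` ({t \<tau>} \<times> topspace Y)" by metis
  define A where "A = t ` {\<tau> \<in> Poly_Mapping.keys c'. \<not> ?inW \<tau>} - {0}"
  have A: "finite A" "A \<subseteq> E - {0}" using t by (auto simp: A_def)
  let ?r = "fold_except A"
  let ?M = "q ` (insert 0 A \<times> topspace Y)"
  have r: "continuous_map X X ?r"
    using fold_except_continuous[OF A] by (rule continuous_map_into_fulltopology)
  \<comment> \<open>\<open>b\<close> consists of the pieces near \<open>P\<close>, \<open>a\<close>
    of the others, which lie in sheets kept by the fold. Neither need be a cycle, but
    \<open>a\<close> cancels from \<open>c'\<close> minus its fold, so \<open>?z\<close> below is
    one.\<close>
  define b where "b = real_extend (\<lambda>\<tau>. if ?inW \<tau> then Poly_Mapping.single \<tau> 1 else 0) c'"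
  define a where "a = real_extend (\<lambda>\<tau>. if ?inW \<tau> then 0 else Poly_Mapping.single \<tau> 1) c'"
  have ab: "c' = a + b"
  proof (rule real_chain_eqI)
    fix \<tau> :: "(nat \<Rightarrow> real) \<Rightarrow> 'a"
    let ?\<phi> = "indicat_real {\<tau>}"
    have "chain_eval ?\<phi> a = chain_eval (\<lambda>\<sigma>. if ?inW \<sigma> then 0 else ?\<phi> \<sigma>) c'"
      "chain_eval ?\<phi> b = chain_eval (\<lambda>\<sigma>. if ?inW \<sigma> then ?\<phi> \<sigma> else 0) c'"
      unfolding a_def b_def chain_eval_extend by (auto intro!: chain_eval_cong)
    then have "chain_eval ?\<phi> (a + b) = chain_eval (\<lambda>\<sigma>. (if ?inW \<sigma> then 0 else ?\<phi> \<sigma>) + (if ?inW \<sigma> then ?\<phi> \<sigma> else 0)) c'"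
      by (simp only: chain_eval_add) (simp add: chain_eval_def distrib_left sum.distrib)
    also have "\<dots> = chain_eval ?\<phi> c'" by (intro chain_eval_cong) simp
    finally show "chain_eval ?\<phi> c' = chain_eval ?\<phi> (a + b)" ..
  qed
  have sc': "singular_simplex k X \<tau>" if "\<tau> \<in> Poly_Mapping.keys c'" for \<tau>
    using that c' by (auto simp: real_singular_chain_set_def)
  have zero: "0 \<in> real_singular_chain_set k Z" for Z :: "'a topology" by (simp add: real_singular_chain_set_def)
  have b: "b \<in> real_singular_chain_set k (subtopology X ?W)"
    unfolding b_def using sc' zero
    by (intro real_chain_extend) (simp add: real_chain_single singular_simplex_subtopology)
  have "a \<in> real_singular_chain_set k (subtopology X ?M)"
    unfolding a_def
  proof (rule real_chain_extend)
    fix \<tau> assume \<tau>: "\<tau> \<in> Poly_Mapping.keys c'"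
    have "\<tau> ` standard_simplex k \<subseteq> ?M" if n: "\<not> ?inW \<tau>"
    proof -
      have "t \<tau> \<in> insert 0 A" using \<tau> n by (auto simp: A_def)
      then have "q ` ({t \<tau>} \<times> topspace Y) \<subseteq> ?M" by blast
      with t[OF \<tau> n] show ?thesis by (metis order_trans)
    qed
    then show "(if ?inW \<tau> then 0 else Poly_Mapping.single \<tau> 1) \<in> real_singular_chain_set k (subtopology X ?M)"
      using sc'[OF \<tau>] zero by (simp add: real_chain_single singular_simplex_subtopology)
  qed
  then have ra: "real_chain_map k ?r a = a"
  proof (rule real_chain_map_id)
    fix x assume "x \<in> topspace (subtopology X ?M)"
    then obtain s y where "s \<in> insert 0 A" "y \<in> topspace Y" "x = q (s, y)" by auto
    then show "?r x = x" using fold_except_q[of s y A] A(2) zero_E by auto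
  qed
  let ?z = "b - real_chain_map k ?r b"
  have z_eq: "c' - real_chain_map k ?r c' = ?z"
    using ra unfolding ab by (simp add: real_chain_map_def real_extend_add)
  have rW: "?r x \<in> ?W" if x: "x \<in> ?W" for x
  proof -
    obtain s y where "s \<in> E" "y \<in> V" "x = q (s, y)" using x by auto
    then show ?thesis using fold_except_q[of s y A] VY zero_E by auto
  qed
  then have rWc: "continuous_map (subtopology X ?W) (subtopology X ?W) ?r"
    using r by (auto simp: continuous_map_in_subtopology continuous_map_from_subtopology)
  have "real_chain_boundary k ?z = 0"
    using c'_cycle real_cycle_map[OF r c'_cycle]
    by (simp add: z_eq[symmetric] real_chain_boundary_diff real_cycle_set_def)
  then have z: "?z \<in> real_cycle_set k (subtopology X ?W)"
    using real_chain_diff[OF b real_chain_map_in[OF rWc b]] by (simp add: real_cycle_set_def)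
  define g where "g x = spread H (1, x)" for x
  \<comment> \<open>The deformation ends in \<open>P\<close>, where \<open>q\<close> forgets the
    sheet.\<close>
  have gq: "g (q (s, y)) = H (1, y)" if "s \<in> E" "y \<in> V" for s y
    using spread_q[OF sat that _ HP, of 1] q_P[OF that(1) H1[OF that(2)]] by (simp add: g_def)
  have "homotopic_with (\<lambda>_. True) (subtopology X ?W) X id g"
  proof (subst homotopic_with, simp, intro exI[of _ "spread H"] conjI ballI)
    show "continuous_map (prod_topology I01 (subtopology X ?W)) X (spread H)"
      using sat H HP by (rule spread_continuous)
    fix x assume "x \<in> topspace (subtopology X ?W)"
    then obtain s y where x: "s \<in> E" "y \<in> V" "x = q (s, y)" by auto
    show "spread H (0, x) = id x" using spread_q[OF sat x(1,2) _ HP, of 0] x(3) H0[OF x(2)] by simp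
  qed (simp_all add: g_def)
  from real_homotopy_invariance[OF this z]
  have 1: "real_chain_map k id ?z - real_chain_map k g ?z \<in> real_boundary_set k X" .
  have 2: "real_chain_map k id ?z = ?z"
    using z by (intro real_chain_map_id) (auto simp: real_cycle_set_def)
  \<comment> \<open>The fold changes only the sheet of a point, which \<open>g\<close> does not see;
    hence \<open>g\<close> sends \<open>?z\<close> to 0.\<close>
  have "real_chain_map k (g \<circ> ?r) b = real_chain_map k g b"
  proof (rule real_chain_map_cong[OF b])
    fix x assume "x \<in> topspace (subtopology X ?W)"
    then obtain s y where x: "s \<in> E" "y \<in> V" "x = q (s, y)" by auto
    have "?r x = q (if s \<in> A then s else 0, y)" using fold_except_q[of s y A] x VY by auto
    then show "(g \<circ> ?r) x = g x" using gq x zero_E by simp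
  qed
  then have 3: "real_chain_map k g ?z = 0"
    unfolding real_chain_map_def real_extend_diff unfolding real_chain_map_def[symmetric]
    by (simp add: real_chain_map_compose)
  have zb: "c' - real_chain_map k ?r c' \<in> real_boundary_set k X" using 1 2 3 z_eq by simp
  have cb: "c' - c \<in> real_boundary_set k X"
    unfolding c'_def using c by (rule real_subdivision_homologous)
  have "real_chain_map k ?r (c' - c) \<in> real_boundary_set k X" using r cb by (rule real_boundary_map)
  then have "real_chain_map k ?r c' - real_chain_map k ?r c \<in> real_boundary_set k X"
    by (simp add: real_chain_map_def real_extend_diff)
  with zb have "(c' - real_chain_map k ?r c') + (real_chain_map k ?r c' - real_chain_map k ?r c) \<in> real_boundary_set k X"
    by (rule real_boundary_add)
  from real_boundary_diff[OF this cb]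
  have "c - real_chain_map k ?r c \<in> real_boundary_set k X" by (simp add: algebra_simps)
  with A show thesis by (rule that)
qed

lemma finite_sheets:
  assumes A: "finite A" "A \<subseteq> E - {0}"
  shows "sheeted_space (subtopology X (q ` (insert 0 A \<times> topspace Y))) Y (insert 0 A) q P"
proof
  let ?S = "insert 0 A" and ?M = "q ` (insert 0 A \<times> topspace Y)"
  have S: "?S \<subseteq> E" using A zero_E by auto
  have MX: "?M \<subseteq> topspace X" using S q_surj by auto
  have eq: "prod_topology (top_of_set ?S) Y = subtopology EY (?S \<times> topspace Y)"
    using S by (simp add: prod_topology_subtopology subtopology_subtopology Times_Int_Times Int_absorb1)
  show "continuous_map (prod_topology (top_of_set ?S) Y) (subtopology X ?M) q"
    unfolding eq using q_cont by (auto simp: continuous_map_in_subtopology continuous_map_from_subtopology)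
  show "q ` (?S \<times> topspace Y) = topspace (subtopology X ?M)" using MX by auto
  show "Hausdorff_space (subtopology X ?M)" using hausX by (rule Hausdorff_space_subtopology)
  show "compact ?S" using A by (simp add: finite_imp_compact)
  show "openin (top_of_set ?S) {s}" if "s \<in> ?S" for s
  proof -
    have "closedin (top_of_set ?S) (?S - {s})"
      using A by (intro closedin_Hausdorff_finite Hausdorff_space_subtopology) auto
    then have "openin (top_of_set ?S) (?S - (?S - {s}))"
      by (metis openin_diff openin_topspace topspace_euclidean_subtopology)
    moreover have "?S - (?S - {s}) = {s}" using that by blast
    ultimately show ?thesis by simp
  qed
  show "y = y' \<and> (s = s' \<or> y \<in> P)" if "s \<in> ?S" "s' \<in> ?S" "y \<in> topspace Y" "y' \<in> topspace Y" "q (s, y) = q (s', y')"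
    for s s' y y'
    using that S by (intro q_eqD) auto
  show "q (s, y) = y" if "s \<in> ?S" "y \<in> P" for s y using that S by (intro q_P) auto
qed (use hausY compY P_sub P_fin q_zero contracts in auto)

end

text \<open>\<open>c\<close> is homologous to its fold, and the fold bounds in the finite union
  \<open>N\<close> of sheets, hence in \<open>X\<close>. \<open>N\<close> is introduced as a metric
  subspace because the filling argument measures sizes.\<close>

theorem sheeted_space_boundary:
  assumes sheeted: "sheeted_space (mtopology_of X) Y E q P" and E: "countable E"
    and c: "c \<in> real_cycle_set k (mtopology_of X)"
    and b: "iota_chain k (mtopology_of X) c \<in> measure_boundary_set k (mtopology_of X)"
  shows "c \<in> real_boundary_set k (mtopology_of X)"
proof -
  interpret sheeted_space "mtopology_of X" Y E q P by fact
  obtain A where A: "finite A" "A \<subseteq> E - {0}"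
    and h: "c - real_chain_map k (fold_except A) c \<in> real_boundary_set k (mtopology_of X)"
    by (rule fold_except_homologous[OF E c])
  define N where "N = submetric X (q ` (insert 0 A \<times> topspace Y))"
  have N: "mtopology_of N = subtopology (mtopology_of X) (q ` (insert 0 A \<times> topspace Y))"
    by (simp add: N_def mtopology_of_submetric)
  interpret N: sheeted_space "mtopology_of N" Y "insert 0 A" q P
    unfolding N by (rule finite_sheets[OF A])
  \<comment> \<open>In a finite index set 0 is isolated as well, which is what makes
    \<open>N\<close> locally contractible.\<close>
  have "closedin (top_of_set (insert 0 A)) A"
    using A by (intro closedin_Hausdorff_finite Hausdorff_space_subtopology) auto
  then have "openin (top_of_set (insert 0 A)) (insert 0 A - A)"
    by (metis openin_diff openin_topspace topspace_euclidean_subtopology)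
  moreover have "insert 0 A - A = {0}" using A by auto
  ultimately have "locally_contractible (mtopology_of N)" by (intro N.locally_contractible_X) simp
  moreover have "continuous_map (mtopology_of X) (mtopology_of N) (fold_except A)"
    unfolding N by (rule fold_except_continuous[OF A])
  ultimately have "real_chain_map k (fold_except A) c \<in> real_boundary_set k (mtopology_of N)"
    using N.compact_X c b by (intro measure_boundary_imp_boundary)
  then have "real_chain_map k (fold_except A) c \<in> real_boundary_set k (mtopology_of X)"
    unfolding N by (rule real_boundary_subtopology)
  from real_boundary_add[OF h this] show ?thesis by simp
qed

subsection \<open>Convergent spaces\<close>

lemma mtopology_of_subspace:
  assumes "mspace Y \<subseteq> mspace X" "\<And>y y'. y \<in> mspace Y \<Longrightarrow> y' \<in> mspace Y \<Longrightarrow> mdist Y y y' = mdist X y y'"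
    and "y \<in> mspace Y" "\<epsilon> > 0"
  shows "openin (mtopology_of Y) {y' \<in> mspace Y. mdist X y y' < \<epsilon>}"
proof -
  have "{y' \<in> mspace Y. mdist X y y' < \<epsilon>} = mball_of Y y \<epsilon>" using assms by auto
  then show ?thesis by (simp add: openin_mball_of)
qed

text \<open>Sheet \<open>n\<close> sits at the index \<open>1 / (n + 1)\<close> and \<open>Y\<close>
  at 0. Uniform convergence of \<open>f n y\<close> to \<open>y\<close> is what makes
  \<open>q\<close> continuous at index 0.\<close>

lemma convergent_space_sheeted:
  fixes X Y :: "'a metric"
  assumes conv: "convergent_space Y X" and comp: "compact_space (mtopology_of Y)"
    and contracts: "\<And>y. y \<in> mspace Y \<Longrightarrow> contracts_at (mtopology_of Y) y"
  shows "\<exists>E q P. countable E \<and> sheeted_space (mtopology_of X) (mtopology_of Y) E q P"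
proof -
  have YX: "mspace Y \<subseteq> mspace X" and dist: "\<And>y y'. y \<in> mspace Y \<Longrightarrow> y' \<in> mspace Y \<Longrightarrow> mdist Y y y' = mdist X y y'"
    using conv unfolding convergent_space_def by blast+
  obtain Z :: "nat \<Rightarrow> 'a set" and f :: "nat \<Rightarrow> 'a \<Rightarrow> 'a" where Z: "mspace X = mspace Y \<union> (\<Union>n. Z n)"
    and f': "\<forall>n. homeomorphic_map (mtopology_of Y) (subtopology (mtopology_of X) (Z n)) (f n)"
    and P: "let P = {y \<in> mspace Y. \<forall>n. f n y = y} in finite P \<and>
           (\<forall>y \<in> mspace Y - P. \<forall>y' \<in> mspace Y - P. (\<forall>n. f n y \<noteq> y') \<and> (\<forall>n m. n \<noteq> m \<longrightarrow> f n y \<noteq> f m y'))"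
    and lim: "uniform_limit (mspace Y) (\<lambda>n y. mdist X (f n y) y) (\<lambda>_. 0) sequentially"
    using conv unfolding convergent_space_def by (elim conjE exE)
  note f = f'[rule_format]
  interpret X: Metric_space "mspace X" "mdist X" by simp
  interpret Y: Metric_space "mspace Y" "mdist Y" by simp
  define P where "P = {y \<in> mspace Y. \<forall>n. f n y = y}"
  have P_fin: "finite P"
    and distinct: "\<And>y y' n. y \<in> mspace Y - P \<Longrightarrow> y' \<in> mspace Y - P \<Longrightarrow> f n y \<noteq> y'"
      "\<And>y y' n m. y \<in> mspace Y - P \<Longrightarrow> y' \<in> mspace Y - P \<Longrightarrow> n \<noteq> m \<Longrightarrow> f n y \<noteq> f m y'"
    using P unfolding Let_def P_def[symmetric] by auto
  have fc: "continuous_map (mtopology_of Y) (mtopology_of X) (f n)" for n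
    using homeomorphic_imp_continuous_map[OF f] by (rule continuous_map_into_fulltopology)
  have fX: "f n y \<in> mspace X" if "y \<in> mspace Y" for n y
    using fc[of n] that by (auto simp: continuous_map_def)
  have f_surj: "f n ` mspace Y = Z n" for n
    using homeomorphic_imp_surjective_map[OF f[of n]] Z by auto
  have f_inj: "y = y'" if "f n y = f n y'" "y \<in> mspace Y" "y' \<in> mspace Y" for n y y'
    using homeomorphic_imp_injective_map[OF f[of n]] that by (auto simp: inj_on_def)
  have fP: "f n p = p" if "p \<in> P" for n p using that by (simp add: P_def)
  have P_sub: "P \<subseteq> mspace Y" by (auto simp: P_def)
  define a where "a n = 1 / real (Suc n)" for n
  define E where "E = insert 0 (range a)"
  have a_pos: "a n > 0" for n by (simp add: a_def)
  have a_less: "a m < a n \<longleftrightarrow> n < m" for m n by (simp add: a_def field_simps)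
  have a_inj: "inj a" by (auto simp: inj_def a_def field_simps)
  have a_lim: "a \<longlonglongrightarrow> 0"
    using LIMSEQ_inverse_real_of_nat by (simp add: a_def[abs_def] inverse_eq_divide)
  define q where "q z = (if fst z = 0 then snd z else f (inv_into UNIV a (fst z)) (snd z))" for z :: "real \<times> 'a"
  have qa: "q (a n, y) = f n y" for n y using a_pos[of n] inv_into_f_f[OF a_inj UNIV_I, of n] by (simp add: q_def)
  have q0: "q (0, y) = y" for y by (simp add: q_def)
  have qP: "q (s, y) = y" if "s \<in> E" "y \<in> P" for s y
    using that qa q0 fP by (auto simp: E_def)
  have isolated: "openin (top_of_set E) {a n}" for n
  proof -
    \<comment> \<open>Above \<open>a (Suc n)\<close> only \<open>a 0\<close> to \<open>a n\<close>
      remain; removing the finitely many earlier ones isolates \<open>a n\<close>.\<close>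
    have "{a n} = E \<inter> ({a (Suc n)<..} - a ` {..<n})"
    proof (intro equalityI subsetI)
      fix s assume "s \<in> E \<inter> ({a (Suc n)<..} - a ` {..<n})"
      then obtain m where m: "s = a m" "a (Suc n) < a m" "m \<notin> {..<n}"
        using a_pos[of "Suc n"] by (auto simp: E_def)
      then have "m = n" using a_less[of "Suc n" m] by simp
      with m show "s \<in> {a n}" by simp
    next
      fix s assume "s \<in> {a n}"
      then show "s \<in> E \<inter> ({a (Suc n)<..} - a ` {..<n})"
        using a_less a_inj by (auto simp: E_def inj_eq)
    qed
    moreover have "open ({a (Suc n)<..} - a ` {..<n})"
      by (intro open_Diff open_greaterThan finite_imp_closed) simp
    ultimately show ?thesis using openin_open by blast
  qed
  have compE: "compact E"
    unfolding E_def using a_lim by (rule compact_sequence_with_limit)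
  have q_cont: "continuous_map (prod_topology (top_of_set E) (mtopology_of Y)) (mtopology_of X) q"
    unfolding continuous_map_def
  proof (intro conjI allI impI)
    let ?T = "prod_topology (top_of_set E) (mtopology_of Y)"
    show "q \<in> topspace ?T \<rightarrow> topspace (mtopology_of X)"
    proof
      fix z assume "z \<in> topspace ?T"
      then have "fst z = 0 \<or> (\<exists>n. fst z = a n)" "snd z \<in> mspace Y" by (auto simp: E_def)
      then show "q z \<in> topspace (mtopology_of X)"
        using qa q0 fX YX by (metis prod.collapse subsetD topspace_mtopology_of)
    qed
    fix U assume U: "openin (mtopology_of X) U"
    show "openin ?T {z \<in> topspace ?T. q z \<in> U}"
    proof (subst openin_subopen, intro ballI)
      fix z assume z: "z \<in> {z \<in> topspace ?T. q z \<in> U}"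
      then obtain s y where sy: "z = (s, y)" "s \<in> E" "y \<in> mspace Y" "q (s, y) \<in> U" by auto
      show "\<exists>N. openin ?T N \<and> z \<in> N \<and> N \<subseteq> {z \<in> topspace ?T. q z \<in> U}"
      proof (cases "s = 0")
        case False
        then obtain n where n: "s = a n" using sy(2) by (auto simp: E_def)
        have "openin (mtopology_of Y) {y \<in> topspace (mtopology_of Y). f n y \<in> U}"
          using fc U by (rule openin_continuous_map_preimage)
        then have "openin ?T ({a n} \<times> {y \<in> mspace Y. f n y \<in> U})"
          using isolated by (simp add: openin_prod_Times_iff)
        then show ?thesis
          using sy n by (intro exI[of _ "{a n} \<times> {y \<in> mspace Y. f n y \<in> U}"]) (auto simp: qa E_def)
      next
        case True
        then have yU: "y \<in> U" using sy q0 by simp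
        have "openin X.mtopology U" using U by (simp add: mtopology_of_def)
        then obtain \<epsilon> where \<epsilon>: "\<epsilon> > 0" "X.mball y \<epsilon> \<subseteq> U" using yU X.openin_mtopology by blast
        have "\<forall>\<^sub>F n in sequentially. \<forall>y'\<in>mspace Y. dist (mdist X (f n y') y') 0 < \<epsilon>/2"
          using \<epsilon>(1) by (intro uniform_limitD[OF lim]) simp
        then obtain N where N': "\<And>n y'. n \<ge> N \<Longrightarrow> y' \<in> mspace Y \<Longrightarrow> dist (mdist X (f n y') y') 0 < \<epsilon>/2"
          unfolding eventually_sequentially by blast
        have N: "mdist X (f n y') y' < \<epsilon>/2" if "n \<ge> N" "y' \<in> mspace Y" for n y'
          using N'[OF that] unfolding dist_real_def by linarith
        \<comment> \<open>An index below \<open>a N\<close> belongs to the limit sheet or to a sheet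
          beyond \<open>N\<close>. One half of \<open>\<epsilon>\<close> pays for moving from
          \<open>y\<close> to \<open>y'\<close>, the other for passing from \<open>y'\<close> to
          \<open>f n y'\<close>.\<close>
        let ?N = "(E \<inter> {..<a N}) \<times> {y' \<in> mspace Y. mdist X y y' < \<epsilon>/2}"
        have "openin (top_of_set E) (E \<inter> {..<a N})" by (intro openin_open_Int) simp
        moreover have "openin (mtopology_of Y) {y' \<in> mspace Y. mdist X y y' < \<epsilon>/2}"
          using YX dist sy(3) \<epsilon>(1) by (intro mtopology_of_subspace) auto
        ultimately have "openin ?T ?N" by (simp add: openin_prod_Times_iff)
        moreover have "z \<in> ?N" using sy True a_pos \<epsilon>(1) YX by (auto simp: E_def)
        moreover have "?N \<subseteq> {z \<in> topspace ?T. q z \<in> U}"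
        proof
          fix w assume "w \<in> ?N"
          then obtain s' y' where w: "w = (s', y')" "s' \<in> E" "s' < a N" "y' \<in> mspace Y" "mdist X y y' < \<epsilon>/2" by auto
          have "q (s', y') \<in> X.mball y \<epsilon>"
          proof (cases "s' = 0")
            case True
            then show ?thesis using w sy(3) YX \<epsilon>(1) by (auto simp: q0)
          next
            case False
            then obtain n where n: "s' = a n" using w(2) by (auto simp: E_def)
            then have "n \<ge> N" using w(3) a_less by simp
            then have "mdist X (f n y') y' < \<epsilon>/2" using N w(4) by simp
            moreover have "mdist X y (f n y') \<le> mdist X y y' + mdist X y' (f n y')"
              using w sy(3) YX fX by (intro X.triangle) auto
            ultimately have "mdist X y (f n y') < \<epsilon>" using w(5) X.commute[of "f n y'" y'] by simp
            then show ?thesis using sy(3) w(4) YX fX by (auto simp: n qa)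
          qed
          then show "w \<in> {z \<in> topspace ?T. q z \<in> U}" using \<epsilon>(2) w by auto
        qed
        ultimately show ?thesis by blast
      qed
    qed
  qed
  have "q ` (E \<times> mspace Y) = mspace X"
  proof (intro equalityI subsetI)
    fix x assume "x \<in> q ` (E \<times> mspace Y)"
    then show "x \<in> mspace X" using qa q0 fX YX by (auto simp: E_def)
  next
    fix x assume "x \<in> mspace X"
    then consider "x \<in> mspace Y" | n where "x \<in> f n ` mspace Y" using Z f_surj by auto
    then show "x \<in> q ` (E \<times> mspace Y)"
    proof cases
      case 1
      then show ?thesis by (intro image_eqI[of _ _ "(0, x)"]) (auto simp: q0 E_def)
    next
      case 2
      then obtain y where "x = f n y" "y \<in> mspace Y" by blast
      then show ?thesis by (intro image_eqI[of _ _ "(a n, y)"]) (auto simp: qa E_def)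
    qed
  qed
  moreover have "y = y' \<and> (s = s' \<or> y \<in> P)"
    if sE: "s \<in> E" "s' \<in> E" and y: "y \<in> mspace Y" "y' \<in> mspace Y" and eq: "q (s, y) = q (s', y')" for s s' y y'
  proof -
    have *: "y = y' \<and> y \<in> P" if "f n y = y'" "y \<in> mspace Y" "y' \<in> mspace Y" for n y y'
    proof (cases "y \<in> P")
      case True
      then show ?thesis using fP that by simp
    next
      case False
      then have "y' \<in> P" using distinct(1)[of y y' n] that by auto
      then have "f n y = f n y'" using fP that by simp
      then have "y = y'" by (rule f_inj) (rule that)+
      then show ?thesis using \<open>y' \<in> P\<close> by simp
    qed
    \<comment> \<open>For \<open>n \<noteq> m\<close> one of the two points lies in \<open>P\<close>
      and is fixed, which reduces the equation to the previous case.\<close>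
    have **: "y = y' \<and> (n = m \<or> y \<in> P)" if e: "f n y = f m y'" for n m
    proof (cases "n = m")
      case True
      then have "y = y'" using e by (intro f_inj[of n, OF _ y]) simp
      with True show ?thesis by simp
    next
      case False
      then consider "y \<in> P" | "y' \<in> P" using distinct(2)[of y y' n m] e y by auto
      then show ?thesis
      proof cases
        case 1
        then have "f m y' = y" using e fP by metis
        then show ?thesis using *[of m y' y] y by auto
      next
        case 2
        then have "f n y = y'" using e fP by metis
        then show ?thesis using *[of n y y'] y by auto
      qed
    qed
    consider "s = 0" "s' = 0" | m where "s = 0" "s' = a m" | n where "s = a n" "s' = 0"
      | n m where "s = a n" "s' = a m"
      using sE unfolding E_def by blast
    then show ?thesis
    proof cases
      case 1
      then show ?thesis using eq by (simp add: q0)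
    next
      case 2
      then show ?thesis using *[of m y' y] eq y by (auto simp: q0 qa)
    next
      case 3
      then show ?thesis using *[of n y y'] eq y by (auto simp: q0 qa)
    next
      case 4
      then show ?thesis using **[of n m] eq by (auto simp: qa)
    qed
  qed
  ultimately have "sheeted_space (mtopology_of X) (mtopology_of Y) E q P"
    using comp compE q_cont qP q0 P_sub P_fin isolated contracts X.Hausdorff_space_mtopology Y.Hausdorff_space_mtopology
    by unfold_locales (auto simp: E_def mtopology_of_def)
  moreover have "countable E" by (simp add: E_def)
  ultimately show ?thesis by blast
qed

theorem corollary3p15:
  fixes X Y :: "'a metric" and K :: "'b topology" and k :: nat
  assumes "finite_CW_complex K" and "mtopology_of Y homeomorphic_space K"
    and "convergent_space Y X"
    and "k \<ge> 2"
  shows "inj_on (iota_homology k (mtopology_of X))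
           (carrier (real_homology_group k (mtopology_of X)))"
proof -
  let ?T = "mtopology_of X"
  have "K homeomorphic_space mtopology_of Y" using assms(2) homeomorphic_space_sym by blast
  then obtain g where g: "homeomorphic_map K (mtopology_of Y) g" using homeomorphic_space by blast
  have "compact_space (mtopology_of Y)"
    using finite_CW_complex_properties(1)[OF assms(1)] homeomorphic_compact_space[OF assms(2)] by blast
  moreover have "contracts_at (mtopology_of Y) y" if "y \<in> mspace Y" for y
  proof -
    have "y \<in> g ` topspace K" using homeomorphic_imp_surjective_map[OF g] that by simp
    then obtain x where x: "x \<in> topspace K" "y = g x" by blast
    show ?thesis
      unfolding x(2) by (rule contracts_at_homeomorphic[OF g x(1) finite_CW_complex_properties(2)[OF assms(1) x(1)]])
  qed
  ultimately obtain E q P where sheeted: "countable E" "sheeted_space ?T (mtopology_of Y) E q P"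
    using convergent_space_sheeted[OF assms(3)] by blast
  note ac = add_closed_real_cycles[of k ?T, unfolded add_closed_def]
  note mc = add_closed_measure_boundaries[of k ?T, unfolded add_closed_def]
  show ?thesis
  proof (rule inj_onI)
    fix h h' assume h: "h \<in> carrier (real_homology_group k ?T)" "h' \<in> carrier (real_homology_group k ?T)"
      and eq: "iota_homology k ?T h = iota_homology k ?T h'"
    obtain c where c: "c \<in> real_cycle_set k ?T"
      "h = real_boundary_set k ?T #>\<^bsub>additive_monoid (real_cycle_set k ?T)\<^esub> c"
      using h(1) by (auto simp: real_homology_group_def carrier_FactGroup additive_monoid_def)
    obtain d where d: "d \<in> real_cycle_set k ?T"
      "h' = real_boundary_set k ?T #>\<^bsub>additive_monoid (real_cycle_set k ?T)\<^esub> d"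
      using h(2) by (auto simp: real_homology_group_def carrier_FactGroup additive_monoid_def)
    have "(\<lambda>t. t + iota_chain k ?T c) ` measure_boundary_set k ?T = (\<lambda>t. t + iota_chain k ?T d) ` measure_boundary_set k ?T"
      using eq unfolding c(2) d(2) iota_homology_coset[OF c(1)] iota_homology_coset[OF d(1)] unfolding r_coset_additive_monoid .
    moreover have "iota_chain k ?T c \<in> (\<lambda>t. t + iota_chain k ?T c) ` measure_boundary_set k ?T"
      using mc by (intro image_eqI[of _ _ 0]) auto
    \<comment> \<open>The image of \<open>c\<close> belongs to its own coset, hence to that of
      \<open>d\<close>: the two images differ by a boundary.\<close>
    ultimately obtain t where t: "t \<in> measure_boundary_set k ?T" "iota_chain k ?T c = t + iota_chain k ?T d" by auto
    have "iota_chain k ?T (c - d) + iota_chain k ?T d = iota_chain k ?T c"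
      by (simp flip: iota_chain_add)
    then have "iota_chain k ?T (c - d) \<in> measure_boundary_set k ?T" using t by simp
    moreover have "c - d \<in> real_cycle_set k ?T" using ac c(1) d(1) by (metis diff_conv_add_uminus)
    ultimately have cd: "c - d \<in> real_boundary_set k ?T"
      using sheeted by (intro sheeted_space_boundary)
    have "(\<lambda>t. t + c) ` real_boundary_set k ?T = (\<lambda>t. t + d) ` real_boundary_set k ?T"
    proof (intro equalityI subsetI)
      fix x assume "x \<in> (\<lambda>t. t + c) ` real_boundary_set k ?T"
      then obtain t where "t \<in> real_boundary_set k ?T" "x = (t + (c - d)) + d" by auto
      then show "x \<in> (\<lambda>t. t + d) ` real_boundary_set k ?T" using cd real_boundary_add by blast
    next
      fix x assume "x \<in> (\<lambda>t. t + d) ` real_boundary_set k ?T"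
      then obtain t where "t \<in> real_boundary_set k ?T" "x = (t - (c - d)) + c" by auto
      then show "x \<in> (\<lambda>t. t + c) ` real_boundary_set k ?T" using cd real_boundary_diff by blast
    qed
    then show "h = h'" unfolding c(2) d(2) r_coset_additive_monoid .
  qed
qed

end
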